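(* There exist absolute constants $C,c_1>0$ such that the following holds. Let $d,N,L\in\mathbb{N}$ with $d+2<N$ and let $\Phi:\mathbb{R}^d\to\mathbb{R}$ be a random ReLU network of width $N$ with $L$ hidden layers, as described in the context. Then: (1) for all $u,t\ge0$, $$\mathrm{Lip}(\Phi)\le C\Big(1+\frac{\sqrt d+t}{\sqrt N}\Big)\Big(2\sqrt2+\frac{\sqrt2\,t}{\sqrt N}\Big)^{L-1}\sqrt L\sqrt{\ln\!\Big(\frac{eN}{d+1}\Big)}(\sqrt d+u)$$ with probability at least $(1-2\exp(-u^2))_+\big((1-2\exp(-c_1t^2))_+\big)^L$; (2) $\mathbb{E}[\mathrm{Lip}(\Phi)]\le C\big(1+\frac{\sqrt d}{\sqrt N}\big)(2\sqrt2)^{L-1}\sqrt L\sqrt{\ln\!\big(\frac{eN}{d+1}\big)}\sqrt d$.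
   Context: A random ReLU network of width $N$ with $L$ hidden layers is $\Phi = V^{(L)}\circ\mathrm{ReLU}\circ V^{(L-1)}\circ\cdots\circ\mathrm{ReLU}\circ V^{(0)}$, where $\mathrm{ReLU}(t)=\max\{0,t\}$ acts componentwise and $V^{(\ell)}(x)=W^{(\ell)}x+b^{(\ell)}$ with $W^{(0)}\in\mathbb{R}^{N\times d}$, $W^{(\ell)}\in\mathbb{R}^{N\times N}$ for $1\le\ell\le L-1$, $W^{(L)}\in\mathbb{R}^{1\times N}$, $b^{(\ell)}\in\mathbb{R}^N$ for $\ell<L$, $b^{(L)}\in\mathbb{R}$. The entries of $W^{(\ell)}$, $0\le\ell<L$, are i.i.d. $\mathcal{N}(0,2/N)$; the entries of $W^{(L)}$ are i.i.d. $\mathcal{N}(0,1)$; $b^{(\ell)}_i\sim\mathcal{D}^{(\ell)}_i$ for arbitrary probability distributions on $\mathbb{R}$; all weights and biases are jointly independent. $\mathrm{Lip}(f)=\sup_{x\neq y}|f(x)-f(y)|/\|x-y\|_2$; $a_+=\max\{0,a\}$. *)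

theory Defs
  imports "HOL-Probability.Probability"
begin

text \<open>Random ReLU network of width N, L hidden layers, input dimension d.
  Parameters: weights W (l,i,j) = entry (i,j) of W^(l) (row i, column j, 0-based),
  biases b (l,i) = i-th entry of b^(l). Output layer l = L has a single row i = 0.\<close>

definition in_dim :: "nat \<Rightarrow> nat \<Rightarrow> nat \<Rightarrow> nat" where
  "in_dim d N l = (if l = 0 then d else N)"

definition weight_idx :: "nat \<Rightarrow> nat \<Rightarrow> nat \<Rightarrow> (nat \<times> nat \<times> nat) set" where
  "weight_idx d N L =
     {(l,i,j). l < L \<and> i < N \<and> j < in_dim d N l} \<union> {(l,i,j). l = L \<and> i = 0 \<and> j < N}"

definition bias_idx :: "nat \<Rightarrow> nat \<Rightarrow> (nat \<times> nat) set" where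
  "bias_idx N L = {(l,i). l < L \<and> i < N} \<union> {(L,0)}"

definition weight_dist :: "nat \<Rightarrow> nat \<Rightarrow> nat \<times> nat \<times> nat \<Rightarrow> real measure" where
  "weight_dist N L = (\<lambda>(l,i,j). if l = L then density lborel (normal_density 0 1)
                                 else density lborel (normal_density 0 (sqrt (2 / real N))))"

definition relu_net_measure ::
  "nat \<Rightarrow> nat \<Rightarrow> nat \<Rightarrow> (nat \<Rightarrow> nat \<Rightarrow> real measure)
     \<Rightarrow> ((nat \<times> nat \<times> nat \<Rightarrow> real) \<times> (nat \<times> nat \<Rightarrow> real)) measure" where
  "relu_net_measure d N L D =
     (PiM (weight_idx d N L) (weight_dist N L)) \<Otimes>\<^sub>M (PiM (bias_idx N L) (\<lambda>(l,i). D l i))"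

definition relu :: "real \<Rightarrow> real" where
  "relu t = max 0 t"

fun hidden :: "nat \<Rightarrow> nat \<Rightarrow> (nat \<times> nat \<times> nat \<Rightarrow> real) \<Rightarrow> (nat \<times> nat \<Rightarrow> real)
                 \<Rightarrow> (nat \<Rightarrow> real) \<Rightarrow> nat \<Rightarrow> (nat \<Rightarrow> real)" where
  "hidden d N W b x 0 = x"
| "hidden d N W b x (Suc l) =
     (\<lambda>i. if i < N then relu ((\<Sum>j<in_dim d N l. W (l,i,j) * hidden d N W b x l j) + b (l,i)) else 0)"

definition relu_net :: "nat \<Rightarrow> nat \<Rightarrow> nat \<Rightarrow> (nat \<times> nat \<times> nat \<Rightarrow> real) \<times> (nat \<times> nat \<Rightarrow> real)
                          \<Rightarrow> (nat \<Rightarrow> real) \<Rightarrow> real" where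
  "relu_net d N L \<omega> x =
     (\<Sum>j<N. fst \<omega> (L,0,j) * hidden d N (fst \<omega>) (snd \<omega>) x L j) + snd \<omega> (L,0)"

definition Rvec :: "nat \<Rightarrow> (nat \<Rightarrow> real) set" where
  "Rvec d = {x. \<forall>j\<ge>d. x j = 0}"

definition dist_d :: "nat \<Rightarrow> (nat \<Rightarrow> real) \<Rightarrow> (nat \<Rightarrow> real) \<Rightarrow> real" where
  "dist_d d x y = sqrt (\<Sum>j<d. (x j - y j)^2)"

text \<open>Lipschitz constant Lip(f) = sup over x \<noteq> y of |f x - f y| / ||x - y||_2
  (0 is inserted only to make the supremum well defined when d = 0).\<close>
definition Lip :: "nat \<Rightarrow> ((nat \<Rightarrow> real) \<Rightarrow> real) \<Rightarrow> real" where
  "Lip d f = Sup (insert 0 {\<bar>f x - f y\<bar> / dist_d d x y | x y. x \<in> Rvec d \<and> y \<in> Rvec d \<and> x \<noteq> y})"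

definition pos_part :: "real \<Rightarrow> real" where
  "pos_part a = max 0 a"

end

theory Submission
  imports Defs "HOL-Real_Asymp.Real_Asymp"
begin

text \<open>
  The network is piecewise affine, so its Lipschitz constant is at most the largest Euclidean norm of
  the gradients \<open>w\<^sup>T A\<close> of its affine pieces, where \<open>w\<close> is the output layer and \<open>A\<close> ranges over the
  finitely many matrices arising from activation patterns. In each layer, conditionally on the previous
  pattern, the new patterns are sign patterns of \<open>N\<close> affine functions on \<open>\<real>\<^sup>d\<close>; since \<open>d + 2\<close> such functions
  are never shattered, Sauer-Shelah bounds the number of pieces by \<open>(e N / (d + 1))\<close> to the power
  \<open>L (d + 1)\<close>. Conditionally on the hidden layers, \<open>w\<^sup>T A\<close> is Gaussian with
  \<open>E exp (t \<bar>w\<^sup>T A\<bar>) \<le> exp (t R sqrt d + t\<^sup>2 R\<^sup>2 / 2)\<close>, where \<open>R\<close> is the product of the operator norms of the hidden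
  layers, and a union bound over the pieces gives both the tail and the mean. The sharp constant
  \<open>2 sqrt 2\<close> per layer requires the sharp estimate
  \<open>E exp (t \<parallel>G\<parallel>) \<le> exp (t s (sqrt m + sqrt n) + t\<^sup>2 s\<^sup>2 / 2)\<close> for an \<open>m \<times> n\<close> matrix \<open>G\<close> with independent \<open>N(0, s\<^sup>2)\<close>
  entries; it follows from Slepian's interpolation argument applied to the functional
  \<open>(\<Sum>k. exp (\<beta> x\<^sub>k)) powr \<alpha>\<close>, which tends to \<open>exp (t max x)\<close> as \<open>\<alpha> \<rightarrow> 0\<close> with \<open>\<alpha> \<beta> = t\<close>, and it yields
  the concentration and the mean of \<open>\<parallel>G\<parallel>\<close> at once. The bounds then multiply by independence of the layers.
\<close>

section \<open>Sign patterns of affine functions\<close>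

text \<open>The activation patterns depend on the hidden weights, so patterns and layer matrices are
  not independent. Two facts make this harmless. The count of the pieces holds for every fixed
  choice of hidden weights and biases, so the union bound involves only the output weights, which
  the pieces do not read. And setting rows to zero never increases a Euclidean norm, so the product
  of the layer norms controls all pieces at once, with no union over patterns inside the hidden
  layers. The logarithm of the number of pieces therefore enters once, through a square root added
  to \<open>sqrt d\<close>, and not in the base of the power \<open>L - 1\<close>. That base is
  \<open>sqrt (2 / N) * (sqrt N + sqrt N) = 2 * sqrt 2\<close>; a constant factor lost on one layer,
  as a net on the spheres would lose it, would be raised to the power \<open>L - 1\<close>, which is
  why the norm estimate has to be sharp. The biases are fixed in all these estimates, hence their
  laws can be arbitrary. Integrals are taken in \<open>ennreal\<close>, so that means follow from
  exponential moments before integrability is known.\<close>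

lemma sauer_shelah_pajor:
  assumes "finite X" "F \<subseteq> Pow X"
  shows "card F \<le> card {S. S \<subseteq> X \<and> (\<forall>T\<subseteq>S. \<exists>A\<in>F. A \<inter> S = T)}"
  using assms
proof (induction X arbitrary: F rule: finite_induct)
  case empty
  then have "F = {} \<or> F = {{}}" by auto
  then show ?case
  proof
    assume F: "F = {{}}"
    have "{S. S \<subseteq> {} \<and> (\<forall>T\<subseteq>S. \<exists>A\<in>F. A \<inter> S = T)} = {{}}" using F by auto
    then show ?thesis using F by simp
  qed simp
next
  case (insert x X)
  let ?sh = "\<lambda>Y G. {S. S \<subseteq> Y \<and> (\<forall>T\<subseteq>S. \<exists>A\<in>G. A \<inter> S = T)}"
  \<comment> \<open>Split \<open>F\<close> by membership of \<open>x\<close>; \<open>Q\<close>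
    strips \<open>x\<close> from the members that contain it. A set shattered by
    \<open>P \<inter> Q\<close> stays shattered by \<open>F\<close> after adding \<open>x\<close>,
    because each of its traces is realised both with and without \<open>x\<close>.\<close>
  define P where "P = {A\<in>F. x \<notin> A}"
  define R where "R = {A\<in>F. x \<in> A}"
  define Q where "Q = (\<lambda>A. A - {x}) ` R"
  have finF: "finite F" using insert by (meson finite.insertI finite_Pow_iff finite_subset)
  have "inj_on (\<lambda>A. A - {x}) R" unfolding R_def inj_on_def by auto
  then have cQ: "card Q = card R" unfolding Q_def by (rule card_image)
  have fin: "finite P" "finite Q" "finite R" using finF by (auto simp: P_def Q_def R_def)
  have "F = P \<union> R" "P \<inter> R = {}" by (auto simp: P_def R_def)
  then have "card F = card P + card R" using fin by (simp add: card_Un_disjoint)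
  also have "\<dots> = card (P \<union> Q) + card (P \<inter> Q)" using card_Un_Int[of P Q] fin cQ by simp
  also have "\<dots> \<le> card (?sh X (P \<union> Q)) + card (?sh X (P \<inter> Q))"
    using insert.prems insert.hyps by (intro add_mono insert.IH) (auto simp: P_def Q_def R_def)
  also have "card (?sh X (P \<inter> Q)) = card (insert x ` ?sh X (P \<inter> Q))"
  proof (rule card_image[symmetric])
    show "inj_on (insert x) (?sh X (P \<inter> Q))"
      using insert.hyps by (intro inj_onI) (metis (no_types, lifting) insert_ident mem_Collect_eq subsetD)
  qed
  also have "card (?sh X (P \<union> Q)) + \<dots> = card (?sh X (P \<union> Q) \<union> insert x ` ?sh X (P \<inter> Q))"
  proof (rule card_Un_disjoint[symmetric])
    show "finite (?sh X (P \<union> Q))" "finite (insert x ` ?sh X (P \<inter> Q))"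
      using insert.hyps by simp_all
    show "?sh X (P \<union> Q) \<inter> insert x ` ?sh X (P \<inter> Q) = {}" using insert.hyps by blast
  qed
  also have "\<dots> \<le> card (?sh (insert x X) F)"
  proof (rule card_mono)
    show "finite (?sh (insert x X) F)" using insert.hyps by simp
    show "?sh X (P \<union> Q) \<union> insert x ` ?sh X (P \<inter> Q) \<subseteq> ?sh (insert x X) F"
    proof
      fix S assume "S \<in> ?sh X (P \<union> Q) \<union> insert x ` ?sh X (P \<inter> Q)"
      then show "S \<in> ?sh (insert x X) F"
      proof
        assume "S \<in> ?sh X (P \<union> Q)"
        then have SX: "S \<subseteq> X" and S: "\<And>T. T \<subseteq> S \<Longrightarrow> \<exists>A\<in>P \<union> Q. A \<inter> S = T" by simp_all
        have xS: "x \<notin> S" using insert.hyps SX by blast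
        have "\<exists>A\<in>F. A \<inter> S = T" if TS: "T \<subseteq> S" for T
        proof -
          obtain B where B: "B \<in> P \<union> Q" "B \<inter> S = T" using S[OF TS] by blast
          show ?thesis
          proof (cases "B \<in> P")
            case True then show ?thesis using B by (auto simp: P_def)
          next
            case False
            then obtain A where "A \<in> R" "B = A - {x}" using B by (auto simp: Q_def)
            then show ?thesis using B xS by (intro bexI[of _ A]) (auto simp: R_def)
          qed
        qed
        then show ?thesis using SX by blast
      next
        assume "S \<in> insert x ` ?sh X (P \<inter> Q)"
        then obtain S' where S': "S = insert x S'" "S' \<in> ?sh X (P \<inter> Q)" by (rule imageE)
        have SX: "S' \<subseteq> X" and SH: "\<And>T. T \<subseteq> S' \<Longrightarrow> \<exists>A\<in>P \<inter> Q. A \<inter> S' = T"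
          using S'(2) by simp_all
        have xS: "x \<notin> S'" using insert.hyps SX by blast
        have "\<exists>A\<in>F. A \<inter> S = T" if TS: "T \<subseteq> S" for T
        proof -
          have "T - {x} \<subseteq> S'" using TS S'(1) by auto
          then obtain B where B: "B \<in> P \<inter> Q" "B \<inter> S' = T - {x}" using SH by blast
          then obtain A where A: "A \<in> R" "B = A - {x}" by (auto simp: Q_def)
          show ?thesis
          proof (cases "x \<in> T")
            case True
            then show ?thesis using A B S'(1) xS TS by (intro bexI[of _ A]) (auto simp: R_def)
          next
            case False
            then show ?thesis using B S'(1) xS TS by (intro bexI[of _ B]) (auto simp: P_def)
          qed
        qed
        then show ?thesis using S'(1) SX by blast
      qed
    qed
  qed
  finally show ?case .
qed

text \<open>Gaussian elimination: a pivot for the last equation removes one unknown together with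
  one equation, so unknowns remain in excess throughout.\<close>

lemma homogeneous_system_nontrivial:
  fixes a :: "'i \<Rightarrow> nat \<Rightarrow> real"
  assumes "finite S" "n < card S"
  shows "\<exists>c. (\<exists>i\<in>S. c i \<noteq> 0) \<and> (\<forall>k<n. (\<Sum>i\<in>S. c i * a i k) = 0)"
  using assms
proof (induction n arbitrary: S a)
  case 0
  then have "S \<noteq> {}" by auto
  then show ?case by (intro exI[of _ "\<lambda>_. 1"]) auto
next
  case (Suc n)
  show ?case
  proof (cases "\<forall>i\<in>S. a i n = 0")
    case True
    obtain c where "\<exists>i\<in>S. c i \<noteq> 0" "\<forall>k<n. (\<Sum>i\<in>S. c i * a i k) = 0"
      using Suc.IH[of S a] Suc.prems by auto
    then show ?thesis using True by (intro exI[of _ c]) (auto simp: less_Suc_eq)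
  next
    case False
    then obtain p where p: "p \<in> S" "a p n \<noteq> 0" by auto
    define S' where "S' = S - {p}"
    have S': "finite S'" "n < card S'" "p \<notin> S'" "S = insert p S'"
      using Suc.prems p by (auto simp: S'_def)
    define a' where "a' i k = a i k - a i n / a p n * a p k" for i k
    obtain c where c: "\<exists>i\<in>S'. c i \<noteq> 0" "\<forall>k<n. (\<Sum>i\<in>S'. c i * a' i k) = 0"
      using Suc.IH[of S' a'] S' by auto
    \<comment> \<open>The value at \<open>p\<close> is forced by equation \<open>n\<close>;
      substituting it into the others turns the coefficients \<open>a\<close> into
      \<open>a'\<close>.\<close>
    define e where "e = c(p := - (\<Sum>i\<in>S'. c i * a i n) / a p n)"
    have "(\<Sum>i\<in>S. e i * a i k) = (\<Sum>i\<in>S'. c i * a' i k)" for k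
    proof -
      have "(\<Sum>i\<in>S. e i * a i k) = e p * a p k + (\<Sum>i\<in>S'. e i * a i k)"
        using S' by simp
      also have "(\<Sum>i\<in>S'. e i * a i k) = (\<Sum>i\<in>S'. c i * a i k)"
        using S' by (intro sum.cong) (auto simp: e_def)
      also have "e p * a p k = (\<Sum>i\<in>S'. - (c i * (a i n / a p n * a p k)))"
        by (simp add: e_def sum_negf sum_distrib_left sum_distrib_right sum_divide_distrib mult_ac)
      finally show ?thesis by (simp add: a'_def sum.distrib[symmetric] algebra_simps)
    qed
    moreover have "(\<Sum>i\<in>S'. c i * a' i n) = 0" using p by (simp add: a'_def)
    ultimately have "\<forall>k<Suc n. (\<Sum>i\<in>S. e i * a i k) = 0" using c by (simp add: less_Suc_eq)
    moreover have "\<exists>i\<in>S. e i \<noteq> 0" using c S' by (force simp: e_def)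
    ultimately show ?thesis by blast
  qed
qed

text \<open>Affine functions on d-dimensional space form a space of dimension \<open>d + 1\<close>,
  so \<open>d + 2\<close> of them satisfy a linear relation with coefficients \<open>c\<close>. The
  pattern "positive exactly where \<open>c\<close> is positive" would make every term of the
  relation nonnegative and one strictly positive, although the sum vanishes identically.\<close>

lemma affine_sign_patterns_not_shattered:
  fixes a :: "nat \<Rightarrow> nat \<Rightarrow> real" and b :: "nat \<Rightarrow> real"
  assumes "finite S" "d + 1 < card S"
  shows "\<exists>T\<subseteq>S. \<forall>x. {i\<in>S. 0 < (\<Sum>k<d. a i k * x k) + b i} \<noteq> T"
proof -
  define a' where "a' i k = (if k < d then a i k else b i)" for i k
  obtain c0 where c0: "\<exists>i\<in>S. c0 i \<noteq> 0" "\<forall>k<d+1. (\<Sum>i\<in>S. c0 i * a' i k) = 0"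
    using homogeneous_system_nontrivial[OF assms, of a'] by auto
  obtain p where p: "p \<in> S" "c0 p \<noteq> 0" using c0 by auto
  \<comment> \<open>The sign is chosen so that some coefficient is strictly positive. With all
    coefficients nonpositive, \<open>T\<close> would be empty and the vanishing of all functions
    would be no contradiction.\<close>
  define c where "c i = c0 i * sgn (c0 p)" for i
  have cp: "c p > 0" using p by (simp add: c_def sgn_if)
  have c: "(\<Sum>i\<in>S. c i * a' i k) = 0" if "k < d+1" for k
  proof -
    have "(\<Sum>i\<in>S. c i * a' i k) = sgn (c0 p) * (\<Sum>i\<in>S. c0 i * a' i k)"
      by (simp add: c_def sum_distrib_left mult_ac)
    then show ?thesis using c0 that by simp
  qed
  define T where "T = {i\<in>S. c i > 0}"
  have "{i\<in>S. 0 < (\<Sum>k<d. a i k * x k) + b i} \<noteq> T" for x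
  proof
    assume eq: "{i\<in>S. 0 < (\<Sum>k<d. a i k * x k) + b i} = T"
    let ?f = "\<lambda>i. (\<Sum>k<d. a i k * x k) + b i"
    have sg: "0 < ?f i \<longleftrightarrow> 0 < c i" if "i \<in> S" for i using eq that by (auto simp: T_def)
    have "(\<Sum>i\<in>S. c i * ?f i) = (\<Sum>k<d. x k * (\<Sum>i\<in>S. c i * a' i k)) + (\<Sum>i\<in>S. c i * a' i d)"
      by (simp add: a'_def distrib_left sum.distrib sum_distrib_left mult_ac sum.swap[of _ S])
    also have "\<dots> = 0" using c by simp
    finally have z: "(\<Sum>i\<in>S. c i * ?f i) = 0" .
    have "0 < c i * ?f i \<or> 0 \<le> c i * ?f i" if "i \<in> S" for i
      using sg[OF that] by (metis linorder_not_less mult_nonpos_nonpos mult_pos_pos)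
    then have nn: "0 \<le> c i * ?f i" if "i \<in> S" for i using that by force
    have "0 < c p * ?f p" using sg[OF p(1)] cp by simp
    then have "0 < (\<Sum>i\<in>S. c i * ?f i)" using nn p(1) assms(1) by (intro sum_pos2[of _ p]) auto
    then show False using z by simp
  qed
  moreover have "T \<subseteq> S" by (auto simp: T_def)
  ultimately show ?thesis by blast
qed

lemma card_affine_sign_patterns:
  fixes a :: "nat \<Rightarrow> nat \<Rightarrow> real" and b :: "nat \<Rightarrow> real"
  shows "card (range (\<lambda>x. {i. i < N \<and> 0 < (\<Sum>k<d. a i k * x k) + b i})) \<le> (\<Sum>j\<le>d+1. N choose j)"
proof -
  let ?F = "range (\<lambda>x. {i. i < N \<and> 0 < (\<Sum>k<d. a i k * x k) + b i})"
  have "card ?F \<le> card {S. S \<subseteq> {..<N} \<and> (\<forall>T\<subseteq>S. \<exists>A\<in>?F. A \<inter> S = T)}"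
    by (rule sauer_shelah_pajor) auto
  also have "\<dots> \<le> card (\<Union>j\<le>d+1. {S. S \<subseteq> {..<N} \<and> card S = j})"
  proof (rule card_mono)
    show "finite (\<Union>j\<le>d+1. {S. S \<subseteq> {..<N} \<and> card S = j})" by auto
    show "{S. S \<subseteq> {..<N} \<and> (\<forall>T\<subseteq>S. \<exists>A\<in>?F. A \<inter> S = T)} \<subseteq> (\<Union>j\<le>d+1. {S. S \<subseteq> {..<N} \<and> card S = j})"
    proof safe
      fix S assume S: "S \<subseteq> {..<N}" "\<forall>T\<subseteq>S. \<exists>A\<in>?F. A \<inter> S = T"
      have "finite S" using S finite_subset by blast
      have "\<not> d + 1 < card S"
      proof
        assume "d + 1 < card S"
        from affine_sign_patterns_not_shattered[OF \<open>finite S\<close> this, of a b] obtain T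
          where T: "T \<subseteq> S" "\<And>x. {i\<in>S. 0 < (\<Sum>k<d. a i k * x k) + b i} \<noteq> T" by auto
        then obtain x where "{i. i < N \<and> 0 < (\<Sum>k<d. a i k * x k) + b i} \<inter> S = T" using S by blast
        then show False using T(2)[of x] S by blast
      qed
      then show "S \<in> (\<Union>j\<le>d+1. {S. S \<subseteq> {..<N} \<and> card S = j})" using S by auto
    qed
  qed
  also have "\<dots> \<le> (\<Sum>j\<le>d+1. card {S. S \<subseteq> {..<N} \<and> card S = j})"
    by (rule card_UN_le) simp
  also have "\<dots> = (\<Sum>j\<le>d+1. N choose j)" by (simp add: n_subsets)
  finally show ?thesis .
qed

text \<open>Weight the sum by \<open>r ^ m\<close> with \<open>r = m / N \<le> 1\<close>. Replacing
  \<open>r ^ m\<close> by \<open>r ^ j\<close> only increases the terms, and the completed sum is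
  \<open>(1 + r) ^ N \<le> exp (r * N) = exp m\<close>.\<close>

lemma sum_binomial_le:
  assumes "0 < m" "m \<le> N"
  shows "real (\<Sum>j\<le>m. N choose j) \<le> (exp 1 * real N / real m) ^ m"
proof -
  have N: "0 < N" using assms by simp
  let ?r = "real m / real N"
  have r: "0 < ?r" "?r \<le> 1" using assms N by auto
  have "real (\<Sum>j\<le>m. N choose j) * ?r ^ m = (\<Sum>j\<le>m. real (N choose j) * ?r ^ m)"
    by (simp add: sum_distrib_right)
  also have "\<dots> \<le> (\<Sum>j\<le>m. real (N choose j) * ?r ^ j)"
    using r by (intro sum_mono mult_left_mono power_decreasing) auto
  also have "\<dots> \<le> (\<Sum>j\<le>N. real (N choose j) * ?r ^ j)"
    using assms r by (intro sum_mono2) auto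
  also have "\<dots> = (?r + 1) ^ N" by (simp add: binomial_ring mult_ac)
  also have "\<dots> \<le> exp ?r ^ N" using r by (intro power_mono) (auto simp: add.commute)
  also have "\<dots> = exp 1 ^ m" using N by (simp add: exp_of_nat_mult[symmetric])
  finally show ?thesis using r N assms by (simp add: power_mult_distrib power_divide field_simps)
qed

section \<open>Gaussian integrals\<close>

definition gauss :: "real \<Rightarrow> real measure" where
  "gauss s = density lborel (normal_density 0 s)"

lemma prob_space_gauss: "0 < s \<Longrightarrow> prob_space (gauss s)"
  unfolding gauss_def by (rule prob_space_normal_density)

lemma sets_gauss [simp, measurable_cong]: "sets (gauss s) = sets borel"
  by (simp add: gauss_def)

lemma product_sigma_finite_gauss: "0 < s \<Longrightarrow> product_sigma_finite (\<lambda>i. gauss s)"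
  by (simp add: prob_space_gauss prob_space_imp_sigma_finite product_sigma_finite.intro)

lemma prob_space_PiM_gauss: "0 < s \<Longrightarrow> prob_space (PiM I (\<lambda>i. gauss s))"
  by (simp add: prob_space_PiM prob_space_gauss)

lemma nn_integral_gauss:
  assumes [measurable]: "f \<in> borel_measurable borel"
  shows "(\<integral>\<^sup>+x. f x \<partial>gauss s) = (\<integral>\<^sup>+x. ennreal (normal_density 0 s x) * f x \<partial>lborel)"
  unfolding gauss_def by (subst nn_integral_density) auto

lemma integral_gauss:
  fixes f :: "real \<Rightarrow> real"
  assumes [measurable]: "f \<in> borel_measurable borel"
  shows "(\<integral>x. f x \<partial>gauss s) = (\<integral>x. normal_density 0 s x * f x \<partial>lborel)"
  unfolding gauss_def by (subst integral_density) auto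

lemma integrable_gauss:
  fixes f :: "real \<Rightarrow> real"
  assumes [measurable]: "f \<in> borel_measurable borel"
  shows "integrable (gauss s) f \<longleftrightarrow> integrable lborel (\<lambda>x. normal_density 0 s x * f x)"
  unfolding gauss_def by (subst integrable_density) auto

text \<open>Completing the square: an exponential tilt shifts the mean, so exponential moments
  reduce to the total mass of a shifted density.\<close>

lemma normal_density_exp_linear:
  assumes "0 < s"
  shows "normal_density 0 s x * exp (a * x) = exp (a\<^sup>2 * s\<^sup>2 / 2) * normal_density (a * s\<^sup>2) s x"
proof -
  have "- (x - 0)\<^sup>2 / (2 * s\<^sup>2) + a * x = a\<^sup>2 * s\<^sup>2 / 2 + - (x - a * s\<^sup>2)\<^sup>2 / (2 * s\<^sup>2)"
    using assms by (simp add: field_simps power2_eq_square)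
  then show ?thesis
    unfolding normal_density_def by (simp add: exp_add[symmetric])
qed

lemma nn_integral_gauss_exp_linear:
  assumes "0 < s"
  shows "(\<integral>\<^sup>+x. exp (a * x) \<partial>gauss s) = exp (a\<^sup>2 * s\<^sup>2 / 2)"
proof -
  have "(\<integral>\<^sup>+x. exp (a * x) \<partial>gauss s) =
      (\<integral>\<^sup>+x. ennreal (exp (a\<^sup>2 * s\<^sup>2 / 2)) * ennreal (normal_density (a * s\<^sup>2) s x) \<partial>lborel)"
    using normal_density_exp_linear[OF assms]
    by (subst nn_integral_gauss) (auto intro!: nn_integral_cong simp: ennreal_mult'[symmetric])
  also have "\<dots> = exp (a\<^sup>2 * s\<^sup>2 / 2) * (\<integral>\<^sup>+x. ennreal (normal_density (a * s\<^sup>2) s x) \<partial>lborel)"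
    by (rule nn_integral_cmult) simp
  also have "(\<integral>\<^sup>+x. ennreal (normal_density (a * s\<^sup>2) s x) \<partial>lborel) = 1"
    using assms integral_normal_density[of s "a * s\<^sup>2"]
    by (subst nn_integral_eq_integral) (auto)
  finally show ?thesis by simp
qed

lemma nn_integral_gauss_exp_square:
  assumes "0 < s" "2 * t * s\<^sup>2 < 1"
  shows "(\<integral>\<^sup>+x. exp (t * x\<^sup>2) \<partial>gauss s) = ennreal (1 / sqrt (1 - 2 * t * s\<^sup>2))"
proof -
  \<comment> \<open>The factor \<open>exp (t * x^2)\<close> turns the density of deviation
    \<open>s\<close> into \<open>1 / q\<close> times the density of deviation
    \<open>s / q\<close>.\<close>
  define q where "q = sqrt (1 - 2 * t * s\<^sup>2)"
  have q: "q > 0" "q\<^sup>2 = 1 - 2 * t * s\<^sup>2" using assms by (auto simp: q_def)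
  have *: "normal_density 0 s x * exp (t * x\<^sup>2) = 1 / q * normal_density 0 (s / q) x" for x
  proof -
    have "- (x - 0)\<^sup>2 / (2 * s\<^sup>2) + t * x\<^sup>2 = - x\<^sup>2 * (1 - 2 * t * s\<^sup>2) / (2 * s\<^sup>2)"
      using assms by (simp add: field_simps)
    also have "\<dots> = - (x - 0)\<^sup>2 / (2 * (s / q)\<^sup>2)"
      by (simp add: power_divide q(2))
    finally have e: "exp (- (x - 0)\<^sup>2 / (2 * s\<^sup>2)) * exp (t * x\<^sup>2) = exp (- (x - 0)\<^sup>2 / (2 * (s / q)\<^sup>2))"
      by (simp add: exp_add[symmetric])
    have "sqrt (2 * pi * (s / q)\<^sup>2) = sqrt (2 * pi * s\<^sup>2) / q"
      using q(1) by (simp add: power_divide real_sqrt_divide real_sqrt_mult)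
    then have "normal_density 0 (s / q) x = q * (1 / sqrt (2 * pi * s\<^sup>2)) * exp (- (x - 0)\<^sup>2 / (2 * (s / q)\<^sup>2))"
      by (simp add: normal_density_def)
    then show ?thesis
      unfolding e[symmetric] using q(1) by (simp add: normal_density_def)
  qed
  have "(\<integral>\<^sup>+x. exp (t * x\<^sup>2) \<partial>gauss s) =
      (\<integral>\<^sup>+x. ennreal (1 / q) * ennreal (normal_density 0 (s / q) x) \<partial>lborel)"
    using * q by (subst nn_integral_gauss) (auto intro!: nn_integral_cong simp: ennreal_mult'[symmetric])
  also have "\<dots> = ennreal (1 / q) * (\<integral>\<^sup>+x. ennreal (normal_density 0 (s / q) x) \<partial>lborel)"
    by (rule nn_integral_cmult) simp
  also have "(\<integral>\<^sup>+x. ennreal (normal_density 0 (s / q) x) \<partial>lborel) = 1"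
    using assms q integral_normal_density[of "s / q" 0]
    by (subst nn_integral_eq_integral) (auto)
  finally show ?thesis by (simp add: q_def)
qed

lemma exp_abs_le: "exp (a * \<bar>x\<bar>) \<le> exp (a * x) + exp (- a * x)" for a x :: real
  by (cases "x \<ge> 0") auto

lemma integrable_gauss_exp_abs:
  assumes "0 < s"
  shows "integrable (gauss s) (\<lambda>x. exp (a * \<bar>x\<bar>))"
proof -
  have "integrable (gauss s) (\<lambda>x. exp (b * x))" for b
    by (subst integrable_gauss) (auto simp: normal_density_exp_linear assms)
  then have "integrable (gauss s) (\<lambda>x. exp (a * x) + exp (- a * x))" by (intro Bochner_Integration.integrable_add)
  then show ?thesis
    by (rule Bochner_Integration.integrable_bound) (use exp_abs_le[of a] in auto)
qed

lemma abs_mult_exp_le: "\<bar>x\<bar> * exp (a * \<bar>x\<bar>) \<le> exp ((a + 1) * \<bar>x\<bar>)" for a x :: real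
proof -
  have "\<bar>x\<bar> \<le> exp \<bar>x\<bar>" using exp_ge_add_one_self[of "\<bar>x\<bar>"] by linarith
  then have "\<bar>x\<bar> * exp (a * \<bar>x\<bar>) \<le> exp \<bar>x\<bar> * exp (a * \<bar>x\<bar>)" by (intro mult_right_mono) auto
  then show ?thesis by (simp add: exp_add[symmetric] algebra_simps)
qed

lemma normal_density_exp_abs_tendsto_0:
  assumes "0 < s"
  shows "((\<lambda>x. normal_density 0 s x * exp (a * \<bar>x\<bar>)) \<longlongrightarrow> 0) at_top"
    and "((\<lambda>x. normal_density 0 s x * exp (a * \<bar>x\<bar>)) \<longlongrightarrow> 0) at_bot"
proof -
  let ?g = "\<lambda>b x. exp (b\<^sup>2 * s\<^sup>2 / 2) * normal_density (b * s\<^sup>2) s x"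
  have le: "norm (normal_density 0 s x * exp (a * \<bar>x\<bar>)) \<le> ?g a x + ?g (- a) x" for x
  proof -
    have "normal_density 0 s x * exp (a * \<bar>x\<bar>) \<le> normal_density 0 s x * (exp (a * x) + exp (- a * x))"
      by (intro mult_left_mono exp_abs_le) simp
    also have "\<dots> = ?g a x + ?g (- a) x"
      unfolding distrib_left using normal_density_exp_linear[OF assms, of x] by metis
    finally show ?thesis by simp
  qed
  have t: "((\<lambda>x. ?g b x) \<longlongrightarrow> 0) at_top" for b
    unfolding normal_density_def using assms by real_asymp
  have b: "((\<lambda>x. ?g b x) \<longlongrightarrow> 0) at_bot" for b
    unfolding normal_density_def using assms by real_asymp
  show "((\<lambda>x. normal_density 0 s x * exp (a * \<bar>x\<bar>)) \<longlongrightarrow> 0) at_top"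
    by (rule Lim_null_comparison[OF always_eventually[OF allI[OF le]] tendsto_add_zero[OF t[of a] t[of "- a"]]])
  show "((\<lambda>x. normal_density 0 s x * exp (a * \<bar>x\<bar>)) \<longlongrightarrow> 0) at_bot"
    by (rule Lim_null_comparison[OF always_eventually[OF allI[OF le]] tendsto_add_zero[OF b[of a] b[of "- a"]]])
qed

text \<open>Stein's identity. The product of the density and \<open>F\<close> has derivative
  \<open>f\<close> and tends to zero at both ends, so \<open>f\<close> integrates to zero. The
  growth condition is the one satisfied by the derivatives of the soft maximum below.\<close>

lemma gauss_integration_by_parts:
  fixes F F' :: "real \<Rightarrow> real"
  assumes s: "0 < s"
    and F: "\<And>x. (F has_real_derivative F' x) (at x)"
    and contF': "continuous_on UNIV F'"
    and bF: "\<And>x. \<bar>F x\<bar> \<le> C * exp (a * \<bar>x\<bar>)"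
    and bF': "\<And>x. \<bar>F' x\<bar> \<le> C * exp (a * \<bar>x\<bar>)"
  shows "(\<integral>x. x * F x \<partial>gauss s) = s\<^sup>2 * (\<integral>x. F' x \<partial>gauss s)"
proof -
  have contF: "continuous_on UNIV F"
    using F by (meson DERIV_isCont continuous_at_imp_continuous_on)
  have [measurable]: "F \<in> borel_measurable borel" "F' \<in> borel_measurable borel"
    using contF contF' by (auto intro: borel_measurable_continuous_onI)
  let ?p = "normal_density 0 s"
  have iF': "integrable (gauss s) F'"
    by (rule Bochner_Integration.integrable_bound[OF integrable_mult_right[OF integrable_gauss_exp_abs[OF s, of a], of C]])
       (use bF' in \<open>auto intro: order_trans[OF _ abs_ge_self]\<close>)
  have ixF: "integrable (gauss s) (\<lambda>x. x * F x)"
  proof (rule Bochner_Integration.integrable_bound[OF integrable_mult_right[OF integrable_gauss_exp_abs[OF s, of "a + 1"], of C]])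
    have C: "0 \<le> C" using bF[of 0] by simp
    show "AE x in gauss s. norm (x * F x) \<le> norm (C * exp ((a + 1) * \<bar>x\<bar>))"
    proof (rule AE_I2)
      fix x
      have "norm (x * F x) \<le> \<bar>x\<bar> * (C * exp (a * \<bar>x\<bar>))"
        using bF by (auto simp: abs_mult intro!: mult_left_mono)
      also have "\<dots> \<le> C * exp ((a + 1) * \<bar>x\<bar>)"
        using mult_left_mono[OF abs_mult_exp_le[of x a] C] by (simp add: mult_ac)
      finally show "norm (x * F x) \<le> norm (C * exp ((a + 1) * \<bar>x\<bar>))" using C by simp
    qed
  qed auto
  have i1: "integrable lborel (\<lambda>x. ?p x * F' x)" and i2: "integrable lborel (\<lambda>x. ?p x * (x * F x))"
    using iF' ixF by (simp_all add: integrable_gauss)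
  define f where "f x = ?p x * F' x - ?p x * (x * F x) / s\<^sup>2" for x
  have intf: "integrable lborel f" unfolding f_def using i1 i2 by auto
  have dp: "(?p has_real_derivative - (x / s\<^sup>2) * ?p x) (at x)" for x
    unfolding normal_density_def using s
    by (auto intro!: derivative_eq_intros simp: field_simps power2_eq_square)
  have d: "((\<lambda>x. ?p x * F x) has_real_derivative f x) (at x)" for x
    by (rule derivative_eq_intros dp F refl)+ (simp add: f_def)
  have contp: "continuous_on UNIV ?p" using dp by (meson DERIV_isCont continuous_at_imp_continuous_on)
  have contf: "isCont f x" for x
  proof -
    have "continuous_on UNIV f" unfolding f_def using contp contF contF' s by (intro continuous_intros) auto
    then show ?thesis by (simp add: continuous_on_eq_continuous_at)
  qed
  have C0: "0 \<le> C" using bF[of 0] by simp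
  have le: "norm (?p x * F x) \<le> C * (?p x * exp (a * \<bar>x\<bar>))" for x
    using mult_left_mono[OF bF[of x], of "?p x"] by (simp add: abs_mult mult_ac)
  have A: "((\<lambda>x. ?p x * F x) \<longlongrightarrow> 0) at_bot"
    by (rule Lim_null_comparison[OF always_eventually[OF allI[OF le]]
          tendsto_mult_right_zero[OF normal_density_exp_abs_tendsto_0(2)[OF s]]])
  have B: "((\<lambda>x. ?p x * F x) \<longlongrightarrow> 0) at_top"
    by (rule Lim_null_comparison[OF always_eventually[OF allI[OF le]]
          tendsto_mult_right_zero[OF normal_density_exp_abs_tendsto_0(1)[OF s]]])
  have "(LBINT x=-\<infinity>..\<infinity>. f x) = 0 - 0"
  proof (rule interval_integral_FTC_integrable)
    show "((\<lambda>x. ?p x * F x) has_vector_derivative f x) (at x)" for x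
      using d by (simp add: has_real_derivative_iff_has_vector_derivative)
    show "set_integrable lborel (einterval (-\<infinity>) \<infinity>) f"
      using intf by (simp add: set_integrable_def einterval_def)
    show "(((\<lambda>x. ?p x * F x) \<circ> real_of_ereal) \<longlongrightarrow> 0) (at_right (-\<infinity>))"
      by (rule ereal_tendsto_simps1(4)[THEN iffD2, OF A])
    show "(((\<lambda>x. ?p x * F x) \<circ> real_of_ereal) \<longlongrightarrow> 0) (at_left \<infinity>)"
      by (rule ereal_tendsto_simps1(3)[THEN iffD2, OF B])
  qed (auto simp: contf)
  then have "(\<integral>x. f x \<partial>lborel) = 0"
    by (simp add: interval_lebesgue_integral_def set_lebesgue_integral_def einterval_def)
  then have "(\<integral>x. ?p x * F' x \<partial>lborel) = (\<integral>x. ?p x * (x * F x) \<partial>lborel) / s\<^sup>2"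
    unfolding f_def using i1 i2 by simp
  then show ?thesis using s by (simp add: integral_gauss)
qed

section \<open>Exponential moments of Gaussian vectors and their norms\<close>

lemma nn_integral_PiM_gauss_exp_linear:
  assumes s: "0 < s" and I: "finite I"
  shows "(\<integral>\<^sup>+x. exp (\<Sum>i\<in>I. a i * x i) \<partial>PiM I (\<lambda>i. gauss s)) = exp (s\<^sup>2 / 2 * (\<Sum>i\<in>I. (a i)\<^sup>2))"
proof -
  interpret product_sigma_finite "\<lambda>i. gauss s" by (rule product_sigma_finite_gauss[OF s])
  have "(\<integral>\<^sup>+x. exp (\<Sum>i\<in>I. a i * x i) \<partial>PiM I (\<lambda>i. gauss s)) =
      (\<integral>\<^sup>+x. (\<Prod>i\<in>I. ennreal (exp (a i * x i))) \<partial>PiM I (\<lambda>i. gauss s))"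
    using I by (intro nn_integral_cong) (simp add: exp_sum prod_ennreal)
  also have "\<dots> = (\<Prod>i\<in>I. \<integral>\<^sup>+x. exp (a i * x) \<partial>gauss s)"
    using I by (intro product_nn_integral_prod) auto
  also have "\<dots> = (\<Prod>i\<in>I. ennreal (exp ((a i)\<^sup>2 * s\<^sup>2 / 2)))"
    using s by (simp add: nn_integral_gauss_exp_linear)
  also have "\<dots> = exp (s\<^sup>2 / 2 * (\<Sum>i\<in>I. (a i)\<^sup>2))"
    using I by (simp add: prod_ennreal exp_sum[symmetric] sum_distrib_left mult_ac)
  finally show ?thesis .
qed

lemma nn_integral_PiM_gauss_exp_square:
  assumes s: "0 < s" and I: "finite I" and t: "2 * t * s\<^sup>2 < 1"
  shows "(\<integral>\<^sup>+x. exp (t * (\<Sum>i\<in>I. (x i)\<^sup>2)) \<partial>PiM I (\<lambda>i. gauss s)) = ennreal ((1 / sqrt (1 - 2 * t * s\<^sup>2)) ^ card I)"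
proof -
  interpret product_sigma_finite "\<lambda>i. gauss s" by (rule product_sigma_finite_gauss[OF s])
  have "(\<integral>\<^sup>+x. exp (t * (\<Sum>i\<in>I. (x i)\<^sup>2)) \<partial>PiM I (\<lambda>i. gauss s)) =
      (\<integral>\<^sup>+x. (\<Prod>i\<in>I. ennreal (exp (t * (x i)\<^sup>2))) \<partial>PiM I (\<lambda>i. gauss s))"
    using I by (intro nn_integral_cong) (simp add: sum_distrib_left exp_sum prod_ennreal)
  also have "\<dots> = (\<Prod>i\<in>I. \<integral>\<^sup>+x. exp (t * x\<^sup>2) \<partial>gauss s)"
    using I by (intro product_nn_integral_prod) auto
  also have "\<dots> = (\<Prod>i\<in>I. ennreal (1 / sqrt (1 - 2 * t * s\<^sup>2)))"
    using s t by (simp add: nn_integral_gauss_exp_square)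
  also have "\<dots> = ennreal ((1 / sqrt (1 - 2 * t * s\<^sup>2)) ^ card I)"
    using t by (simp add: ennreal_power)
  finally show ?thesis .
qed

text \<open>With \<open>y = l s / (sqrt n + l s)\<close>, the optimal Chernoff parameter for \<open>sqrt Q\<close> is \<open>t = y / (2 s\<^sup>2)\<close>;
  the term \<open>- n / 2 * ln (1 - y)\<close> is at most \<open>l s sqrt n / 2\<close>.\<close>

lemma nn_integral_exp_sqrt_le:
  fixes Q :: "'a \<Rightarrow> real"
  assumes s: "0 < s" and l: "0 \<le> l" and M: "prob_space M"
    and Q: "\<And>x. 0 \<le> Q x" and [measurable]: "Q \<in> borel_measurable M"
    and Q0: "n = 0 \<Longrightarrow> AE x in M. Q x = 0"
    and mgf: "\<And>t. 0 < t \<Longrightarrow> 2 * t * s\<^sup>2 < 1 \<Longrightarrow>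
      (\<integral>\<^sup>+x. exp (t * Q x) \<partial>M) \<le> ennreal ((1 / sqrt (1 - 2 * t * s\<^sup>2)) ^ n)"
  shows "(\<integral>\<^sup>+x. exp (l * sqrt (Q x)) \<partial>M) \<le> ennreal (exp (l * s * sqrt n + l\<^sup>2 * s\<^sup>2 / 2))"
proof -
  interpret prob_space M by fact
  show ?thesis
  \<comment> \<open>The choice of \<open>t\<close> below degenerates here: \<open>n = 0\<close>
    would give \<open>2 * t * s^2 = 1\<close> and \<open>l = 0\<close> would give
    \<open>t = 0\<close>, both outside the range of \<open>mgf\<close>.\<close>
  proof (cases "n = 0 \<or> l = 0")
    case True
    then have "AE x in M. l * sqrt (Q x) = 0" using Q0 by auto
    then have "(\<integral>\<^sup>+x. exp (l * sqrt (Q x)) \<partial>M) = (\<integral>\<^sup>+x. 1 \<partial>M)"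
      by (intro nn_integral_cong_AE) auto
    also have "\<dots> = 1" by (simp add: emeasure_space_1)
    also have "\<dots> \<le> ennreal (exp (l * s * sqrt n + l\<^sup>2 * s\<^sup>2 / 2))"
      using s l by simp
    finally show ?thesis .
  next
    case False
    define r where "r = sqrt n"
    have r: "r > 0" "r\<^sup>2 = n" using False by (auto simp: r_def)
    have l: "l > 0" using l False by simp
    define t where "t = l / (2 * s * (r + l * s))"
    have ls: "l * s > 0" using l s by simp
    have t: "t > 0" using l s r ls by (simp add: t_def add_pos_pos)
    have t2: "1 - 2 * t * s\<^sup>2 = r / (r + l * s)"
    proof -
      have "r + l * s > 0" using r ls by simp
      moreover from this have "2 * t * s\<^sup>2 = l * s / (r + l * s)"
        using s by (simp add: t_def power2_eq_square)
      ultimately show ?thesis by (simp add: diff_divide_eq_iff)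
    qed
    then have t1: "2 * t * s\<^sup>2 < 1" using r ls by (smt (verit) divide_pos_pos)
    \<comment> \<open>The square root is linearised by a completed square, which is tight at
      \<open>sqrt (Q x) = l / (2 * t) = s * (r + l * s)\<close>.\<close>
    have "l * sqrt (Q x) \<le> t * Q x + l\<^sup>2 / (4 * t)" for x
    proof -
      have "0 \<le> (2 * t * sqrt (Q x) - l)\<^sup>2" by simp
      also have "\<dots> = 4 * t * (t * Q x + l\<^sup>2 / (4 * t) - l * sqrt (Q x))"
        using t Q by (simp add: power2_eq_square algebra_simps)
      finally show ?thesis using t by (simp add: zero_le_mult_iff)
    qed
    then have "(\<integral>\<^sup>+x. exp (l * sqrt (Q x)) \<partial>M) \<le> (\<integral>\<^sup>+x. ennreal (exp (l\<^sup>2 / (4 * t))) * exp (t * Q x) \<partial>M)"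
      by (intro nn_integral_mono) (simp add: ennreal_mult'[symmetric] exp_add[symmetric] add.commute)
    also have "\<dots> = ennreal (exp (l\<^sup>2 / (4 * t))) * (\<integral>\<^sup>+x. exp (t * Q x) \<partial>M)"
      by (rule nn_integral_cmult) measurable
    also have "\<dots> \<le> ennreal (exp (l\<^sup>2 / (4 * t))) * ennreal ((1 / sqrt (1 - 2 * t * s\<^sup>2)) ^ n)"
      by (intro mult_left_mono mgf t t1) simp
    also have "\<dots> = ennreal (exp (l\<^sup>2 / (4 * t)) * (1 / sqrt (1 - 2 * t * s\<^sup>2)) ^ n)"
      by (simp add: ennreal_mult')
    also have "\<dots> \<le> ennreal (exp (l * s * sqrt n + l\<^sup>2 * s\<^sup>2 / 2))"
    proof (rule ennreal_leI)
      \<comment> \<open>One half of \<open>l * s * sqrt n\<close> and the whole variance term come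
        from the linearisation; the other half comes from the moment of \<open>Q\<close>.\<close>
      have e1: "l\<^sup>2 / (4 * t) = l * s * (r + l * s) / 2"
        using l s r ls by (simp add: t_def field_simps power2_eq_square)
      have "1 / sqrt (1 - 2 * t * s\<^sup>2) = sqrt (1 + l * s / r)"
      proof -
        have "1 / (r / (r + l * s)) = 1 + l * s / r" using r ls by (simp add: field_simps)
        then show ?thesis unfolding t2 using real_sqrt_divide[of 1 "r / (r + l * s)"] by simp
      qed
      also have "\<dots> \<le> sqrt (exp (l * s / r))" by (intro real_sqrt_le_mono) simp
      also have "\<dots> = exp (l * s / r / 2)"
        by (rule real_sqrt_unique) (auto simp: power2_eq_square exp_add[symmetric])
      finally have "(1 / sqrt (1 - 2 * t * s\<^sup>2)) ^ n \<le> exp (l * s / r / 2) ^ n"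
        using t1 by (intro power_mono) auto
      also have "\<dots> = exp (l * s * r / 2)"
        using r by (simp add: exp_of_nat_mult[symmetric] r(2)[symmetric] power2_eq_square)
      finally have "exp (l\<^sup>2 / (4 * t)) * (1 / sqrt (1 - 2 * t * s\<^sup>2)) ^ n \<le> exp (l\<^sup>2 / (4 * t)) * exp (l * s * r / 2)"
        by simp
      also have "\<dots> = exp (l * s * sqrt n + l\<^sup>2 * s\<^sup>2 / 2)"
        unfolding e1 by (simp add: exp_add[symmetric] r_def power2_eq_square field_simps)
      finally show "exp (l\<^sup>2 / (4 * t)) * (1 / sqrt (1 - 2 * t * s\<^sup>2)) ^ n \<le> exp (l * s * sqrt n + l\<^sup>2 * s\<^sup>2 / 2)" .
    qed
    finally show ?thesis .
  qed
qed

lemma nn_integral_gauss_exp_norm_le: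
  assumes s: "0 < s" and I: "finite I" and l: "0 \<le> l"
  shows "(\<integral>\<^sup>+x. exp (l * sqrt (\<Sum>i\<in>I. (x i)\<^sup>2)) \<partial>PiM I (\<lambda>i. gauss s))
    \<le> ennreal (exp (l * s * sqrt (card I) + l\<^sup>2 * s\<^sup>2 / 2))"
  using I s l by (intro nn_integral_exp_sqrt_le)
    (auto simp: sum_nonneg prob_space_PiM_gauss nn_integral_PiM_gauss_exp_square)

text \<open>Linearise the square by \<open>exp (t y\<^sup>2) = E exp (sqrt (2 t) y g)\<close> with a standard Gaussian \<open>g\<close>
  and integrate over \<open>w\<close> first; this replaces a singular value decomposition of \<open>A\<close>.\<close>

lemma nn_integral_gauss_exp_norm_matrix_le:
  fixes A :: "'i \<Rightarrow> 'k \<Rightarrow> real"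
  assumes I: "finite I" and J: "finite J" and R: "0 < R" and l: "0 \<le> l"
    and A: "\<And>v. (\<Sum>i\<in>I. (\<Sum>k\<in>J. A i k * v k)\<^sup>2) \<le> R\<^sup>2 * (\<Sum>k\<in>J. (v k)\<^sup>2)"
  shows "(\<integral>\<^sup>+w. exp (l * sqrt (\<Sum>k\<in>J. (\<Sum>i\<in>I. w i * A i k)\<^sup>2)) \<partial>PiM I (\<lambda>i. gauss 1))
    \<le> ennreal (exp (l * R * sqrt (card J) + l\<^sup>2 * R\<^sup>2 / 2))"
proof (rule nn_integral_exp_sqrt_le[OF R l])
  let ?P = "PiM I (\<lambda>i. gauss 1)" and ?G = "PiM J (\<lambda>i. gauss 1)"
  interpret P: prob_space ?P by (rule prob_space_PiM_gauss) simp
  interpret G: prob_space ?G by (rule prob_space_PiM_gauss) simp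
  interpret pair_sigma_finite ?P ?G ..
  show "prob_space ?P" by (rule prob_space_PiM_gauss) simp
  fix t :: real assume t: "0 < t" "2 * t * R\<^sup>2 < 1"
  define c where "c = sqrt (2 * t)"
  have c: "c\<^sup>2 = 2 * t" using t by (simp add: c_def)
  have "ennreal (exp (t * (\<Sum>k\<in>J. (\<Sum>i\<in>I. w i * A i k)\<^sup>2))) =
      (\<integral>\<^sup>+g. exp (\<Sum>k\<in>J. (c * (\<Sum>i\<in>I. w i * A i k)) * g k) \<partial>?G)" for w
    by (subst nn_integral_PiM_gauss_exp_linear) (simp_all add: J power_mult_distrib c sum_distrib_left[symmetric])
  then have "(\<integral>\<^sup>+w. exp (t * (\<Sum>k\<in>J. (\<Sum>i\<in>I. w i * A i k)\<^sup>2)) \<partial>?P) =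
      (\<integral>\<^sup>+w. \<integral>\<^sup>+g. exp (\<Sum>k\<in>J. (c * (\<Sum>i\<in>I. w i * A i k)) * g k) \<partial>?G \<partial>?P)"
    by simp
  also have "\<dots> = (\<integral>\<^sup>+g. \<integral>\<^sup>+w. exp (\<Sum>k\<in>J. (c * (\<Sum>i\<in>I. w i * A i k)) * g k) \<partial>?P \<partial>?G)"
    by (rule Fubini'[symmetric]) measurable
  also have "\<dots> = (\<integral>\<^sup>+g. \<integral>\<^sup>+w. exp (\<Sum>i\<in>I. (c * (\<Sum>k\<in>J. A i k * g k)) * w i) \<partial>?P \<partial>?G)"
    by (simp add: sum_distrib_left sum_distrib_right mult_ac sum.swap[of _ I])
  also have "\<dots> = (\<integral>\<^sup>+g. exp (t * (\<Sum>i\<in>I. (\<Sum>k\<in>J. A i k * g k)\<^sup>2)) \<partial>?G)"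
    by (subst nn_integral_PiM_gauss_exp_linear) (simp_all add: I power_mult_distrib c sum_distrib_left[symmetric])
  also have "\<dots> \<le> (\<integral>\<^sup>+g. exp (t * R\<^sup>2 * (\<Sum>k\<in>J. (g k)\<^sup>2)) \<partial>?G)"
    using t A by (intro nn_integral_mono) (simp add: mult.assoc)
  \<comment> \<open>The remaining Gaussian vector \<open>g\<close> is indexed by \<open>J\<close>.
    This is why the final bound contains the input dimension, through \<open>sqrt (card J)\<close>,
    and not the width.\<close>
  also have "\<dots> = ennreal ((1 / sqrt (1 - 2 * t * R\<^sup>2)) ^ card J)"
    using t J nn_integral_PiM_gauss_exp_square[of 1 J "t * R\<^sup>2"] by (simp add: mult.assoc)
  finally show "(\<integral>\<^sup>+w. exp (t * (\<Sum>k\<in>J. (\<Sum>i\<in>I. w i * A i k)\<^sup>2)) \<partial>?P)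
    \<le> ennreal ((1 / sqrt (1 - 2 * t * R\<^sup>2)) ^ card J)" .
qed (use J in \<open>auto simp: sum_nonneg\<close>)

section \<open>Gaussian comparison\<close>

text \<open>The sum of absolute values in the exponent makes this majorant a product over
  coordinates; it dominates the integrands of the comparison argument.\<close>

lemma integrable_PiM_gauss_exp_sum_abs:
  assumes s: "0 < s" and I: "finite I"
  shows "integrable (PiM I (\<lambda>i. gauss s)) (\<lambda>z. exp (r * (\<Sum>i\<in>I. \<bar>z i\<bar>)))"
proof -
  interpret product_sigma_finite "\<lambda>i. gauss s" by (rule product_sigma_finite_gauss[OF s])
  have "integrable (PiM I (\<lambda>i. gauss s)) (\<lambda>z. \<Prod>i\<in>I. exp (r * \<bar>z i\<bar>))"
    using I s by (intro product_integrable_prod integrable_gauss_exp_abs)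
  then show ?thesis using I by (simp add: sum_distrib_left exp_sum)
qed

lemma PiM_gauss_integration_by_parts:
  fixes f f' :: "('i \<Rightarrow> real) \<Rightarrow> real"
  assumes s: "0 < s" and I: "finite I" "i \<in> I"
    and [measurable]: "f \<in> borel_measurable (PiM I (\<lambda>i. gauss s))" "f' \<in> borel_measurable (PiM I (\<lambda>i. gauss s))"
    and d: "\<And>z y. ((\<lambda>y. f (z(i := y))) has_real_derivative f' (z(i := y))) (at y)"
    and c: "\<And>z. continuous_on UNIV (\<lambda>y. f' (z(i := y)))"
    and bf: "\<And>z. \<bar>f z\<bar> \<le> C * exp (r * (\<Sum>i\<in>I. \<bar>z i\<bar>))"
    and bf': "\<And>z. \<bar>f' z\<bar> \<le> C * exp (r * (\<Sum>i\<in>I. \<bar>z i\<bar>))"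
  shows "integrable (PiM I (\<lambda>i. gauss s)) (\<lambda>z. z i * f z)"
    and "integrable (PiM I (\<lambda>i. gauss s)) f'"
    and "(\<integral>z. z i * f z \<partial>PiM I (\<lambda>i. gauss s)) = s\<^sup>2 * (\<integral>z. f' z \<partial>PiM I (\<lambda>i. gauss s))"
proof -
  interpret product_sigma_finite "\<lambda>i. gauss s" by (rule product_sigma_finite_gauss[OF s])
  have C0: "0 \<le> C" using bf[of "\<lambda>_. 0"] by simp
  have [measurable]: "(\<lambda>z. z i) \<in> borel_measurable (PiM I (\<lambda>i. gauss s))"
    using I by measurable
  show int1: "integrable (PiM I (\<lambda>i. gauss s)) (\<lambda>z. z i * f z)"
  proof (rule Bochner_Integration.integrable_bound[OF integrable_mult_right[OF integrable_PiM_gauss_exp_sum_abs[OF s I(1), of "r + 1"], of C]])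
    show "AE z in PiM I (\<lambda>i. gauss s). norm (z i * f z) \<le> norm (C * exp ((r + 1) * (\<Sum>i\<in>I. \<bar>z i\<bar>)))"
    proof (rule AE_I2)
      fix z :: "'i \<Rightarrow> real"
      let ?n = "\<Sum>i\<in>I. \<bar>z i\<bar>"
      have n: "\<bar>z i\<bar> \<le> ?n" "0 \<le> ?n" using I member_le_sum[of i I "\<lambda>i. \<bar>z i\<bar>"] by (auto simp: sum_nonneg)
      have "norm (z i * f z) \<le> ?n * (C * exp (r * ?n))"
        using bf[of z] n by (auto simp: abs_mult intro!: mult_mono)
      also have "\<dots> \<le> C * exp ((r + 1) * ?n)"
        using mult_left_mono[OF abs_mult_exp_le[of ?n r] C0] n by (simp add: mult_ac)
      finally show "norm (z i * f z) \<le> norm (C * exp ((r + 1) * ?n))" using C0 by simp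
    qed
  qed measurable
  show int2: "integrable (PiM I (\<lambda>i. gauss s)) f'"
    by (rule Bochner_Integration.integrable_bound[OF integrable_mult_right[OF integrable_PiM_gauss_exp_sum_abs[OF s I(1), of r], of C]])
       (use bf' in \<open>auto intro: order_trans[OF _ abs_ge_self]\<close>)
  define J where "J = I - {i}"
  have J: "I = insert i J" "i \<notin> J" "finite J" using I by (auto simp: J_def)
  have "(\<integral>z. z i * f z \<partial>PiM I (\<lambda>i. gauss s)) = (\<integral>x. (\<integral>y. y * f (x(i := y)) \<partial>gauss s) \<partial>PiM J (\<lambda>i. gauss s))"
    using int1 unfolding J(1) by (subst product_integral_insert[OF J(3,2)]) simp_all
  also have "\<dots> = (\<integral>x. s\<^sup>2 * (\<integral>y. f' (x(i := y)) \<partial>gauss s) \<partial>PiM J (\<lambda>i. gauss s))"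
  proof (rule Bochner_Integration.integral_cong[OF refl])
    fix x :: "'i \<Rightarrow> real"
    let ?n = "\<Sum>j\<in>J. \<bar>x j\<bar>"
    have n: "(\<Sum>j\<in>I. \<bar>(x(i := y)) j\<bar>) = \<bar>y\<bar> + ?n" for y
      unfolding J(1) using J by (simp cong: sum.cong) (intro sum.cong, auto)
    show "(\<integral>y. y * f (x(i := y)) \<partial>gauss s) = s\<^sup>2 * (\<integral>y. f' (x(i := y)) \<partial>gauss s)"
    proof (rule gauss_integration_by_parts[OF s d c, where C = "C * exp (r * ?n)" and a = r])
      show "\<bar>f (x(i := y))\<bar> \<le> C * exp (r * ?n) * exp (r * \<bar>y\<bar>)" for y
        using bf[of "x(i := y)"] unfolding n by (simp add: exp_add[symmetric] algebra_simps)
      show "\<bar>f' (x(i := y))\<bar> \<le> C * exp (r * ?n) * exp (r * \<bar>y\<bar>)" for y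
        using bf'[of "x(i := y)"] unfolding n by (simp add: exp_add[symmetric] algebra_simps)
    qed
  qed
  also have "\<dots> = s\<^sup>2 * (\<integral>z. f' z \<partial>PiM I (\<lambda>i. gauss s))"
    using int2 unfolding J(1) by (subst product_integral_insert[OF J(3,2)]) simp_all
  finally show "(\<integral>z. z i * f z \<partial>PiM I (\<lambda>i. gauss s)) = s\<^sup>2 * (\<integral>z. f' z \<partial>PiM I (\<lambda>i. gauss s))" .
qed

section \<open>The soft maximum of a finite Gaussian family\<close>

definition lin :: "'i set \<Rightarrow> ('i \<Rightarrow> real) \<Rightarrow> ('i \<Rightarrow> real) \<Rightarrow> real" where
  "lin I c z = (\<Sum>i\<in>I. c i * z i)"

text \<open>The partition function at inverse temperature \<open>\<beta>\<close>: its logarithm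
  divided by \<open>\<beta>\<close> approximates the maximum of the linear forms.\<close>

definition sexp :: "real \<Rightarrow> 'i set \<Rightarrow> 'k set \<Rightarrow> ('k \<Rightarrow> 'i \<Rightarrow> real) \<Rightarrow> ('i \<Rightarrow> real) \<Rightarrow> real" where
  "sexp \<beta> I K c z = (\<Sum>k\<in>K. exp (\<beta> * lin I (c k) z))"

lemma sexp_pos: "finite K \<Longrightarrow> K \<noteq> {} \<Longrightarrow> 0 < sexp \<beta> I K c z"
  unfolding sexp_def by (intro sum_pos) auto

lemma exp_le_sexp: "finite K \<Longrightarrow> k \<in> K \<Longrightarrow> exp (\<beta> * lin I (c k) z) \<le> sexp \<beta> I K c z"
  unfolding sexp_def by (rule member_le_sum) auto

lemma lin_update: "finite I \<Longrightarrow> i \<in> I \<Longrightarrow> lin I c (z(i := y)) = lin I c (z(i := 0)) + c i * y"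
  unfolding lin_def by (simp add: sum.remove[of I i] cong: sum.cong_simp)

lemma measurable_lin [measurable]: "lin I c \<in> borel_measurable (PiM I (\<lambda>i. gauss s))"
  unfolding lin_def by measurable

lemma measurable_sexp [measurable]: "sexp \<beta> I K c \<in> borel_measurable (PiM I (\<lambda>i. gauss s))"
  unfolding sexp_def by measurable

lemma lin_le:
  assumes "finite I" "\<And>i. i \<in> I \<Longrightarrow> \<bar>c i\<bar> \<le> A"
  shows "\<bar>lin I c z\<bar> \<le> A * (\<Sum>i\<in>I. \<bar>z i\<bar>)"
proof -
  have "\<bar>lin I c z\<bar> \<le> (\<Sum>i\<in>I. \<bar>c i * z i\<bar>)" unfolding lin_def by (rule sum_abs)
  also have "\<dots> \<le> (\<Sum>i\<in>I. A * \<bar>z i\<bar>)"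
    using assms by (intro sum_mono) (auto simp: abs_mult intro!: mult_right_mono)
  finally show ?thesis by (simp add: sum_distrib_left)
qed

lemma sexp_powr_le:
  assumes K: "finite K" "K \<noteq> {}" and I: "finite I" and \<alpha>: "0 \<le> \<alpha>" "\<alpha> \<le> 1" and \<beta>: "0 \<le> \<beta>"
    and c: "\<And>k i. k \<in> K \<Longrightarrow> i \<in> I \<Longrightarrow> \<bar>c k i\<bar> \<le> A" and A: "0 \<le> A"
  shows "sexp \<beta> I K c z powr \<alpha> \<le> card K * exp (\<beta> * A * (\<Sum>i\<in>I. \<bar>z i\<bar>))"
proof -
  let ?B = "card K * exp (\<beta> * A * (\<Sum>i\<in>I. \<bar>z i\<bar>))"
  have "sexp \<beta> I K c z \<le> (\<Sum>k\<in>K. exp (\<beta> * (A * (\<Sum>i\<in>I. \<bar>z i\<bar>))))"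
    unfolding sexp_def using lin_le[OF I c] \<beta>
    by (intro sum_mono) (simp add: abs_le_iff mult_left_mono)
  then have le: "sexp \<beta> I K c z \<le> ?B" by (simp add: mult_ac)
  \<comment> \<open>Since \<open>?B\<close> is at least 1, lowering its exponent from 1 to
    \<open>\<alpha>\<close> does not increase it.\<close>
  have "1 \<le> card K" using K by (simp add: Suc_leI card_gt_0_iff)
  moreover have "1 \<le> exp (\<beta> * A * (\<Sum>i\<in>I. \<bar>z i\<bar>))" using \<beta> A by (simp add: sum_nonneg)
  ultimately have "1 * 1 \<le> ?B" by (intro mult_mono) auto
  then have "?B powr \<alpha> \<le> ?B powr 1" using \<alpha> by (intro powr_mono) auto
  moreover have "sexp \<beta> I K c z powr \<alpha> \<le> ?B powr \<alpha>"
    using le \<alpha> sexp_pos[OF K, of \<beta> I c z] by (intro powr_mono2) auto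
  ultimately show ?thesis by simp
qed

lemma finite_family_bounded:
  fixes c :: "'k \<Rightarrow> 'i \<Rightarrow> real"
  assumes "finite K" "finite I"
  obtains A where "0 \<le> A" "\<And>k i. k \<in> K \<Longrightarrow> i \<in> I \<Longrightarrow> \<bar>c k i\<bar> \<le> A"
proof
  show "0 \<le> (\<Sum>(k, i)\<in>K \<times> I. \<bar>c k i\<bar>)" by (intro sum_nonneg) auto
  show "\<bar>c k i\<bar> \<le> (\<Sum>(k, i)\<in>K \<times> I. \<bar>c k i\<bar>)" if "k \<in> K" "i \<in> I" for k i
    using member_le_sum[of "(k, i)" "K \<times> I" "\<lambda>(k, i). \<bar>c k i\<bar>"] assms that by auto
qed

lemma integrable_sexp_powr:
  assumes s: "0 < s" and I: "finite I" and K: "finite K" "K \<noteq> {}" and \<alpha>: "0 \<le> \<alpha>" "\<alpha> \<le> 1" and \<beta>: "0 \<le> \<beta>"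
  shows "integrable (PiM I (\<lambda>i. gauss s)) (\<lambda>z. sexp \<beta> I K c z powr \<alpha>)"
proof -
  obtain A where A: "0 \<le> A" "\<And>k i. k \<in> K \<Longrightarrow> i \<in> I \<Longrightarrow> \<bar>c k i\<bar> \<le> A"
    using finite_family_bounded[OF K(1) I, of c] by metis
  have "sexp \<beta> I K c z powr \<alpha> \<le> card K * exp (\<beta> * A * (\<Sum>i\<in>I. \<bar>z i\<bar>))" for z
    by (rule sexp_powr_le[OF K I \<alpha> \<beta>]) (use A in auto)
  then show ?thesis
    by (intro Bochner_Integration.integrable_bound[OF integrable_mult_right[OF integrable_PiM_gauss_exp_sum_abs[OF s I, of "\<beta> * A"], of "card K"]])
       (auto intro: order_trans[OF _ abs_ge_self])
qed

text \<open>\<open>p k\<close> is, up to the factor \<open>\<alpha> \<beta>\<close>, the \<open>k\<close>-th partial derivative of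
  \<open>\<Psi> x = (\<Sum>k. exp (\<beta> x k)) powr \<alpha>\<close>, whose mixed second derivatives are nonpositive because \<open>\<alpha> \<le> 1\<close>.\<close>

lemma gaussian_interpolation_static:
  fixes c c' :: "'k \<Rightarrow> 'i \<Rightarrow> real"
  assumes s: "0 < s" and I: "finite I" and K: "finite K" "K \<noteq> {}"
    and \<alpha>: "0 \<le> \<alpha>" "\<alpha> \<le> 1" and \<beta>: "0 \<le> \<beta>"
    and diag: "\<And>k. k \<in> K \<Longrightarrow> (\<Sum>i\<in>I. c' k i * c k i) = 0"
    and off: "\<And>k l. k \<in> K \<Longrightarrow> l \<in> K \<Longrightarrow> (\<Sum>i\<in>I. c' k i * c l i) \<le> 0"
  defines "p \<equiv> \<lambda>k z. exp (\<beta> * lin I (c k) z) * sexp \<beta> I K c z powr (\<alpha> - 1)"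
  shows "0 \<le> (\<integral>z. (\<Sum>k\<in>K. lin I (c' k) z * p k z) \<partial>PiM I (\<lambda>i. gauss s))"
proof -
  let ?P = "PiM I (\<lambda>i. gauss s)"
  obtain A where A0: "0 \<le> A" and A: "\<And>k i. k \<in> K \<Longrightarrow> i \<in> I \<Longrightarrow> \<bar>c k i\<bar> \<le> A"
    using finite_family_bounded[OF K(1) I, of c] by metis
  let ?S = "\<lambda>z. sexp \<beta> I K c z"
  let ?e = "\<lambda>k z. exp (\<beta> * lin I (c k) z)"
  have S: "0 < ?S z" for z by (rule sexp_pos[OF K])
  \<comment> \<open>The partial derivative of \<open>p k\<close> in the coordinate
    \<open>z i\<close>: the first summand differentiates the exponential, the second the power of
    the partition function.\<close>
  define dp where "dp k i z = \<beta> * c k i * p k z + (\<alpha> - 1) * (\<Sum>l\<in>K. \<beta> * c l i * ?e l z) * ?e k z * ?S z powr (\<alpha> - 2)" for k i z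
  have p0: "0 \<le> p k z" for k z by (simp add: p_def)
  have pS: "p k z \<le> ?S z powr \<alpha>" if "k \<in> K" for k z
  proof -
    have "p k z \<le> ?S z * ?S z powr (\<alpha> - 1)"
      unfolding p_def using K that by (intro mult_right_mono exp_le_sexp) auto
    also have "\<dots> = ?S z powr \<alpha>" using S[of z] by (simp add: powr_mult_base)
    finally show ?thesis .
  qed
  let ?C = "(1 + 2 * \<beta> * A) * card K"
  have pC: "p k z \<le> card K * exp (\<beta> * A * (\<Sum>i\<in>I. \<bar>z i\<bar>))" if "k \<in> K" for k z
    by (rule order_trans[OF pS[OF that] sexp_powr_le[OF K I \<alpha> \<beta>]]) (use A A0 in auto)
  have lu: "(\<lambda>y. lin I d (z(i := y))) = (\<lambda>y. lin I d (z(i := 0)) + d i * y)" if "i \<in> I" for i d z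
    by (rule ext, rule lin_update[OF I that])
  have ibp: "integrable ?P (\<lambda>z. z i * p k z)" "integrable ?P (dp k i)"
    "(\<integral>z. z i * p k z \<partial>?P) = s\<^sup>2 * (\<integral>z. dp k i z \<partial>?P)"
    if k: "k \<in> K" and i: "i \<in> I" for k i
  proof -
    have "p k \<in> borel_measurable ?P" unfolding p_def by measurable
    moreover have "dp k i \<in> borel_measurable ?P" unfolding dp_def p_def by measurable
    moreover have "((\<lambda>y. p k (z(i := y))) has_real_derivative dp k i (z(i := y))) (at y)" for z y
    proof -
      have dl: "((\<lambda>y. lin I d (z(i := y))) has_real_derivative d i) (at y)" for d
        unfolding lu[OF i] by (auto intro!: derivative_eq_intros)
      have dS: "((\<lambda>y. ?S (z(i := y))) has_real_derivative (\<Sum>l\<in>K. \<beta> * c l i * ?e l (z(i := y)))) (at y)"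
        unfolding sexp_def by (auto intro!: derivative_eq_intros dl sum.cong)
      have "((\<lambda>y. exp (\<beta> * lin I (c k) (z(i := y))) * ?S (z(i := y)) powr (\<alpha> - 1)) has_real_derivative
          exp (\<beta> * lin I (c k) (z(i := y))) * (\<beta> * c k i) * ?S (z(i := y)) powr (\<alpha> - 1)
          + (\<alpha> - 1) * ?S (z(i := y)) powr (\<alpha> - 1 - of_nat 1) * (\<Sum>l\<in>K. \<beta> * c l i * ?e l (z(i := y)))
            * exp (\<beta> * lin I (c k) (z(i := y)))) (at y)"
        by (rule DERIV_mult[OF DERIV_fun_exp[OF DERIV_cmult[OF dl]] DERIV_fun_powr[OF dS S]])
      then show ?thesis
        unfolding p_def dp_def by (rule DERIV_cong) (simp add: mult_ac)
    qed
    moreover have "continuous_on UNIV (\<lambda>y. dp k i (z(i := y)))" for z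
    proof -
      have cl: "continuous_on UNIV (\<lambda>y. lin I d (z(i := y)))" for d
        unfolding lu[OF i] by (intro continuous_intros)
      have cS: "continuous_on UNIV (\<lambda>y. ?S (z(i := y)))"
        unfolding sexp_def by (intro continuous_intros cl)
      show ?thesis
        unfolding dp_def p_def by (intro continuous_intros cl cS) (use S in \<open>auto simp: less_imp_neq[symmetric]\<close>)
    qed
    moreover have "\<bar>p k z\<bar> \<le> ?C * exp (\<beta> * A * (\<Sum>i\<in>I. \<bar>z i\<bar>))" for z
    proof -
      have "card K * exp (\<beta> * A * (\<Sum>i\<in>I. \<bar>z i\<bar>)) \<le> ?C * exp (\<beta> * A * (\<Sum>i\<in>I. \<bar>z i\<bar>))"
        using \<beta> A0 by (intro mult_right_mono) (auto simp: distrib_right)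
      then show ?thesis using pC[OF k, of z] p0[of k z] by linarith
    qed
    moreover have "\<bar>dp k i z\<bar> \<le> ?C * exp (\<beta> * A * (\<Sum>i\<in>I. \<bar>z i\<bar>))" for z
    proof -
      have "\<bar>\<Sum>l\<in>K. \<beta> * c l i * ?e l z\<bar> \<le> (\<Sum>l\<in>K. \<beta> * A * ?e l z)"
        using \<beta> A i A0 by (intro order_trans[OF sum_abs] sum_mono) (auto simp: abs_mult intro!: mult_mono)
      also have "\<dots> = \<beta> * A * ?S z" by (simp add: sexp_def sum_distrib_left)
      finally have 1: "\<bar>\<Sum>l\<in>K. \<beta> * c l i * ?e l z\<bar> \<le> \<beta> * A * ?S z" .
      have "?S z powr (\<alpha> - 1) = ?S z * ?S z powr (\<alpha> - 2)"
        using S[of z] by (simp add: powr_mult_base)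
      then have 2: "p k z = ?S z * ?e k z * ?S z powr (\<alpha> - 2)" by (simp add: p_def)
      have "\<bar>(\<alpha> - 1) * (\<Sum>l\<in>K. \<beta> * c l i * ?e l z)\<bar> \<le> 1 * (\<beta> * A * ?S z)"
        unfolding abs_mult using 1 \<alpha> by (intro mult_mono) auto
      then have "\<bar>(\<alpha> - 1) * (\<Sum>l\<in>K. \<beta> * c l i * ?e l z)\<bar> * (?e k z * ?S z powr (\<alpha> - 2))
          \<le> 1 * (\<beta> * A * ?S z) * (?e k z * ?S z powr (\<alpha> - 2))"
        by (rule mult_right_mono) simp
      then have 3: "\<bar>(\<alpha> - 1) * (\<Sum>l\<in>K. \<beta> * c l i * ?e l z) * ?e k z * ?S z powr (\<alpha> - 2)\<bar> \<le> \<beta> * A * p k z"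
        unfolding 2 by (simp add: abs_mult mult_ac)
      have "\<bar>\<beta> * c k i * p k z\<bar> \<le> \<beta> * A * p k z"
        using \<beta> A[OF k i] p0[of k z] by (auto simp: abs_mult intro!: mult_mono)
      then have "\<bar>dp k i z\<bar> \<le> 2 * \<beta> * A * p k z"
        using 3 unfolding dp_def by linarith
      also have "\<dots> \<le> (1 + 2 * \<beta> * A) * (card K * exp (\<beta> * A * (\<Sum>i\<in>I. \<bar>z i\<bar>)))"
        using \<beta> A0 p0 pC[OF k, of z] by (intro mult_mono) auto
      finally show ?thesis by (simp add: mult_ac)
    qed
    ultimately show "integrable ?P (\<lambda>z. z i * p k z)" "integrable ?P (dp k i)"
      "(\<integral>z. z i * p k z \<partial>?P) = s\<^sup>2 * (\<integral>z. dp k i z \<partial>?P)"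
      using PiM_gauss_integration_by_parts[OF s I i, of "p k" "dp k i" ?C "\<beta> * A"] by blast+
  qed
  have "(\<integral>z. (\<Sum>k\<in>K. lin I (c' k) z * p k z) \<partial>?P) = (\<integral>z. (\<Sum>k\<in>K. \<Sum>i\<in>I. c' k i * (z i * p k z)) \<partial>?P)"
    by (simp only: lin_def sum_distrib_right mult.assoc)
  also have "\<dots> = (\<Sum>k\<in>K. \<Sum>i\<in>I. c' k i * (s\<^sup>2 * (\<integral>z. dp k i z \<partial>?P)))"
    using ibp by (simp add: Bochner_Integration.integral_sum Bochner_Integration.integrable_sum)
  also have "\<dots> = s\<^sup>2 * (\<integral>z. (\<Sum>k\<in>K. \<Sum>i\<in>I. c' k i * dp k i z) \<partial>?P)"
    using ibp by (simp add: Bochner_Integration.integral_sum Bochner_Integration.integrable_sum sum_distrib_left mult_ac)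
  finally have eq: "(\<integral>z. (\<Sum>k\<in>K. lin I (c' k) z * p k z) \<partial>?P) = s\<^sup>2 * (\<integral>z. (\<Sum>k\<in>K. \<Sum>i\<in>I. c' k i * dp k i z) \<partial>?P)" .
  have "0 \<le> (\<Sum>i\<in>I. c' k i * dp k i z)" if k: "k \<in> K" for k z
  proof -
    \<comment> \<open>Summing over \<open>i\<close> leaves only inner products of coefficient
      vectors. The first part is killed by \<open>diag\<close>; in the second,
      \<open>\<alpha> - 1 \<le> 0\<close> meets the nonpositive products from
      \<open>off\<close>.\<close>
    have "(\<Sum>i\<in>I. c' k i * dp k i z) = \<beta> * p k z * (\<Sum>i\<in>I. c' k i * c k i)
        + (\<alpha> - 1) * \<beta> * ?e k z * ?S z powr (\<alpha> - 2) * (\<Sum>l\<in>K. ?e l z * (\<Sum>i\<in>I. c' k i * c l i))"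
      unfolding dp_def by (simp add: sum_distrib_left sum_distrib_right sum.distrib distrib_left mult_ac sum.swap[of _ K I])
    also have "\<dots> = (1 - \<alpha>) * (\<beta> * ?e k z * ?S z powr (\<alpha> - 2)) * (\<Sum>l\<in>K. ?e l z * - (\<Sum>i\<in>I. c' k i * c l i))"
      using diag[OF k] by (simp add: sum_negf algebra_simps)
    also have "0 \<le> \<dots>"
      using \<alpha> \<beta> off[OF k] by (intro mult_nonneg_nonneg sum_nonneg) auto
    finally show ?thesis .
  qed
  then show ?thesis unfolding eq
    by (intro mult_nonneg_nonneg[OF zero_le_power2] Bochner_Integration.integral_nonneg sum_nonneg[of K])
qed

text \<open>Both families are linear forms in one independent Gaussian family, so covariances are
  inner products of coefficients times \<open>s^2\<close>, and \<open>cross\<close> says that the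
  families are independent of each other. At equal variances the less correlated family
  \<open>b\<close> has the larger expected soft maximum.\<close>

lemma gaussian_comparison:
  fixes a b :: "'k \<Rightarrow> 'i \<Rightarrow> real"
  assumes s: "0 < s" and I: "finite I" and K: "finite K" "K \<noteq> {}"
    and \<alpha>: "0 \<le> \<alpha>" "\<alpha> \<le> 1" and \<beta>: "0 \<le> \<beta>"
    and cross: "\<And>k l. k \<in> K \<Longrightarrow> l \<in> K \<Longrightarrow> (\<Sum>i\<in>I. a k i * b l i) = 0"
    and diag: "\<And>k. k \<in> K \<Longrightarrow> (\<Sum>i\<in>I. a k i * a k i) = (\<Sum>i\<in>I. b k i * b k i)"
    and off: "\<And>k l. k \<in> K \<Longrightarrow> l \<in> K \<Longrightarrow> (\<Sum>i\<in>I. b k i * b l i) \<le> (\<Sum>i\<in>I. a k i * a l i)"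
  shows "(\<integral>z. sexp \<beta> I K a z powr \<alpha> \<partial>PiM I (\<lambda>i. gauss s)) \<le> (\<integral>z. sexp \<beta> I K b z powr \<alpha> \<partial>PiM I (\<lambda>i. gauss s))"
proof -
  let ?P = "PiM I (\<lambda>i. gauss s)"
  interpret P: prob_space ?P by (rule prob_space_PiM_gauss[OF s])
  interpret LP: pair_sigma_finite lborel ?P ..
  obtain A where A0: "0 \<le> A" and A': "\<And>k i. k \<in> K \<Longrightarrow> i \<in> I \<Longrightarrow> \<bar>\<bar>a k i\<bar> + \<bar>b k i\<bar>\<bar> \<le> A"
    using finite_family_bounded[OF K(1) I, of "\<lambda>k i. \<bar>a k i\<bar> + \<bar>b k i\<bar>"] by metis
  have A: "\<bar>a k i\<bar> + \<bar>b k i\<bar> \<le> A" if "k \<in> K" "i \<in> I" for k i using A'[OF that] by simp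
  \<comment> \<open>A quarter turn from \<open>a\<close> to \<open>b\<close>, with velocity
    \<open>c'\<close>. Because \<open>cross\<close> removes the mixed terms, the inner product of
    \<open>c'\<close> and \<open>c\<close> is \<open>sin \<theta> * cos \<theta>\<close> times the
    covariance gap, whose sign is constant along the path.\<close>
  define c where "c \<theta> k i = cos \<theta> * a k i + sin \<theta> * b k i" for \<theta> k i
  define c' where "c' \<theta> k i = cos \<theta> * b k i - sin \<theta> * a k i" for \<theta> k i
  have trig: "\<bar>cos \<theta> * x\<bar> \<le> \<bar>x\<bar>" "\<bar>sin \<theta> * x\<bar> \<le> \<bar>x\<bar>" for \<theta> x :: real
    using mult_right_mono[OF abs_cos_le_one[of \<theta>], of "\<bar>x\<bar>"] mult_right_mono[OF abs_sin_le_one[of \<theta>], of "\<bar>x\<bar>"]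
    by (auto simp: abs_mult)
  have cA: "\<bar>c \<theta> k i\<bar> \<le> A" "\<bar>c' \<theta> k i\<bar> \<le> A" if "k \<in> K" "i \<in> I" for \<theta> k i
    using trig[of \<theta> "a k i"] trig[of \<theta> "b k i"] A[OF that] unfolding c_def c'_def by linarith+
  let ?S = "\<lambda>\<theta> z. sexp \<beta> I K (c \<theta>) z"
  let ?e = "\<lambda>\<theta> k z. exp (\<beta> * lin I (c \<theta> k) z)"
  let ?n = "\<lambda>z. \<Sum>i\<in>I. \<bar>z i\<bar>"
  have S: "0 < ?S \<theta> z" for \<theta> z by (rule sexp_pos[OF K])
  have SB: "?S \<theta> z powr \<alpha> \<le> card K * exp (\<beta> * A * ?n z)" for \<theta> z
    by (rule sexp_powr_le[OF K I \<alpha> \<beta> cA(1) A0])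
  define Q where "Q \<theta> z = (\<Sum>k\<in>K. lin I (c' \<theta> k) z * (?e \<theta> k z * ?S \<theta> z powr (\<alpha> - 1)))" for \<theta> z
  define D where "D \<theta> z = \<alpha> * \<beta> * Q \<theta> z" for \<theta> z
  have dl: "((\<lambda>\<theta>. lin I (c \<theta> k) z) has_real_derivative lin I (c' \<theta> k) z) (at \<theta>)" for k z \<theta>
    unfolding lin_def c_def c'_def by (auto intro!: derivative_eq_intros sum.cong simp: algebra_simps)
  have dS: "((\<lambda>\<theta>. ?S \<theta> z) has_real_derivative (\<Sum>k\<in>K. \<beta> * lin I (c' \<theta> k) z * ?e \<theta> k z)) (at \<theta>)" for z \<theta>
    unfolding sexp_def by (auto intro!: derivative_eq_intros dl sum.cong)
  have dG: "((\<lambda>\<theta>. ?S \<theta> z powr \<alpha>) has_real_derivative D \<theta> z) (at \<theta>)" for z \<theta>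
    unfolding D_def Q_def
    by (rule DERIV_cong[OF DERIV_fun_powr[OF dS S]]) (simp add: sum_distrib_left mult_ac)
  have cl: "isCont (\<lambda>\<theta>. lin I (c \<theta> k) z) \<theta>" "isCont (\<lambda>\<theta>. lin I (c' \<theta> k) z) \<theta>" for k z \<theta>
    unfolding lin_def c_def c'_def by (intro continuous_intros)+
  have cS: "isCont (\<lambda>\<theta>. ?S \<theta> z) \<theta>" for z \<theta> using dS by (rule DERIV_isCont)
  have cD: "isCont (\<lambda>\<theta>. D \<theta> z) \<theta>" for z \<theta>
    unfolding D_def Q_def by (intro continuous_intros cl cS) (use S in \<open>auto simp: less_imp_neq[symmetric]\<close>)
  have ends: "c (pi / 2) = b" "c 0 = a" by (auto simp: c_def fun_eq_iff)
  \<comment> \<open>The fundamental theorem of calculus is applied for each fixed \<open>z\<close>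
    and followed by Fubini, which replaces differentiation under the integral. The majorant for
    Fubini is \<open>H\<close>, uniform in \<open>\<theta>\<close>.\<close>
  define F where "F \<theta> z = D \<theta> z * indicator {0..pi/2} \<theta>" for \<theta> z
  have ftc: "(\<integral>\<theta>. F \<theta> z \<partial>lborel) = sexp \<beta> I K b z powr \<alpha> - sexp \<beta> I K a z powr \<alpha>" for z
    unfolding F_def using integral_FTC_Icc_real[of 0 "pi / 2" "\<lambda>\<theta>. ?S \<theta> z powr \<alpha>" "\<lambda>\<theta>. D \<theta> z"] dG cD
    by (simp add: ends)
  define H where "H z = \<alpha> * \<beta> * (card K * (A * (card K * exp ((\<beta> * A + 1) * ?n z))))" for z :: "'i \<Rightarrow> real"
  have QH: "\<bar>D \<theta> z\<bar> \<le> H z" for \<theta> z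
  proof -
    have "\<bar>lin I (c' \<theta> k) z * (?e \<theta> k z * ?S \<theta> z powr (\<alpha> - 1))\<bar> \<le> A * (card K * exp ((\<beta> * A + 1) * ?n z))"
      if k: "k \<in> K" for k
    proof -
      have "?e \<theta> k z * ?S \<theta> z powr (\<alpha> - 1) \<le> ?S \<theta> z * ?S \<theta> z powr (\<alpha> - 1)"
        using K k by (intro mult_right_mono exp_le_sexp) auto
      also have "\<dots> = ?S \<theta> z powr \<alpha>" using S[of \<theta> z] by (simp add: powr_mult_base)
      also note SB[of \<theta> z]
      finally have 1: "?e \<theta> k z * ?S \<theta> z powr (\<alpha> - 1) \<le> card K * exp (\<beta> * A * ?n z)" .
      have 2: "\<bar>lin I (c' \<theta> k) z\<bar> \<le> A * ?n z" using cA(2)[OF k] I by (intro lin_le) auto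
      have "\<bar>lin I (c' \<theta> k) z\<bar> * (?e \<theta> k z * ?S \<theta> z powr (\<alpha> - 1)) \<le> (A * ?n z) * (card K * exp (\<beta> * A * ?n z))"
        by (rule mult_mono[OF 2 1]) (use A0 in \<open>auto simp: sum_nonneg\<close>)
      moreover have "\<bar>lin I (c' \<theta> k) z * (?e \<theta> k z * ?S \<theta> z powr (\<alpha> - 1))\<bar> = \<bar>lin I (c' \<theta> k) z\<bar> * (?e \<theta> k z * ?S \<theta> z powr (\<alpha> - 1))"
        by (simp add: abs_mult)
      ultimately have "\<bar>lin I (c' \<theta> k) z * (?e \<theta> k z * ?S \<theta> z powr (\<alpha> - 1))\<bar> \<le> (A * ?n z) * (card K * exp (\<beta> * A * ?n z))"
        by simp
      also have "\<dots> = A * (card K * (\<bar>?n z\<bar> * exp (\<beta> * A * \<bar>?n z\<bar>)))"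
        by (simp add: sum_nonneg)
      also have "\<dots> \<le> A * (card K * exp ((\<beta> * A + 1) * \<bar>?n z\<bar>))"
        using A0 by (intro mult_left_mono abs_mult_exp_le) auto
      finally show ?thesis by (simp add: sum_nonneg)
    qed
    then have "\<bar>Q \<theta> z\<bar> \<le> (\<Sum>k\<in>K. A * (card K * exp ((\<beta> * A + 1) * ?n z)))"
      unfolding Q_def by (intro order_trans[OF sum_abs] sum_mono)
    then show ?thesis
      unfolding D_def H_def abs_mult using \<alpha> \<beta> by (intro mult_mono) auto
  qed
  have intH: "integrable ?P H"
    unfolding H_def by (intro integrable_mult_right integrable_PiM_gauss_exp_sum_abs s I)
  have H0: "0 \<le> H z" for z using order_trans[OF abs_ge_zero QH] .
  have "integrable (lborel \<Otimes>\<^sub>M ?P) (\<lambda>(\<theta>, z). indicator {0..pi/2} \<theta> * H z)"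
  proof (rule LP.Fubini_integrable)
    have [measurable]: "H \<in> borel_measurable ?P" using intH by auto
    show "(\<lambda>(\<theta>, z). indicator {0..pi/2} \<theta> * H z) \<in> borel_measurable (lborel \<Otimes>\<^sub>M ?P)" by measurable
    have "integrable lborel (\<lambda>\<theta>. indicator {0..pi/2} \<theta> * (\<integral>z. H z \<partial>?P))"
      by (intro integrable_mult_left) (simp add: integrable_indicator_iff)
    then show "integrable lborel (\<lambda>\<theta>. \<integral>z. norm (case (\<theta>, z) of (\<theta>, z) \<Rightarrow> indicator {0..pi/2} \<theta> * H z) \<partial>?P)"
      using H0 by simp
  qed (use intH in auto)
  then have intF: "integrable (lborel \<Otimes>\<^sub>M ?P) (case_prod F)"
  proof (rule Bochner_Integration.integrable_bound)
    show "case_prod F \<in> borel_measurable (lborel \<Otimes>\<^sub>M ?P)"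
      unfolding F_def D_def Q_def sexp_def lin_def c_def c'_def by measurable
    show "AE x in lborel \<Otimes>\<^sub>M ?P. norm (case_prod F x) \<le> norm (case x of (\<theta>, z) \<Rightarrow> indicator {0..pi/2} \<theta> * H z)"
      using QH by (intro AE_I2) (auto simp: F_def indicator_def intro: order_trans[OF _ abs_ge_self])
  qed
  have intG: "integrable ?P (\<lambda>z. ?S \<theta> z powr \<alpha>)" for \<theta>
    by (rule integrable_sexp_powr[OF s I K \<alpha> \<beta>])
  have "0 \<le> (\<integral>\<theta>. (\<integral>z. F \<theta> z \<partial>?P) \<partial>lborel)"
  proof (rule Bochner_Integration.integral_nonneg)
    fix \<theta> :: real
    show "0 \<le> (\<integral>z. F \<theta> z \<partial>?P)"
    proof (cases "\<theta> \<in> {0..pi/2}")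
      case True
      then have t: "0 \<le> sin \<theta>" "0 \<le> cos \<theta>" by (auto intro: sin_ge_zero cos_ge_zero)
      have G: "(\<Sum>i\<in>I. c' \<theta> k i * c \<theta> l i) = sin \<theta> * cos \<theta> * ((\<Sum>i\<in>I. b k i * b l i) - (\<Sum>i\<in>I. a k i * a l i))"
        if "k \<in> K" "l \<in> K" for k l
      proof -
        have "(\<Sum>i\<in>I. c' \<theta> k i * c \<theta> l i) = sin \<theta> * cos \<theta> * (\<Sum>i\<in>I. b k i * b l i) - sin \<theta> * cos \<theta> * (\<Sum>i\<in>I. a k i * a l i)
          + cos \<theta> * cos \<theta> * (\<Sum>i\<in>I. a l i * b k i) - sin \<theta> * sin \<theta> * (\<Sum>i\<in>I. a k i * b l i)"
          unfolding c_def c'_def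
          by (simp add: sum_distrib_left sum.distrib[symmetric] sum_subtractf[symmetric] algebra_simps)
        then show ?thesis using cross that by (simp add: algebra_simps)
      qed
      have "0 \<le> (\<integral>z. Q \<theta> z \<partial>?P)"
        unfolding Q_def
      proof (rule gaussian_interpolation_static[OF s I K \<alpha> \<beta>])
        show "(\<Sum>i\<in>I. c' \<theta> k i * c \<theta> k i) = 0" if "k \<in> K" for k using G[OF that that] diag[OF that] by simp
        show "(\<Sum>i\<in>I. c' \<theta> k i * c \<theta> l i) \<le> 0" if "k \<in> K" "l \<in> K" for k l
          unfolding G[OF that] using off[OF that] t by (intro mult_nonneg_nonpos) auto
      qed
      then show ?thesis using True \<alpha> \<beta> by (simp add: F_def D_def)
    qed (simp add: F_def)
  qed
  also have "\<dots> = (\<integral>z. (\<integral>\<theta>. F \<theta> z \<partial>lborel) \<partial>?P)" by (rule LP.Fubini_integral[OF intF, symmetric])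
  also have "\<dots> = (\<integral>z. sexp \<beta> I K b z powr \<alpha> \<partial>?P) - (\<integral>z. sexp \<beta> I K a z powr \<alpha> \<partial>?P)"
    unfolding ftc using intG[of 0] intG[of "pi / 2"] by (simp add: ends)
  finally show ?thesis by simp
qed

section \<open>Gaussian matrices\<close>

text \<open>Functionals of one layer are evaluated on the whole weight family. As they read only the
  coordinates in \<open>I\<close>, a restriction to \<open>I\<close> can be inserted, and
  measurability on the block carries over.\<close>

lemma measurable_PiM_lift:
  assumes "f \<in> measurable (PiM I M') N" "I \<subseteq> K"
    and dep: "\<And>z z'. (\<And>i. i \<in> I \<Longrightarrow> z i = z' i) \<Longrightarrow> f z = f z'"
  shows "f \<in> measurable (PiM K M') N"
proof -
  have "(\<lambda>z. f (restrict z I)) \<in> measurable (PiM K M') N"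
    by (rule measurable_compose[OF measurable_restrict_subset[OF assms(2)] assms(1)])
  moreover have "f (restrict z I) = f z" for z by (rule dep) simp
  ultimately show ?thesis by simp
qed

text \<open>Independence of disjoint blocks, for functions written on the whole family that read
  only their own block.\<close>

lemma (in product_sigma_finite) nn_integral_PiM_factor:
  assumes I: "finite I" "finite J" "I \<inter> J = {}"
    and f: "f \<in> borel_measurable (PiM I M)" "\<And>z z'. (\<And>i. i \<in> I \<Longrightarrow> z i = z' i) \<Longrightarrow> f z = f z'"
    and g: "g \<in> borel_measurable (PiM J M)" "\<And>z z'. (\<And>i. i \<in> J \<Longrightarrow> z i = z' i) \<Longrightarrow> g z = g z'"
  shows "(\<integral>\<^sup>+z. f z * g z \<partial>PiM (I \<union> J) M) = (\<integral>\<^sup>+z. f z \<partial>PiM I M) * (\<integral>\<^sup>+z. g z \<partial>PiM J M)"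
proof -
  have [measurable]: "f \<in> borel_measurable (PiM (I \<union> J) M)" "g \<in> borel_measurable (PiM (I \<union> J) M)"
    using measurable_PiM_lift[OF f(1) _ f(2)] measurable_PiM_lift[OF g(1) _ g(2)] by auto
  have "f (merge I J (x, y)) = f x" "g (merge I J (x, y)) = g y" for x y
    using I by (auto intro!: f(2) g(2) simp: merge_def)
  then have "(\<integral>\<^sup>+z. f z * g z \<partial>PiM (I \<union> J) M) = (\<integral>\<^sup>+x. \<integral>\<^sup>+y. f x * g y \<partial>PiM J M \<partial>PiM I M)"
    using I by (subst product_nn_integral_fold) auto
  also have "\<dots> = (\<integral>\<^sup>+z. f z \<partial>PiM I M) * (\<integral>\<^sup>+z. g z \<partial>PiM J M)"
    using f(1) g(1) by (simp add: nn_integral_cmult nn_integral_multc)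
  finally show ?thesis .
qed

lemma measurable_gauss_component:
  "i \<in> J \<Longrightarrow> (\<lambda>z. z i) \<in> borel_measurable (PiM J (\<lambda>_. gauss s))"
  by measurable

lemma measurable_gauss_norm:
  assumes "I \<subseteq> J"
  shows "(\<lambda>z. sqrt (\<Sum>i\<in>I. (z i)\<^sup>2)) \<in> borel_measurable (PiM J (\<lambda>_. gauss s))"
proof -
  have "(\<lambda>z. \<Sum>i\<in>I. (z i)\<^sup>2) \<in> borel_measurable (PiM J (\<lambda>_. gauss s))"
    using assms by (intro borel_measurable_sum borel_measurable_power measurable_gauss_component) auto
  then show ?thesis by measurable
qed

text \<open>With \<open>\<beta> = l / \<alpha>\<close>, passing from the maximum to the soft maximum
  costs at most the factor \<open>card K powr \<alpha>\<close>, which tends to 1. So the bound is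
  free of the size of \<open>K\<close>. On the side of \<open>b\<close> the maximum may be replaced
  by any common upper bound \<open>m\<close>, later a sum of two norms.\<close>

lemma gaussian_comparison_mgf:
  fixes a b :: "'k \<Rightarrow> 'i \<Rightarrow> real"
  assumes s: "0 < s" and I: "finite I" and K: "finite K" "K \<noteq> {}" and l: "0 \<le> l"
    and cross: "\<And>k l. k \<in> K \<Longrightarrow> l \<in> K \<Longrightarrow> (\<Sum>i\<in>I. a k i * b l i) = 0"
    and diag: "\<And>k. k \<in> K \<Longrightarrow> (\<Sum>i\<in>I. a k i * a k i) = (\<Sum>i\<in>I. b k i * b k i)"
    and off: "\<And>k l. k \<in> K \<Longrightarrow> l \<in> K \<Longrightarrow> (\<Sum>i\<in>I. b k i * b l i) \<le> (\<Sum>i\<in>I. a k i * a l i)"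
    and [measurable]: "m \<in> borel_measurable (PiM I (\<lambda>i. gauss s))"
    and m: "\<And>z k. k \<in> K \<Longrightarrow> lin I (b k) z \<le> m z"
    and B: "(\<integral>\<^sup>+z. exp (l * m z) \<partial>PiM I (\<lambda>i. gauss s)) \<le> ennreal B" "0 \<le> B"
  shows "(\<integral>\<^sup>+z. exp (l * Max ((\<lambda>k. lin I (a k) z) ` K)) \<partial>PiM I (\<lambda>i. gauss s)) \<le> ennreal B"
proof -
  let ?P = "PiM I (\<lambda>i. gauss s)"
  have step: "(\<integral>\<^sup>+z. exp (l * Max ((\<lambda>k. lin I (a k) z) ` K)) \<partial>?P) \<le> ennreal (card K powr \<alpha> * B)"
    if \<alpha>: "0 < \<alpha>" "\<alpha> \<le> 1" for \<alpha>
  proof -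
    define \<beta> where "\<beta> = l / \<alpha>"
    have \<beta>: "0 \<le> \<beta>" "\<beta> * \<alpha> = l" using \<alpha> l by (auto simp: \<beta>_def)
    have "exp (l * Max ((\<lambda>k. lin I (a k) z) ` K)) \<le> sexp \<beta> I K a z powr \<alpha>" for z
    proof -
      have "Max ((\<lambda>k. lin I (a k) z) ` K) \<in> (\<lambda>k. lin I (a k) z) ` K" using K by (intro Max_in) auto
      then obtain k where k: "k \<in> K" "Max ((\<lambda>k. lin I (a k) z) ` K) = lin I (a k) z" by auto
      have "exp (l * lin I (a k) z) = exp (\<beta> * lin I (a k) z) powr \<alpha>"
        unfolding exp_powr_real \<beta>(2)[symmetric] by (simp add: mult_ac)
      also have "\<dots> \<le> sexp \<beta> I K a z powr \<alpha>"
        using \<alpha> exp_le_sexp[OF K(1) k(1)] by (intro powr_mono2) auto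
      finally show ?thesis using k by simp
    qed
    then have "(\<integral>\<^sup>+z. exp (l * Max ((\<lambda>k. lin I (a k) z) ` K)) \<partial>?P) \<le> (\<integral>\<^sup>+z. sexp \<beta> I K a z powr \<alpha> \<partial>?P)"
      by (intro nn_integral_mono ennreal_leI)
    also have "\<dots> = ennreal (\<integral>z. sexp \<beta> I K a z powr \<alpha> \<partial>?P)"
      using \<alpha> \<beta> by (intro nn_integral_eq_integral integrable_sexp_powr s I K) auto
    also have "\<dots> \<le> ennreal (\<integral>z. sexp \<beta> I K b z powr \<alpha> \<partial>?P)"
      using \<alpha> \<beta> by (intro ennreal_leI gaussian_comparison s I K cross diag off) auto
    also have "\<dots> = (\<integral>\<^sup>+z. sexp \<beta> I K b z powr \<alpha> \<partial>?P)"
      using \<alpha> \<beta> by (intro nn_integral_eq_integral[symmetric] integrable_sexp_powr s I K) auto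
    also have "\<dots> \<le> (\<integral>\<^sup>+z. ennreal (card K powr \<alpha>) * exp (l * m z) \<partial>?P)"
    proof (intro nn_integral_mono)
      fix z
      have "sexp \<beta> I K b z \<le> (\<Sum>k\<in>K. exp (\<beta> * m z))"
        unfolding sexp_def using \<beta> m by (intro sum_mono) (auto intro: mult_left_mono)
      then have "sexp \<beta> I K b z powr \<alpha> \<le> (card K * exp (\<beta> * m z)) powr \<alpha>"
        using \<alpha> sexp_pos[OF K, of \<beta> I b z] by (intro powr_mono2) auto
      also have "\<dots> = card K powr \<alpha> * exp (l * m z)"
        unfolding \<beta>(2)[symmetric] by (simp add: powr_mult exp_powr_real mult_ac)
      finally show "ennreal (sexp \<beta> I K b z powr \<alpha>) \<le> ennreal (card K powr \<alpha>) * exp (l * m z)"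
        by (simp add: ennreal_mult'[symmetric] ennreal_leI)
    qed
    also have "\<dots> = ennreal (card K powr \<alpha>) * (\<integral>\<^sup>+z. exp (l * m z) \<partial>?P)"
      by (rule nn_integral_cmult) measurable
    also have "\<dots> \<le> ennreal (card K powr \<alpha>) * ennreal B"
      by (intro mult_left_mono B) simp
    finally show ?thesis by (simp add: ennreal_mult')
  qed
  have "card K \<noteq> 0" using K by simp
  then have "(\<lambda>n. card K powr (1 / real (Suc n)) * B) \<longlonglongrightarrow> card K powr 0 * B"
    by (intro tendsto_intros LIMSEQ_Suc[OF lim_1_over_n]) auto
  then have "(\<lambda>n. ennreal (card K powr (1 / real (Suc n)) * B)) \<longlonglongrightarrow> ennreal B"
    using \<open>card K \<noteq> 0\<close> by (auto dest: tendsto_ennrealI)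
  then show ?thesis
    by (rule LIMSEQ_le_const) (use step in auto)
qed

section \<open>Bilinear forms on pairs of unit vectors\<close>

definition bil :: "nat \<Rightarrow> nat \<Rightarrow> (nat \<Rightarrow> nat \<Rightarrow> real) \<Rightarrow> (nat \<Rightarrow> real) \<Rightarrow> (nat \<Rightarrow> real) \<Rightarrow> real" where
  "bil m n A u v = (\<Sum>i<m. \<Sum>j<n. u i * A i j * v j)"

text \<open>Unit vectors are functions with vanishing tail, so spheres of all dimensions lie in
  \<open>nat \<Rightarrow> real\<close>, whose product topology is metrizable and second countable.
  Countable dense subsets are taken there.\<close>

definition usph :: "nat \<Rightarrow> (nat \<Rightarrow> real) set" where
  "usph n = {u. (\<forall>i\<ge>n. u i = 0) \<and> (\<Sum>i<n. (u i)\<^sup>2) = 1}"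

text \<open>The first component is a tag: it keeps the layers, and the auxiliary variables of the
  comparison, in disjoint index sets of one product space.\<close>

definition blk :: "nat \<Rightarrow> nat \<Rightarrow> nat \<Rightarrow> (nat \<times> nat \<times> nat) set" where
  "blk l m n = {l} \<times> {..<m} \<times> {..<n}"

lemma finite_blk [simp]: "finite (blk l m n)"
  by (simp add: blk_def)

lemma card_blk [simp]: "card (blk l m n) = m * n"
  by (simp add: blk_def card_cartesian_product)

lemma sum_blk: "sum f (blk l m n) = (\<Sum>i<m. \<Sum>j<n. f (l, i, j))"
proof -
  have "sum f (blk l m n) = (\<Sum>(l', i, j)\<in>{l} \<times> {..<m} \<times> {..<n}. f (l', i, j))"
    by (simp add: blk_def)
  also have "\<dots> = (\<Sum>i<m. \<Sum>j<n. f (l, i, j))"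
    by (simp add: sum.cartesian_product[symmetric] sum.cartesian_product' split_def)
  finally show ?thesis .
qed

lemma sum_mult_le_sqrt:
  fixes x y :: "'a \<Rightarrow> real"
  shows "(\<Sum>i\<in>I. x i * y i) \<le> sqrt (\<Sum>i\<in>I. (x i)\<^sup>2) * sqrt (\<Sum>i\<in>I. (y i)\<^sup>2)"
proof -
  have "(\<Sum>i\<in>I. x i * y i) \<le> sqrt ((\<Sum>i\<in>I. x i * y i)\<^sup>2)" by simp
  also have "\<dots> \<le> sqrt ((\<Sum>i\<in>I. (x i)\<^sup>2) * (\<Sum>i\<in>I. (y i)\<^sup>2))"
    by (intro real_sqrt_le_mono Cauchy_Schwarz_ineq_sum)
  finally show ?thesis by (simp add: real_sqrt_mult)
qed

text \<open>Slepian comparison of \<open>u\<^sup>T G v + \<xi>\<close> with \<open>\<langle>g, u\<rangle> + \<langle>h, v\<rangle>\<close>: both have variance \<open>2 s\<^sup>2\<close>,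
  and the covariances differ by \<open>s\<^sup>2 (1 - \<langle>u, u'\<rangle>) (1 - \<langle>v, v'\<rangle>) \<ge> 0\<close>. The blocks
  \<open>q + 1\<close>, \<open>q + 2\<close>, \<open>q + 3\<close> carry the auxiliary variables \<open>\<xi>\<close>, \<open>g\<close>, \<open>h\<close>.\<close>

lemma gaussian_matrix_finite_mgf:
  assumes s: "0 < s" and l: "0 \<le> l" and K: "finite K" "K \<noteq> {}" "K \<subseteq> usph m \<times> usph n"
  shows "(\<integral>\<^sup>+z. exp (l * Max ((\<lambda>(u, v). bil m n (\<lambda>i j. z (q, i, j)) u v) ` K)) \<partial>PiM (blk q m n) (\<lambda>_. gauss s))
    \<le> ennreal (exp (l * s * (sqrt m + sqrt n) + l\<^sup>2 * s\<^sup>2 / 2))"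
proof -
  interpret product_sigma_finite "\<lambda>i :: nat \<times> nat \<times> nat. gauss s" by (rule product_sigma_finite_gauss[OF s])
  define Ix where "Ix = blk (q + 1) 1 1"
  define Ig where "Ig = blk (q + 2) m 1"
  define Ih where "Ih = blk (q + 3) n 1"
  define I where "I = blk q m n \<union> (Ix \<union> (Ig \<union> Ih))"
  have fin: "finite I" "finite Ix" "finite Ig" "finite Ih" by (auto simp: I_def Ix_def Ig_def Ih_def)
  have disj: "blk q m n \<inter> (Ix \<union> (Ig \<union> Ih)) = {}" "Ix \<inter> (Ig \<union> Ih) = {}" "Ig \<inter> Ih = {}" "(blk q m n \<union> Ix) \<inter> (Ig \<union> Ih) = {}"
    by (auto simp: Ix_def Ig_def Ih_def blk_def)
  let ?P = "\<lambda>I. PiM I (\<lambda>_ :: nat \<times> nat \<times> nat. gauss s)"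
  have sumI: "sum f I = (\<Sum>i<m. \<Sum>j<n. f (q, i, j)) + f (q + 1, 0, 0) + (\<Sum>i<m. f (q + 2, i, 0)) + (\<Sum>i<n. f (q + 3, i, 0))"
    for f :: "_ \<Rightarrow> real"
    unfolding I_def using disj fin
    by (simp add: sum.union_disjoint sum_blk Ix_def Ig_def Ih_def)
  define a where "a = (\<lambda>(u, v) (l :: nat, i :: nat, j :: nat). if l = q then u i * v j else if l = q + 1 then (1::real) else 0)"
  define b where "b = (\<lambda>(u, v) (l :: nat, i :: nat, j :: nat). if l = q + 2 then u i else if l = q + 3 then v i else (0::real))"
  have aa: "(\<Sum>i\<in>I. a (u, v) i * a (u', v') i) = (\<Sum>i<m. u i * u' i) * (\<Sum>j<n. v j * v' j) + 1" for u v u' v'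
    unfolding sumI by (simp add: a_def sum_product mult_ac)
  have bb: "(\<Sum>i\<in>I. b (u, v) i * b (u', v') i) = (\<Sum>i<m. u i * u' i) + (\<Sum>j<n. v j * v' j)" for u v u' v'
    unfolding sumI by (simp add: b_def)
  have ab: "(\<Sum>i\<in>I. a (u, v) i * b (u', v') i) = 0" for u v u' v'
    unfolding sumI by (simp add: a_def b_def)
  have la: "lin I (a (u, v)) z = bil m n (\<lambda>i j. z (q, i, j)) u v + z (q + 1, 0, 0)" for u v z
    unfolding lin_def sumI by (simp add: a_def bil_def mult_ac)
  have lb: "lin I (b (u, v)) z = (\<Sum>i<m. u i * z (q + 2, i, 0)) + (\<Sum>i<n. v i * z (q + 3, i, 0))" for u v z
    unfolding lin_def sumI by (simp add: b_def)
  have U1: "(\<Sum>i<k. u i * u i) = 1" if "u \<in> usph k" for u k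
    using that by (simp add: usph_def power2_eq_square)
  have Ule: "(\<Sum>i<k. u i * u' i) \<le> 1" if "u \<in> usph k" "u' \<in> usph k" for u u' k
    using sum_mult_le_sqrt[of u u' "{..<k}"] that by (simp add: usph_def)
  define mg where "mg z = sqrt (\<Sum>x\<in>Ig. (z x)\<^sup>2)" for z :: "nat \<times> nat \<times> nat \<Rightarrow> real"
  define mh where "mh z = sqrt (\<Sum>x\<in>Ih. (z x)\<^sup>2)" for z :: "nat \<times> nat \<times> nat \<Rightarrow> real"
  have mgm: "mg \<in> borel_measurable (?P J)" if "Ig \<subseteq> J" for J
    using that unfolding mg_def by (rule measurable_gauss_norm)
  have mhm: "mh \<in> borel_measurable (?P J)" if "Ih \<subseteq> J" for J
    using that unfolding mh_def by (rule measurable_gauss_norm)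
  let ?Bg = "exp (l * s * sqrt m + l\<^sup>2 * s\<^sup>2 / 2)"
  let ?Bh = "exp (l * s * sqrt n + l\<^sup>2 * s\<^sup>2 / 2)"
  have upper: "(\<integral>\<^sup>+z. exp (l * (mg z + mh z)) \<partial>?P I) \<le> ennreal (?Bg * ?Bh)"
  proof -
    have "(\<integral>\<^sup>+z. exp (l * (mg z + mh z)) \<partial>?P I) = (\<integral>\<^sup>+z. 1 * (ennreal (exp (l * mg z)) * ennreal (exp (l * mh z))) \<partial>?P ((blk q m n \<union> Ix) \<union> (Ig \<union> Ih)))"
      by (simp add: I_def Un_assoc distrib_left exp_add ennreal_mult')
    also have "\<dots> = (\<integral>\<^sup>+z. 1 \<partial>?P (blk q m n \<union> Ix)) * (\<integral>\<^sup>+z. ennreal (exp (l * mg z)) * ennreal (exp (l * mh z)) \<partial>?P (Ig \<union> Ih))"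
      using disj fin mgm[of "Ig \<union> Ih"] mhm[of "Ig \<union> Ih"]
      by (intro nn_integral_PiM_factor) (auto simp: mg_def mh_def cong: sum.cong)
    also have "(\<integral>\<^sup>+z. 1 \<partial>?P (blk q m n \<union> Ix)) = 1"
      using prob_space.emeasure_space_1[OF prob_space_PiM_gauss[OF s]] by simp
    also have "(\<integral>\<^sup>+z. ennreal (exp (l * mg z)) * ennreal (exp (l * mh z)) \<partial>?P (Ig \<union> Ih))
        = (\<integral>\<^sup>+z. exp (l * mg z) \<partial>?P Ig) * (\<integral>\<^sup>+z. exp (l * mh z) \<partial>?P Ih)"
      using disj fin mgm[of "Ig"] mhm[of "Ih"]
      by (intro nn_integral_PiM_factor) (auto simp: mg_def mh_def cong: sum.cong)
    also have "\<dots> \<le> ennreal ?Bg * ennreal ?Bh"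
      using nn_integral_gauss_exp_norm_le[OF s fin(3) l] nn_integral_gauss_exp_norm_le[OF s fin(4) l]
      by (intro mult_mono) (auto simp: mg_def mh_def Ig_def Ih_def)
    finally show ?thesis by (simp add: ennreal_mult')
  qed
  let ?mx = "\<lambda>z. Max ((\<lambda>(u, v). bil m n (\<lambda>i j. z (q, i, j)) u v) ` K)"
  have cmp: "(\<integral>\<^sup>+z. exp (l * Max ((\<lambda>k. lin I (a k) z) ` K)) \<partial>?P I) \<le> ennreal (?Bg * ?Bh)"
  proof (rule gaussian_comparison_mgf[OF s fin(1) K(1,2) l, where m = "\<lambda>z. mg z + mh z" and b = b])
    fix k k' assume k: "k \<in> K" "k' \<in> K"
    obtain u v u' v' where uv: "k = (u, v)" "k' = (u', v')" by (cases k, cases k')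
    then have U: "u \<in> usph m" "v \<in> usph n" "u' \<in> usph m" "v' \<in> usph n" using K k by auto
    show "(\<Sum>i\<in>I. a k i * b k' i) = 0" by (simp add: uv ab)
    show "(\<Sum>i\<in>I. a k i * a k i) = (\<Sum>i\<in>I. b k i * b k i)" using U by (simp add: uv aa bb U1)
    have "0 \<le> (1 - (\<Sum>i<m. u i * u' i)) * (1 - (\<Sum>j<n. v j * v' j))"
      using U Ule by (intro mult_nonneg_nonneg) auto
    then show "(\<Sum>i\<in>I. b k i * b k' i) \<le> (\<Sum>i\<in>I. a k i * a k' i)"
      by (simp add: uv aa bb algebra_simps)
  next
    fix z k assume k: "k \<in> K"
    obtain u v where uv: "k = (u, v)" by (cases k)
    then have U: "u \<in> usph m" "v \<in> usph n" using K k by auto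
    show "lin I (b k) z \<le> mg z + mh z"
      using sum_mult_le_sqrt[of u "\<lambda>i. z (q + 2, i, 0)" "{..<m}"] sum_mult_le_sqrt[of v "\<lambda>i. z (q + 3, i, 0)" "{..<n}"] U
      by (simp add: uv lb mg_def mh_def Ig_def Ih_def sum_blk usph_def)
  next
    have "Ig \<subseteq> I" "Ih \<subseteq> I" by (auto simp: I_def)
    then show "(\<lambda>z. mg z + mh z) \<in> borel_measurable (?P I)"
      by (intro borel_measurable_add mgm mhm)
  qed (use upper in auto)
  have mxa: "Max ((\<lambda>k. lin I (a k) z) ` K) = ?mx z + z (q + 1, 0, 0)" for z
  proof -
    have "(\<lambda>k. lin I (a k) z) ` K = (\<lambda>x. x + z (q + 1, 0, 0)) ` ((\<lambda>(u, v). bil m n (\<lambda>i j. z (q, i, j)) u v) ` K)"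
      by (auto simp: image_image la intro!: image_cong)
    also have "Max \<dots> = ?mx z + z (q + 1, 0, 0)"
      using K by (intro mono_Max_commute[symmetric]) (auto simp: mono_def)
    finally show ?thesis .
  qed
  have 1: "(\<integral>\<^sup>+z. exp (l * (?mx z + z (q + 1, 0, 0))) \<partial>?P I) \<le> ennreal (?Bg * ?Bh)"
    using cmp unfolding mxa .
  have mxm: "?mx \<in> borel_measurable (?P (blk q m n))"
  proof (rule borel_measurable_Max[OF K(1)])
    fix k
    have "(\<lambda>z. z (q, i, j)) \<in> borel_measurable (?P (blk q m n))" if "i < m" "j < n" for i j
      using that by (intro measurable_gauss_component) (auto simp: blk_def)
    then show "(\<lambda>z. case k of (u, v) \<Rightarrow> bil m n (\<lambda>i j. z (q, i, j)) u v) \<in> borel_measurable (?P (blk q m n))"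
      unfolding bil_def split_def
      by (intro borel_measurable_sum borel_measurable_times) auto
  qed
  have "(\<integral>\<^sup>+z. exp (l * (?mx z + z (q + 1, 0, 0))) \<partial>?P I) = (\<integral>\<^sup>+z. exp (l * ?mx z) * ennreal (exp (l * z (q + 1, 0, 0))) \<partial>?P I)"
    by (simp add: distrib_left exp_add ennreal_mult')
  also have "\<dots> = (\<integral>\<^sup>+z. exp (l * ?mx z) \<partial>?P (blk q m n)) * (\<integral>\<^sup>+z. exp (l * z (q + 1, 0, 0)) \<partial>?P (Ix \<union> (Ig \<union> Ih)))"
    unfolding I_def
  proof (rule nn_integral_PiM_factor)
    show "(\<lambda>z. ennreal (exp (l * ?mx z))) \<in> borel_measurable (?P (blk q m n))" using mxm by measurable
    fix z z' :: "nat \<times> nat \<times> nat \<Rightarrow> real" assume "\<And>i. i \<in> blk q m n \<Longrightarrow> z i = z' i"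
    then have "bil m n (\<lambda>i j. z (q, i, j)) u v = bil m n (\<lambda>i j. z' (q, i, j)) u v" for u v
      unfolding bil_def by (intro sum.cong refl) (auto simp: blk_def)
    then show "ennreal (exp (l * ?mx z)) = ennreal (exp (l * ?mx z'))" by simp
  qed (use fin disj in \<open>auto simp: Ix_def blk_def\<close>)
  also have "(\<integral>\<^sup>+z. exp (l * z (q + 1, 0, 0)) \<partial>?P (Ix \<union> (Ig \<union> Ih))) = (\<integral>\<^sup>+z. ennreal (exp (l * z (q + 1, 0, 0))) * 1 \<partial>?P (Ix \<union> (Ig \<union> Ih)))"
    by simp
  also have "\<dots> = (\<integral>\<^sup>+z. exp (l * z (q + 1, 0, 0)) \<partial>?P Ix) * (\<integral>\<^sup>+z. 1 \<partial>?P (Ig \<union> Ih))"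
    using disj fin by (intro nn_integral_PiM_factor) (auto simp: Ix_def blk_def)
  also have "(\<integral>\<^sup>+z. 1 \<partial>?P (Ig \<union> Ih)) = 1"
    using prob_space.emeasure_space_1[OF prob_space_PiM_gauss[OF s]] by simp
  also have "(\<integral>\<^sup>+z. exp (l * z (q + 1, 0, 0)) \<partial>?P Ix) = ennreal (exp (l\<^sup>2 * s\<^sup>2 / 2))"
    using nn_integral_PiM_gauss_exp_linear[OF s, of Ix "\<lambda>_. l"] fin by (simp add: Ix_def sum_blk mult_ac)
  finally have 2: "(\<integral>\<^sup>+z. exp (l * ?mx z) \<partial>?P (blk q m n)) * ennreal (exp (l\<^sup>2 * s\<^sup>2 / 2)) \<le> ennreal (?Bg * ?Bh)"
    using 1 by simp
  let ?X = "\<integral>\<^sup>+z. exp (l * ?mx z) \<partial>?P (blk q m n)"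
  \<comment> \<open>Dividing out the moment of the auxiliary variable cancels one of the two terms
    \<open>l^2 * s^2 / 2\<close> of the norms. What remains is the variance of a single entry of the
    matrix.\<close>
  have "?X = ?X * ennreal (exp (l\<^sup>2 * s\<^sup>2 / 2)) * ennreal (exp (- (l\<^sup>2 * s\<^sup>2 / 2)))"
    by (simp add: mult.assoc ennreal_mult'[symmetric] exp_add[symmetric])
  also have "\<dots> \<le> ennreal (?Bg * ?Bh) * ennreal (exp (- (l\<^sup>2 * s\<^sup>2 / 2)))"
    using 2 by (intro mult_right_mono) auto
  also have "\<dots> = ennreal (exp (l * s * (sqrt m + sqrt n) + l\<^sup>2 * s\<^sup>2 / 2))"
    by (simp add: ennreal_mult'[symmetric] exp_add[symmetric] algebra_simps)
  finally show ?thesis .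
qed

section \<open>Operator norms\<close>

text \<open>Suprema over spheres and over pairs of inputs range over uncountable sets. A bound on a
  continuous function is decided on a countable dense subset, which gives measurability and permits
  monotone convergence.\<close>

lemma countable_determining_set:
  fixes S :: "'p::{metric_space,second_countable_topology} set"
  obtains T where "countable T" "T \<subseteq> S"
    "\<And>(f :: 'p \<Rightarrow> real) c p. continuous_on UNIV f \<Longrightarrow> (\<And>p. p \<in> T \<Longrightarrow> f p \<le> c) \<Longrightarrow> p \<in> S \<Longrightarrow> f p \<le> c"
proof -
  obtain T where T: "countable T" "T \<subseteq> S" "S \<subseteq> closure T" by (rule separable)
  show ?thesis
  proof (rule that[OF T(1,2)])
    fix f :: "'p \<Rightarrow> real" and c p
    assume "continuous_on UNIV f" "\<And>p. p \<in> T \<Longrightarrow> f p \<le> c" "p \<in> S"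
    then show "f p \<le> c"
      using T(3) by (intro continuous_le_on_closure[of T f p c]) (auto intro: continuous_on_subset)
  qed
qed

lemma sets_Ball_continuous_le:
  fixes S :: "'p::{metric_space,second_countable_topology} set" and f :: "'w \<Rightarrow> 'p \<Rightarrow> real"
  assumes c: "\<And>w. w \<in> space M \<Longrightarrow> continuous_on UNIV (f w)"
    and m: "\<And>p. p \<in> S \<Longrightarrow> (\<lambda>w. f w p) \<in> borel_measurable M"
  shows "{w \<in> space M. \<forall>p\<in>S. f w p \<le> a} \<in> sets M"
proof -
  obtain T where T: "countable T" "T \<subseteq> S"
    "\<And>(f :: 'p \<Rightarrow> real) c p. continuous_on UNIV f \<Longrightarrow> (\<And>p. p \<in> T \<Longrightarrow> f p \<le> c) \<Longrightarrow> p \<in> S \<Longrightarrow> f p \<le> c"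
    by (rule countable_determining_set[of S]) blast
  have "{w \<in> space M. \<forall>p\<in>S. f w p \<le> a} = {w \<in> space M. \<forall>p\<in>T. f w p \<le> a}"
    using T(2,3) c by blast
  also have "\<dots> \<in> sets M"
  proof (rule sets.sets_Collect_countable_All'[OF _ T(1)])
    fix p assume "p \<in> T"
    then have [measurable]: "(\<lambda>w. f w p) \<in> borel_measurable M" using m T(2) by auto
    show "{w \<in> space M. f w p \<le> a} \<in> sets M" by measurable
  qed
  finally show ?thesis .
qed

text \<open>The operator norm of the matrix. An absolute value would change nothing, since the
  sphere is symmetric under \<open>u \<mapsto> - u\<close>.\<close>

definition opn :: "nat \<Rightarrow> nat \<Rightarrow> (nat \<Rightarrow> nat \<Rightarrow> real) \<Rightarrow> real" where
  "opn m n A = (SUP (u, v)\<in>usph m \<times> usph n. bil m n A u v)"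

lemma abs_usph_le_1:
  assumes "u \<in> usph n" "i < n"
  shows "\<bar>u i\<bar> \<le> 1"
proof -
  have "(u i)\<^sup>2 \<le> (\<Sum>i<n. (u i)\<^sup>2)" using assms by (intro member_le_sum) auto
  then show ?thesis using assms by (simp add: usph_def abs_square_le_1)
qed

lemma usph_nonempty:
  assumes "0 < n"
  shows "(\<lambda>i. if i = 0 then 1 else 0) \<in> usph n"
  using assms by (auto simp: usph_def if_distrib[of "\<lambda>x. x\<^sup>2"] cong: if_cong)

lemma bil_le:
  assumes "u \<in> usph m" "v \<in> usph n"
  shows "bil m n A u v \<le> (\<Sum>i<m. \<Sum>j<n. \<bar>A i j\<bar>)"
  unfolding bil_def
proof (intro sum_mono)
  fix i j assume "i \<in> {..<m}" "j \<in> {..<n}"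
  then have "\<bar>u i\<bar> * \<bar>A i j\<bar> * \<bar>v j\<bar> \<le> 1 * \<bar>A i j\<bar> * 1"
    using assms abs_usph_le_1 by (intro mult_mono) auto
  then show "u i * A i j * v j \<le> \<bar>A i j\<bar>"
    using abs_ge_self[of "u i * A i j * v j"] by (simp add: abs_mult)
qed

lemma bdd_above_bil: "bdd_above ((\<lambda>(u, v). bil m n A u v) ` (usph m \<times> usph n))"
  using bil_le by (auto intro!: bdd_aboveI2[where M = "\<Sum>i<m. \<Sum>j<n. \<bar>A i j\<bar>"])

lemma bil_le_opn: "u \<in> usph m \<Longrightarrow> v \<in> usph n \<Longrightarrow> bil m n A u v \<le> opn m n A"
  unfolding opn_def using cSUP_upper[OF _ bdd_above_bil, of "(u, v)"] by auto

lemma opn_le_iff: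
  assumes "0 < m" "0 < n"
  shows "opn m n A \<le> c \<longleftrightarrow> (\<forall>p\<in>usph m \<times> usph n. bil m n A (fst p) (snd p) \<le> c)"
proof -
  have "usph m \<times> usph n \<noteq> {}" using usph_nonempty assms by blast
  then show ?thesis
    unfolding opn_def by (subst cSUP_le_iff[OF _ bdd_above_bil]) (auto simp: split_def)
qed

lemma opn_nonneg:
  assumes "0 < m" "0 < n"
  shows "0 \<le> opn m n A"
proof -
  let ?u = "\<lambda>i. if i = 0 then 1 else 0 :: real"
  have u: "?u \<in> usph m" "(\<lambda>i. - ?u i) \<in> usph m" "?u \<in> usph n"
    using usph_nonempty assms by (auto simp: usph_def)
  have "bil m n A (\<lambda>i. - ?u i) ?u = - bil m n A ?u ?u"
    by (simp add: bil_def sum_negf)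
  then show ?thesis using bil_le_opn[OF u(1,3), of A] bil_le_opn[OF u(2,3), of A] by linarith
qed

lemma norm_matrix_vector_le_opn:
  assumes "0 < m" "0 < n"
  shows "sqrt (\<Sum>i<m. (\<Sum>j<n. A i j * v j)\<^sup>2) \<le> opn m n A * sqrt (\<Sum>j<n. (v j)\<^sup>2)"
proof -
  let ?w = "\<lambda>i. \<Sum>j<n. A i j * v j"
  define a where "a = sqrt (\<Sum>i<m. (?w i)\<^sup>2)"
  define b where "b = sqrt (\<Sum>j<n. (v j)\<^sup>2)"
  have nn: "0 \<le> a" "0 \<le> b" by (auto simp: a_def b_def sum_nonneg)
  have a2: "(\<Sum>i<m. (?w i)\<^sup>2) = a\<^sup>2" and b2: "(\<Sum>j<n. (v j)\<^sup>2) = b\<^sup>2"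
    by (simp_all add: a_def b_def sum_nonneg)
  have "a \<le> opn m n A * b"
  proof (cases "a = 0 \<or> b = 0")
    case True
    have "a = 0" if "b = 0"
    proof -
      have "v j = 0" if "j < n" for j
        using \<open>b = 0\<close> b2 that by (simp add: sum_nonneg_eq_0_iff)
      then show ?thesis by (simp add: a_def)
    qed
    then show ?thesis using True opn_nonneg[OF assms, of A] nn by auto
  next
    case False
    then have ab: "0 < a" "0 < b" using nn by auto
    \<comment> \<open>Testing the bilinear form at the normalised image and the normalised argument
      yields exactly \<open>a / b\<close>.\<close>
    define u where "u i = (if i < m then ?w i / a else 0)" for i
    define v' where "v' j = (if j < n then v j / b else 0)" for j
    have "(\<Sum>i<m. (u i)\<^sup>2) = (\<Sum>i<m. (?w i)\<^sup>2) / a\<^sup>2"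
      unfolding sum_divide_distrib by (intro sum.cong) (auto simp: u_def power_divide)
    then have u: "u \<in> usph m" using ab unfolding a2 by (simp add: usph_def u_def)
    have "(\<Sum>i<n. (v' i)\<^sup>2) = (\<Sum>i<n. (v i)\<^sup>2) / b\<^sup>2"
      unfolding sum_divide_distrib by (intro sum.cong) (auto simp: v'_def power_divide)
    then have v': "v' \<in> usph n" using ab unfolding b2 by (simp add: usph_def v'_def)
    have "bil m n A u v' = (\<Sum>i<m. ?w i / a * (?w i / b))"
      unfolding bil_def by (simp add: u_def v'_def sum_distrib_left sum_divide_distrib mult_ac)
    also have "\<dots> = (\<Sum>i<m. (?w i)\<^sup>2) / (a * b)"
    proof -
      have "?w i / a * (?w i / b) = (?w i)\<^sup>2 / (a * b)" for i by (simp add: power2_eq_square)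
      then show ?thesis by (simp only: sum_divide_distrib[symmetric])
    qed
    also have "\<dots> = a / b" unfolding a2 using ab by (simp add: power2_eq_square)
    finally show ?thesis using bil_le_opn[OF u v', of A] ab by (simp add: divide_le_eq)
  qed
  then show ?thesis by (simp add: a_def b_def)
qed

lemma continuous_on_bil: "continuous_on UNIV (\<lambda>p. bil m n A (fst p) (snd p))"
proof -
  have "continuous_on UNIV (\<lambda>p :: (nat \<Rightarrow> real) \<times> (nat \<Rightarrow> real). fst p i)"
    "continuous_on UNIV (\<lambda>p :: (nat \<Rightarrow> real) \<times> (nat \<Rightarrow> real). snd p i)" for i
    by (intro continuous_on_compose2[OF continuous_on_product_coordinates continuous_on_fst[OF continuous_on_id]]
          continuous_on_compose2[OF continuous_on_product_coordinates continuous_on_snd[OF continuous_on_id]]; simp)+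
  then show ?thesis unfolding bil_def by (intro continuous_intros)
qed

lemma measurable_opn:
  assumes mn: "0 < m" "0 < n"
    and A: "\<And>i j. i < m \<Longrightarrow> j < n \<Longrightarrow> (\<lambda>x. A x i j) \<in> borel_measurable M"
  shows "(\<lambda>x. opn m n (A x)) \<in> borel_measurable M"
proof (subst borel_measurable_iff_le, intro allI)
  fix a
  have "(\<lambda>x. bil m n (A x) u v) \<in> borel_measurable M" for u v
    unfolding bil_def using A by (intro borel_measurable_sum borel_measurable_times) auto
  then show "{x \<in> space M. opn m n (A x) \<le> a} \<in> sets M"
    unfolding opn_le_iff[OF mn] by (intro sets_Ball_continuous_le continuous_on_bil)
qed

text \<open>The bound for finite sets of unit vectors does not depend on their number, so it
  survives the supremum along initial segments of a dense sequence.\<close>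

lemma gaussian_opn_mgf:
  assumes s: "0 < s" and l: "0 \<le> l" and mn: "0 < m" "0 < n"
  shows "(\<integral>\<^sup>+z. exp (l * opn m n (\<lambda>i j. z (q, i, j))) \<partial>PiM (blk q m n) (\<lambda>_. gauss s))
    \<le> ennreal (exp (l * s * (sqrt m + sqrt n) + l\<^sup>2 * s\<^sup>2 / 2))"
proof -
  let ?P = "PiM (blk q m n) (\<lambda>_. gauss s)" and ?A = "\<lambda>z i j. z (q, i, j)"
  obtain T where T: "countable T" "T \<subseteq> usph m \<times> usph n"
    "\<And>(f :: (nat \<Rightarrow> real) \<times> (nat \<Rightarrow> real) \<Rightarrow> real) c p.
      continuous_on UNIV f \<Longrightarrow> (\<And>p. p \<in> T \<Longrightarrow> f p \<le> c) \<Longrightarrow> p \<in> usph m \<times> usph n \<Longrightarrow> f p \<le> c"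
    by (rule countable_determining_set[of "usph m \<times> usph n"]) blast
  \<comment> \<open>Over an empty \<open>T\<close> the constant 1 would vacuously be bounded by 0 on
    the nonempty product of spheres.\<close>
  have "T \<noteq> {}"
  proof
    assume "T = {}"
    then have "(1::real) \<le> 0"
      using T(3)[of "\<lambda>_. 1" 0 "(\<lambda>i. if i = 0 then 1 else 0, \<lambda>i. if i = 0 then 1 else 0)"] usph_nonempty mn by auto
    then show False by simp
  qed
  define K where "K k = from_nat_into T ` {..k}" for k
  have K: "finite (K k)" "K k \<noteq> {}" "K k \<subseteq> usph m \<times> usph n" for k
    unfolding K_def using from_nat_into[OF \<open>T \<noteq> {}\<close>] T(2) by (simp, simp, blast)
  define f where "f k z = Max ((\<lambda>(u, v). bil m n (?A z) u v) ` K k)" for k z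
  have inc: "incseq (\<lambda>k. f k z)" for z
    unfolding f_def incseq_def using K by (intro allI impI Max_mono image_mono) (auto simp: K_def)
  have le: "f k z \<le> opn m n (?A z)" for k z
  proof -
    have "f k z \<in> (\<lambda>(u, v). bil m n (?A z) u v) ` K k" unfolding f_def using K by (intro Max_in) auto
    then show ?thesis using K(3) bil_le_opn by fastforce
  qed
  have lim: "(\<lambda>k. f k z) \<longlonglongrightarrow> opn m n (?A z)" for z
  proof -
    have b: "bdd_above (range (\<lambda>k. f k z))" using le by (intro bdd_aboveI2)
    have "bil m n (?A z) (fst p) (snd p) \<le> (SUP k. f k z)" if p: "p \<in> usph m \<times> usph n" for p
    proof (rule T(3)[OF continuous_on_bil _ p])
      fix p assume "p \<in> T"
      then obtain k where k: "p = from_nat_into T k" using from_nat_into_surj[OF T(1)] by metis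
      have "bil m n (?A z) (fst p) (snd p) \<le> f k z"
        unfolding f_def by (intro Max_ge) (auto simp: K_def k split_def)
      also have "\<dots> \<le> (SUP k. f k z)" by (rule cSUP_upper[OF _ b]) simp
      finally show "bil m n (?A z) (fst p) (snd p) \<le> (SUP k. f k z)" .
    qed
    then have "opn m n (?A z) \<le> (SUP k. f k z)" unfolding opn_le_iff[OF mn] by blast
    moreover have "(SUP k. f k z) \<le> opn m n (?A z)" using le by (intro cSUP_least) auto
    ultimately show ?thesis using LIMSEQ_incseq_SUP[OF b inc] by simp
  qed
  have meas: "(\<lambda>z. ennreal (exp (l * f k z))) \<in> borel_measurable ?P" for k
  proof -
    have "f k \<in> borel_measurable ?P"
      unfolding f_def
    proof (rule borel_measurable_Max[OF K(1)])
      fix p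
      show "(\<lambda>z. case p of (u, v) \<Rightarrow> bil m n (?A z) u v) \<in> borel_measurable ?P"
        unfolding bil_def split_def
        by (intro borel_measurable_sum borel_measurable_times measurable_gauss_component) (auto simp: blk_def)
    qed
    then show ?thesis by measurable
  qed
  have ince: "incseq (\<lambda>k. ennreal (exp (l * f k z)))" for z
    using inc l by (auto simp: incseq_def intro!: ennreal_leI mult_left_mono)
  have sup: "ennreal (exp (l * opn m n (?A z))) = (SUP k. ennreal (exp (l * f k z)))" for z
    by (rule LIMSEQ_unique[OF _ LIMSEQ_SUP[OF ince]]) (intro tendsto_ennrealI tendsto_intros lim)
  have "(\<integral>\<^sup>+z. exp (l * opn m n (?A z)) \<partial>?P) = (SUP k. \<integral>\<^sup>+z. exp (l * f k z) \<partial>?P)"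
    unfolding sup using ince meas
    by (intro nn_integral_monotone_convergence_SUP) (auto simp: incseq_def le_fun_def)
  also have "\<dots> \<le> ennreal (exp (l * s * (sqrt m + sqrt n) + l\<^sup>2 * s\<^sup>2 / 2))"
    unfolding f_def by (intro SUP_least gaussian_matrix_finite_mgf s l K)
  finally show ?thesis .
qed

section \<open>From exponential moments to tails and means\<close>

lemma chernoff_subgaussian:
  assumes M: "prob_space M" and [measurable]: "X \<in> borel_measurable M"
    and s: "0 < s" and t: "0 \<le> t" and k: "1 \<le> k"
    and mgf: "\<And>l. 0 \<le> l \<Longrightarrow> (\<integral>\<^sup>+x. exp (l * X x) \<partial>M) \<le> ennreal (k * exp (l * c + l\<^sup>2 * s\<^sup>2 / 2))"
  shows "emeasure M {x \<in> space M. X x \<le> c + s * t} \<ge> ennreal (1 - k * exp (- t\<^sup>2 / 2))"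
proof (cases "t = 0")
  case True
  then show ?thesis using k by (simp add: ennreal_neg)
next
  case False
  interpret prob_space M by fact
  \<comment> \<open>The minimiser of \<open>l^2 * s^2 / 2 - l * s * t\<close>. The prefactor
    \<open>k\<close> is carried along to hold the bound on the number of affine pieces; single
    layers use \<open>k = 1\<close>.\<close>
  define l where "l = t / s"
  have l: "0 < l" "l * s = t" using False t s by (auto simp: l_def)
  have "emeasure M {x \<in> space M. X x \<ge> c + s * t} \<le> ennreal (exp (- l * (c + s * t))) * (\<integral>\<^sup>+x. ennreal (exp (l * X x)) * indicator (space M) x \<partial>M)"
    using l by (intro Chernoff_ineq_nn_integral_ge) auto
  also have "(\<integral>\<^sup>+x. ennreal (exp (l * X x)) * indicator (space M) x \<partial>M) = (\<integral>\<^sup>+x. exp (l * X x) \<partial>M)"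
    by (intro nn_integral_cong) simp
  also have "ennreal (exp (- l * (c + s * t))) * \<dots> \<le> ennreal (exp (- l * (c + s * t))) * ennreal (k * exp (l * c + l\<^sup>2 * s\<^sup>2 / 2))"
    using l by (intro mult_left_mono mgf) auto
  also have "\<dots> = ennreal (k * exp (- t\<^sup>2 / 2))"
  proof -
    have "- l * (c + s * t) + (l * c + l\<^sup>2 * s\<^sup>2 / 2) = - (l * s) * t + (l * s)\<^sup>2 / 2"
      by (simp add: algebra_simps power2_eq_square)
    also have "\<dots> = - t\<^sup>2 / 2" unfolding l by (simp add: power2_eq_square)
    finally have "exp (- l * (c + s * t)) * exp (l * c + l\<^sup>2 * s\<^sup>2 / 2) = exp (- t\<^sup>2 / 2)"
      by (simp only: exp_add[symmetric])
    then show ?thesis by (simp add: ennreal_mult'[symmetric] mult.left_commute)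
  qed
  finally have "measure M {x \<in> space M. X x \<ge> c + s * t} \<le> k * exp (- t\<^sup>2 / 2)"
    using k by (simp add: emeasure_eq_measure)
  moreover have "measure M {x \<in> space M. X x > c + s * t} \<le> measure M {x \<in> space M. X x \<ge> c + s * t}"
    by (intro finite_measure_mono) auto
  moreover have "measure M {x \<in> space M. X x \<le> c + s * t} = 1 - measure M {x \<in> space M. X x > c + s * t}"
    by (subst prob_neg[symmetric]) (auto simp: not_less)
  ultimately show ?thesis by (simp add: emeasure_eq_measure)
qed

text \<open>Jensen's inequality, obtained by integrating the tangent line of the exponential at
  \<open>ln a\<close>; integrability of \<open>X\<close> comes out as a consequence.\<close>

lemma nn_integral_le_ln_mgf:
  assumes M: "prob_space M" and [measurable]: "X \<in> borel_measurable M" and X: "\<And>x. x \<in> space M \<Longrightarrow> 0 \<le> X x"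
    and l: "0 < l" and a: "1 \<le> a" and mgf: "(\<integral>\<^sup>+x. exp (l * X x) \<partial>M) \<le> ennreal a"
  shows "(\<integral>\<^sup>+x. X x \<partial>M) \<le> ennreal (ln a / l)"
proof -
  interpret prob_space M by fact
  have le: "l * X x + 1 \<le> ln a + 1 / a * exp (l * X x)" for x
    using exp_ge_add_one_self[of "l * X x - ln a"] a by (simp add: exp_diff)
  have "ennreal l * (\<integral>\<^sup>+x. X x \<partial>M) + 1 = (\<integral>\<^sup>+x. ennreal (l * X x + 1) \<partial>M)"
  proof -
    have "(\<integral>\<^sup>+x. ennreal (l * X x + 1) \<partial>M) = (\<integral>\<^sup>+x. ennreal l * ennreal (X x) + 1 \<partial>M)"
      using l X by (intro nn_integral_cong) (simp add: ennreal_plus ennreal_mult')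
    then show ?thesis by (simp add: nn_integral_add nn_integral_cmult emeasure_space_1)
  qed
  also have "\<dots> \<le> (\<integral>\<^sup>+x. ennreal (ln a) + ennreal (1 / a) * ennreal (exp (l * X x)) \<partial>M)"
    using le a by (intro nn_integral_mono) (simp add: ennreal_plus[symmetric] ennreal_mult'[symmetric] ennreal_leI del: ennreal_plus)
  also have "\<dots> = ennreal (ln a) + ennreal (1 / a) * (\<integral>\<^sup>+x. exp (l * X x) \<partial>M)"
    by (simp add: nn_integral_add nn_integral_cmult emeasure_space_1)
  also have "\<dots> \<le> ennreal (ln a) + ennreal (1 / a) * ennreal a"
    using mgf by (intro add_left_mono mult_left_mono) auto
  also have "ennreal (1 / a) * ennreal a = 1" using a by (simp add: ennreal_mult'[symmetric])
  finally have "ennreal l * (\<integral>\<^sup>+x. X x \<partial>M) \<le> ennreal (ln a)"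
    by (simp add: ennreal_add_left_cancel_le add.commute[of _ 1])
  then have "ennreal (1 / l) * (ennreal l * (\<integral>\<^sup>+x. X x \<partial>M)) \<le> ennreal (1 / l) * ennreal (ln a)"
    by (rule mult_left_mono) simp
  then show ?thesis using l a by (simp add: mult.assoc[symmetric] ennreal_mult'[symmetric])
qed

section \<open>Affine pieces of a ReLU network\<close>

text \<open>On the set of inputs sharing an activation pattern in the first \<open>l\<close> layers, the map \<open>x \<mapsto> hidden x l\<close>
  is affine; \<open>aff\<close> records the matrix and the offset of the affine piece containing \<open>x\<close>.\<close>

definition apply_aff :: "nat \<Rightarrow> (nat \<Rightarrow> nat \<Rightarrow> real) \<times> (nat \<Rightarrow> real) \<Rightarrow> (nat \<Rightarrow> real) \<Rightarrow> nat \<Rightarrow> real" where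
  "apply_aff d P x i = (\<Sum>k<d. fst P i k * x k) + snd P i"

definition layer_aff ::
  "nat \<Rightarrow> nat \<Rightarrow> (nat \<times> nat \<times> nat \<Rightarrow> real) \<Rightarrow> (nat \<times> nat \<Rightarrow> real) \<Rightarrow> nat
    \<Rightarrow> (nat \<Rightarrow> nat \<Rightarrow> real) \<times> (nat \<Rightarrow> real) \<Rightarrow> (nat \<Rightarrow> nat \<Rightarrow> real) \<times> (nat \<Rightarrow> real)" where
  "layer_aff d N W b l P =
    (\<lambda>i k. \<Sum>j<in_dim d N l. W (l, i, j) * fst P j k, \<lambda>i. (\<Sum>j<in_dim d N l. W (l, i, j) * snd P j) + b (l, i))"

definition mask_aff :: "nat set \<Rightarrow> (nat \<Rightarrow> nat \<Rightarrow> real) \<times> (nat \<Rightarrow> real) \<Rightarrow> (nat \<Rightarrow> nat \<Rightarrow> real) \<times> (nat \<Rightarrow> real)" where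
  "mask_aff S P = (\<lambda>i k. if i \<in> S then fst P i k else 0, \<lambda>i. if i \<in> S then snd P i else 0)"

text \<open>With the strict inequality a neuron at pre-activation zero counts as inactive; its
  output is zero in either case.\<close>

definition active :: "nat \<Rightarrow> nat \<Rightarrow> (nat \<Rightarrow> nat \<Rightarrow> real) \<times> (nat \<Rightarrow> real) \<Rightarrow> (nat \<Rightarrow> real) \<Rightarrow> nat set" where
  "active d N P x = {i. i < N \<and> 0 < apply_aff d P x i}"

fun aff ::
  "nat \<Rightarrow> nat \<Rightarrow> (nat \<times> nat \<times> nat \<Rightarrow> real) \<Rightarrow> (nat \<times> nat \<Rightarrow> real) \<Rightarrow> (nat \<Rightarrow> real) \<Rightarrow> nat
    \<Rightarrow> (nat \<Rightarrow> nat \<Rightarrow> real) \<times> (nat \<Rightarrow> real)" where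
  "aff d N W b x 0 = (\<lambda>i k. if i = k then 1 else 0, \<lambda>i. 0)"
| "aff d N W b x (Suc l) =
    (let Q = layer_aff d N W b l (aff d N W b x l) in mask_aff (active d N Q x) Q)"

lemma apply_layer_aff:
  "apply_aff d (layer_aff d N W b l P) x i = (\<Sum>j<in_dim d N l. W (l, i, j) * apply_aff d P x j) + b (l, i)"
  by (simp add: apply_aff_def layer_aff_def distrib_left sum.distrib sum_distrib_left sum_distrib_right
      mult.assoc sum.swap[of _ "{..<d}"])

lemma hidden_eq_apply_aff:
  "i < in_dim d N l \<Longrightarrow> hidden d N W b x l i = apply_aff d (aff d N W b x l) x i"
proof (induction l arbitrary: i)
  case 0
  then show ?case by (simp add: in_dim_def apply_aff_def if_distrib[of "\<lambda>c. c * _"] cong: if_cong)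
next
  case (Suc l)
  let ?Q = "layer_aff d N W b l (aff d N W b x l)"
  have i: "i < N" using Suc.prems by (simp add: in_dim_def)
  have "hidden d N W b x (Suc l) i = relu (apply_aff d ?Q x i)"
    using i Suc.IH by (simp add: apply_layer_aff)
  also have "\<dots> = apply_aff d (mask_aff (active d N ?Q x) ?Q) x i"
    using i by (auto simp: relu_def active_def mask_aff_def apply_aff_def)
  finally show ?case by (simp add: Let_def)
qed

text \<open>The pieces of layer \<open>l\<close> read only weights of earlier layers. Hence the
  output weights can be integrated while the set of pieces stays frozen.\<close>

lemma aff_cong:
  assumes "\<And>l' i j. l' < l \<Longrightarrow> i < N \<Longrightarrow> j < in_dim d N l' \<Longrightarrow> W (l', i, j) = W' (l', i, j)"
  shows "aff d N W b x l = aff d N W' b x l"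
  using assms
proof (induction l)
  case (Suc l)
  have eq: "aff d N W b x l = aff d N W' b x l" using Suc by simp
  have m: "mask_aff (active d N (layer_aff d N W b l P) x) (layer_aff d N W b l P)
     = mask_aff (active d N (layer_aff d N W' b l P) x) (layer_aff d N W' b l P)" for P
  proof -
    have L: "fst (layer_aff d N W b l P) i k = fst (layer_aff d N W' b l P) i k"
      "snd (layer_aff d N W b l P) i = snd (layer_aff d N W' b l P) i" if "i < N" for i k
      using Suc.prems that by (auto simp: layer_aff_def)
    then have "active d N (layer_aff d N W b l P) x = active d N (layer_aff d N W' b l P) x"
      by (auto simp: active_def apply_aff_def)
    then show ?thesis using L by (auto simp: mask_aff_def active_def fun_eq_iff)
  qed
  show ?case by (simp add: Let_def eq m)
qed simp

text \<open>Each piece of layer \<open>l\<close> extends to an affine map on the whole input space,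
  so its successors are counted by the sign patterns of \<open>N\<close> affine functions in
  \<open>d\<close> variables, however narrow the region of the piece is.\<close>

lemma card_range_aff:
  "finite (range (\<lambda>x. aff d N W b x l)) \<and> card (range (\<lambda>x. aff d N W b x l)) \<le> (\<Sum>j\<le>d+1. N choose j) ^ l"
proof (induction l)
  case (Suc l)
  let ?R = "\<lambda>l. range (\<lambda>x. aff d N W b x l)"
  let ?F = "\<lambda>P. (\<lambda>S. mask_aff S (layer_aff d N W b l P)) ` range (active d N (layer_aff d N W b l P))"
  have fin: "finite (range (active d N Q))" for Q
    by (rule finite_subset[of _ "Pow {..<N}"]) (auto simp: active_def)
  have c: "card (?F P) \<le> (\<Sum>j\<le>d+1. N choose j)" for P
  proof -
    have "card (?F P) \<le> card (range (active d N (layer_aff d N W b l P)))"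
      by (rule card_image_le[OF fin])
    also have "\<dots> \<le> (\<Sum>j\<le>d+1. N choose j)"
      unfolding active_def apply_aff_def by (rule card_affine_sign_patterns)
    finally show ?thesis .
  qed
  have sub: "?R (Suc l) \<subseteq> (\<Union>P\<in>?R l. ?F P)" by (auto simp: Let_def)
  have finU: "finite (\<Union>P\<in>?R l. ?F P)" by (rule finite_UN_I) (use Suc fin in auto)
  have "card (?R (Suc l)) \<le> card (\<Union>P\<in>?R l. ?F P)" by (rule card_mono[OF finU sub])
  also have "\<dots> \<le> (\<Sum>P\<in>?R l. card (?F P))" by (rule card_UN_le) (use Suc in simp)
  also have "\<dots> \<le> (\<Sum>P\<in>?R l. \<Sum>j\<le>d+1. N choose j)" by (rule sum_mono) (rule c)
  also have "\<dots> = card (?R l) * (\<Sum>j\<le>d+1. N choose j)" by simp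
  also have "\<dots> \<le> (\<Sum>j\<le>d+1. N choose j) ^ l * (\<Sum>j\<le>d+1. N choose j)" using Suc by simp
  finally show ?case using finite_subset[OF sub finU] by (simp add: mult.commute)
qed simp

section \<open>Gradients of the pieces and the Lipschitz constant\<close>

definition layer_norm :: "nat \<Rightarrow> nat \<Rightarrow> (nat \<times> nat \<times> nat \<Rightarrow> real) \<Rightarrow> nat \<Rightarrow> real" where
  "layer_norm d N W l = opn N (in_dim d N l) (\<lambda>i j. W (l, i, j))"

text \<open>Masking replaces rows by zero and cannot increase the norm, so the bound is the same for
  every activation pattern and every bias.\<close>

lemma norm_aff_le:
  assumes "0 < d" "0 < N"
  shows "sqrt (\<Sum>i<in_dim d N l. (\<Sum>k<d. fst (aff d N W b x l) i k * v k)\<^sup>2)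
    \<le> (\<Prod>l'<l. layer_norm d N W l') * sqrt (\<Sum>k<d. (v k)\<^sup>2)"
proof (induction l)
  case 0
  have "(\<Sum>k<d. fst (aff d N W b x 0) i k * v k) = v i" if "i < d" for i
    using that by (simp add: if_distrib[of "\<lambda>c. c * _"] cong: if_cong)
  then show ?case by (simp add: in_dim_def)
next
  case (Suc l)
  let ?P = "aff d N W b x l"
  let ?w = "\<lambda>j. \<Sum>k<d. fst ?P j k * v k"
  have pos: "0 < in_dim d N l" using assms by (simp add: in_dim_def)
  have "(\<Sum>k<d. fst (layer_aff d N W b l ?P) i k * v k) = (\<Sum>j<in_dim d N l. W (l, i, j) * ?w j)" for i
    by (simp add: layer_aff_def sum_distrib_left sum_distrib_right mult.assoc sum.swap[of _ "{..<d}"])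
  then have "((\<Sum>k<d. fst (aff d N W b x (Suc l)) i k * v k)\<^sup>2) \<le> (\<Sum>j<in_dim d N l. W (l, i, j) * ?w j)\<^sup>2" for i
    by (cases "i \<in> active d N (layer_aff d N W b l ?P) x") (simp_all add: Let_def mask_aff_def)
  then have "sqrt (\<Sum>i<in_dim d N (Suc l). (\<Sum>k<d. fst (aff d N W b x (Suc l)) i k * v k)\<^sup>2)
      \<le> sqrt (\<Sum>i<N. (\<Sum>j<in_dim d N l. W (l, i, j) * ?w j)\<^sup>2)"
    by (intro real_sqrt_le_mono) (simp add: in_dim_def sum_mono)
  also have "\<dots> \<le> layer_norm d N W l * sqrt (\<Sum>j<in_dim d N l. (?w j)\<^sup>2)"
    unfolding layer_norm_def by (rule norm_matrix_vector_le_opn[OF assms(2) pos])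
  also have "\<dots> \<le> layer_norm d N W l * ((\<Prod>l'<l. layer_norm d N W l') * sqrt (\<Sum>k<d. (v k)\<^sup>2))"
    using Suc opn_nonneg[OF assms(2) pos] by (intro mult_left_mono) (auto simp: layer_norm_def)
  finally show ?case by (simp add: mult_ac)
qed

lemma continuous_on_hidden: "continuous_on UNIV (\<lambda>x. hidden d N W b x l i)"
proof (induction l arbitrary: i)
  case (Suc l)
  then show ?case
    unfolding hidden.simps relu_def by (cases "i < N") (auto intro!: continuous_intros)
qed simp

lemma continuous_on_relu_net: "continuous_on UNIV (relu_net d N L \<omega>)"
  unfolding relu_net_def by (intro continuous_intros continuous_on_hidden)

definition grad_norm :: "nat \<Rightarrow> nat \<Rightarrow> (nat \<Rightarrow> real) \<Rightarrow> (nat \<Rightarrow> nat \<Rightarrow> real) \<times> (nat \<Rightarrow> real) \<Rightarrow> real" where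
  "grad_norm d N w P = sqrt (\<Sum>k<d. (\<Sum>j<N. w j * fst P j k)\<^sup>2)"

text \<open>Restrict the network to the segment from \<open>x\<close> to \<open>y\<close>. On the
  parameters of one piece it is affine with slope at most \<open>R * D\<close> by Cauchy-Schwarz,
  and finitely many pieces cover the segment.\<close>

lemma relu_net_lipschitz:
  assumes L: "1 \<le> L" and R: "\<And>x. grad_norm d N (\<lambda>j. fst \<omega> (L, 0, j)) (aff d N (fst \<omega>) (snd \<omega>) x L) \<le> R"
  shows "\<bar>relu_net d N L \<omega> x - relu_net d N L \<omega> y\<bar> \<le> R * dist_d d x y"
proof -
  let ?A = "\<lambda>x. aff d N (fst \<omega>) (snd \<omega>) x L" and ?w = "\<lambda>j. fst \<omega> (L, 0, j)"
  define \<gamma> where "\<gamma> t k = x k + t * (y k - x k)" for t :: real and k :: nat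
  let ?g = "\<lambda>t. relu_net d N L \<omega> (\<gamma> t)"
  define D where "D = dist_d d x y"
  have D0: "0 \<le> D" by (simp add: D_def dist_d_def sum_nonneg)
  have "0 \<le> grad_norm d N ?w (?A x)" by (simp add: grad_norm_def sum_nonneg)
  then have R0: "0 \<le> R" using R[of x] by linarith
  have c\<gamma>: "continuous_on UNIV \<gamma>"
    unfolding \<gamma>_def by (intro continuous_on_coordinatewise_then_product continuous_intros)
  have cg: "continuous_on UNIV ?g"
    by (rule continuous_on_compose2[OF continuous_on_relu_net c\<gamma>]) simp
  have net: "relu_net d N L \<omega> z = (\<Sum>j<N. ?w j * apply_aff d (?A z) z j) + snd \<omega> (L, 0)" for z
    using L by (simp add: relu_net_def hidden_eq_apply_aff in_dim_def)
  have piece: "(R * D)-lipschitz_on {t. ?A (\<gamma> t) = P} ?g" for P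
  proof (rule lipschitz_onI)
    show "0 \<le> R * D" using R0 D0 by simp
    fix s t assume "s \<in> {t. ?A (\<gamma> t) = P}" "t \<in> {t. ?A (\<gamma> t) = P}"
    then have st: "?A (\<gamma> s) = P" "?A (\<gamma> t) = P" by auto
    have "?g s - ?g t = (\<Sum>j<N. ?w j * (\<Sum>k<d. fst P j k * ((s - t) * (y k - x k))))"
    proof -
      have "apply_aff d P (\<gamma> s) j - apply_aff d P (\<gamma> t) j = (\<Sum>k<d. fst P j k * ((s - t) * (y k - x k)))" for j
        unfolding apply_aff_def \<gamma>_def by (simp add: sum_subtractf[symmetric]) (simp add: algebra_simps)
      then show ?thesis
        unfolding net st by (simp add: sum_subtractf[symmetric] right_diff_distrib[symmetric])
    qed
    also have "\<dots> = (\<Sum>k<d. (\<Sum>j<N. ?w j * fst P j k) * ((s - t) * (y k - x k)))"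
      by (simp add: sum_distrib_left sum_distrib_right mult.assoc sum.swap[of _ "{..<d}"])
    finally have eq: "?g s - ?g t = (\<Sum>k<d. (\<Sum>j<N. ?w j * fst P j k) * ((s - t) * (y k - x k)))" .
    have "\<bar>?g s - ?g t\<bar> \<le> grad_norm d N ?w P * sqrt (\<Sum>k<d. ((s - t) * (y k - x k))\<^sup>2)"
    proof (rule abs_leI)
      show "?g s - ?g t \<le> grad_norm d N ?w P * sqrt (\<Sum>k<d. ((s - t) * (y k - x k))\<^sup>2)"
        unfolding eq grad_norm_def by (rule sum_mult_le_sqrt)
      have "- (?g s - ?g t) = (\<Sum>k<d. (\<Sum>j<N. ?w j * fst P j k) * - ((s - t) * (y k - x k)))"
        unfolding eq by (simp add: sum_negf)
      also have "\<dots> \<le> grad_norm d N ?w P * sqrt (\<Sum>k<d. (- ((s - t) * (y k - x k)))\<^sup>2)"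
        unfolding grad_norm_def by (rule sum_mult_le_sqrt)
      finally show "- (?g s - ?g t) \<le> grad_norm d N ?w P * sqrt (\<Sum>k<d. ((s - t) * (y k - x k))\<^sup>2)" by simp
    qed
    also have "(\<Sum>k<d. ((s - t) * (y k - x k))\<^sup>2) = (s - t)\<^sup>2 * (\<Sum>k<d. (x k - y k)\<^sup>2)"
      by (simp add: sum_distrib_left power_mult_distrib power2_commute[of "y _"])
    also have "sqrt \<dots> = \<bar>s - t\<bar> * D" by (simp add: real_sqrt_mult D_def dist_d_def)
    also have "grad_norm d N ?w P * (\<bar>s - t\<bar> * D) \<le> R * (\<bar>s - t\<bar> * D)"
      using R[of "\<gamma> s"] D0 unfolding st by (intro mult_right_mono) auto
    finally show "dist (?g s) (?g t) \<le> R * D * dist s t"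
      by (simp add: dist_real_def mult_ac)
  qed
  \<comment> \<open>The parameter set of a piece need not be closed or connected. Continuity extends
    its Lipschitz bound to the closure, and a finite closed cover of an interval with a common
    constant gives the constant on the interval.\<close>
  have "(R * D)-lipschitz_on {0..1} ?g"
  proof (rule lipschitz_on_closed_Union[where I = "range ?A" and U = "\<lambda>P. closure {t. ?A (\<gamma> t) = P}"])
    show "(R * D)-lipschitz_on (closure {t. ?A (\<gamma> t) = P}) ?g" for P
      by (rule lipschitz_on_closure[OF piece continuous_on_subset[OF cg]]) simp
    show "finite (range ?A)" using card_range_aff by blast
    show "{0..1} \<subseteq> (\<Union>P\<in>range ?A. closure {t. ?A (\<gamma> t) = P})"
      using closure_subset by fastforce
  qed (use R0 D0 in auto)
  then have "dist (?g 0) (?g 1) \<le> R * D * dist (0::real) 1"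
    by (rule lipschitz_onD) auto
  moreover have "\<gamma> 0 = x" "\<gamma> 1 = y" by (auto simp: \<gamma>_def)
  ultimately show ?thesis by (simp add: dist_real_def D_def)
qed

lemma dist_d_pos:
  assumes "x \<in> Rvec d" "y \<in> Rvec d" "x \<noteq> y"
  shows "0 < dist_d d x y"
proof -
  obtain k where k: "x k \<noteq> y k" using assms by (auto simp: fun_eq_iff)
  then have "k < d" using assms by (force simp: Rvec_def not_less)
  then have "0 < (\<Sum>j<d. (x j - y j)\<^sup>2)" using k by (intro sum_pos2[of _ k]) auto
  then show ?thesis by (simp add: dist_d_def)
qed

text \<open>The difference form of the bound has no division: it is continuous in the pair of
  inputs, also on the diagonal, and so can be tested on a countable dense set.\<close>

lemma Lip_props:
  assumes R: "\<And>x y. \<bar>f x - f y\<bar> \<le> R * dist_d d x y"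
  shows Lip_nonneg: "0 \<le> Lip d f"
    and Lip_le_iff: "0 \<le> c \<Longrightarrow> Lip d f \<le> c \<longleftrightarrow> (\<forall>p\<in>Rvec d \<times> Rvec d. \<bar>f (fst p) - f (snd p)\<bar> - c * dist_d d (fst p) (snd p) \<le> 0)"
proof -
  let ?S = "insert 0 {\<bar>f x - f y\<bar> / dist_d d x y | x y. x \<in> Rvec d \<and> y \<in> Rvec d \<and> x \<noteq> y}"
  have bdd: "bdd_above ?S"
  proof (rule bdd_aboveI)
    fix r assume "r \<in> ?S"
    then consider "r = 0" | x y where "r = \<bar>f x - f y\<bar> / dist_d d x y" "x \<in> Rvec d" "y \<in> Rvec d" "x \<noteq> y" by auto
    then show "r \<le> max 0 R"
    proof cases
      case 2
      then have "r \<le> R" using dist_d_pos R[of x y] by (simp add: divide_le_eq)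
      then show ?thesis by simp
    qed simp
  qed
  show "0 \<le> Lip d f" unfolding Lip_def by (rule cSup_upper[OF _ bdd]) simp
  assume c: "0 \<le> c"
  have "Lip d f \<le> c \<longleftrightarrow> (\<forall>r\<in>?S. r \<le> c)"
    unfolding Lip_def by (rule cSup_le_iff[OF _ bdd]) simp
  also have "\<dots> \<longleftrightarrow> (\<forall>x\<in>Rvec d. \<forall>y\<in>Rvec d. x \<noteq> y \<longrightarrow> \<bar>f x - f y\<bar> / dist_d d x y \<le> c)"
    using c by blast
  also have "\<dots> \<longleftrightarrow> (\<forall>x\<in>Rvec d. \<forall>y\<in>Rvec d. \<bar>f x - f y\<bar> - c * dist_d d x y \<le> 0)"
  proof -
    have "(x \<noteq> y \<longrightarrow> \<bar>f x - f y\<bar> / dist_d d x y \<le> c) \<longleftrightarrow> \<bar>f x - f y\<bar> - c * dist_d d x y \<le> 0"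
      if "x \<in> Rvec d" "y \<in> Rvec d" for x y
      using dist_d_pos[OF that] by (cases "x = y") (auto simp: divide_le_eq dist_d_def)
    then show ?thesis by blast
  qed
  finally show "Lip d f \<le> c \<longleftrightarrow> (\<forall>p\<in>Rvec d \<times> Rvec d. \<bar>f (fst p) - f (snd p)\<bar> - c * dist_d d (fst p) (snd p) \<le> 0)"
    by auto
qed

lemma Lip_relu_net_bounded:
  assumes "1 \<le> L"
  obtains R where "\<And>x y. \<bar>relu_net d N L \<omega> x - relu_net d N L \<omega> y\<bar> \<le> R * dist_d d x y"
proof -
  let ?G = "grad_norm d N (\<lambda>j. fst \<omega> (L, 0, j))"
  have "finite (?G ` range (\<lambda>x. aff d N (fst \<omega>) (snd \<omega>) x L))" using card_range_aff by blast
  then have "?G (aff d N (fst \<omega>) (snd \<omega>) x L) \<le> Max (?G ` range (\<lambda>x. aff d N (fst \<omega>) (snd \<omega>) x L))" for x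
    by (intro Max_ge) auto
  then show ?thesis using relu_net_lipschitz[OF assms] that by blast
qed

lemma Lip_relu_net_nonneg: "1 \<le> L \<Longrightarrow> 0 \<le> Lip d (relu_net d N L \<omega>)"
  by (rule Lip_relu_net_bounded[of L d N \<omega>]) (auto intro: Lip_nonneg)

text \<open>The union bound over the pieces at the level of exponentials: the largest gradient norm
  is attained by one of the summands.\<close>

lemma exp_Lip_relu_net_le:
  assumes L: "1 \<le> L" and l: "0 \<le> l"
  shows "exp (l * Lip d (relu_net d N L \<omega>))
    \<le> (\<Sum>P\<in>range (\<lambda>x. aff d N (fst \<omega>) (snd \<omega>) x L). exp (l * grad_norm d N (\<lambda>j. fst \<omega> (L, 0, j)) P))"
proof -
  let ?G = "grad_norm d N (\<lambda>j. fst \<omega> (L, 0, j))"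
  let ?I = "range (\<lambda>x. aff d N (fst \<omega>) (snd \<omega>) x L)"
  have fin: "finite ?I" using card_range_aff by blast
  define R where "R = Max (?G ` ?I)"
  have "R \<in> ?G ` ?I" unfolding R_def using fin by (intro Max_in) auto
  then obtain P where P: "P \<in> ?I" "R = ?G P" by auto
  have R: "?G (aff d N (fst \<omega>) (snd \<omega>) x L) \<le> R" for x
    unfolding R_def using fin by (intro Max_ge) auto
  note lip = relu_net_lipschitz[OF L R]
  have "0 \<le> R" unfolding P by (simp add: grad_norm_def sum_nonneg)
  then have "Lip d (relu_net d N L \<omega>) \<le> R"
    using Lip_le_iff[of "relu_net d N L \<omega>", OF lip] lip by force
  then have "exp (l * Lip d (relu_net d N L \<omega>)) \<le> exp (l * ?G P)"
    using l P by (simp add: mult_left_mono)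
  also have "\<dots> \<le> (\<Sum>P\<in>?I. exp (l * ?G P))"
    using fin P by (intro member_le_sum) auto
  finally show ?thesis .
qed

section \<open>The random network\<close>

lemma (in product_sigma_finite) nn_integral_PiM_prod_factor:
  fixes B :: "nat \<Rightarrow> 'i set"
  assumes fin: "\<And>l. l < n \<Longrightarrow> finite (B l)" and disj: "\<And>l l'. l < l' \<Longrightarrow> l' < n \<Longrightarrow> B l \<inter> B l' = {}"
    and f: "\<And>l. l < n \<Longrightarrow> f l \<in> borel_measurable (PiM (B l) M)"
      "\<And>l z z'. l < n \<Longrightarrow> (\<And>i. i \<in> B l \<Longrightarrow> z i = z' i) \<Longrightarrow> f l z = f l z'"
  shows "(\<integral>\<^sup>+z. (\<Prod>l<n. f l z) \<partial>PiM (\<Union>l<n. B l) M) = (\<Prod>l<n. \<integral>\<^sup>+z. f l z \<partial>PiM (B l) M)"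
  using assms
proof (induction n)
  case 0
  show ?case by (simp add: space_PiM)
next
  case (Suc n)
  let ?U = "\<Union>l<n. B l"
  have "(\<integral>\<^sup>+z. (\<Prod>l<Suc n. f l z) \<partial>PiM (\<Union>l<Suc n. B l) M) = (\<integral>\<^sup>+z. (\<Prod>l<n. f l z) * f n z \<partial>PiM (?U \<union> B n) M)"
    by (simp add: lessThan_Suc Un_commute mult.commute)
  also have "\<dots> = (\<integral>\<^sup>+z. (\<Prod>l<n. f l z) \<partial>PiM ?U M) * (\<integral>\<^sup>+z. f n z \<partial>PiM (B n) M)"
  proof (rule nn_integral_PiM_factor)
    show "?U \<inter> B n = {}" using Suc.prems(2) by auto
    have "f l \<in> borel_measurable (PiM ?U M)" if "l < n" for l
      by (rule measurable_PiM_lift[OF Suc.prems(3) _ Suc.prems(4)]) (use that in auto)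
    then show "(\<lambda>z. \<Prod>l<n. f l z) \<in> borel_measurable (PiM ?U M)"
      by (intro borel_measurable_prod_ennreal) auto
    show "(\<Prod>l<n. f l z) = (\<Prod>l<n. f l z')" if "\<And>i. i \<in> ?U \<Longrightarrow> z i = z' i" for z z'
      using that by (intro prod.cong refl Suc.prems(4)) auto
    show "f n z = f n z'" if "\<And>i. i \<in> B n \<Longrightarrow> z i = z' i" for z z'
      using that by (intro Suc.prems(4)) auto
  qed (use Suc.prems(1,3) in auto)
  also have "(\<integral>\<^sup>+z. (\<Prod>l<n. f l z) \<partial>PiM ?U M) = (\<Prod>l<n. \<integral>\<^sup>+z. f l z \<partial>PiM (B l) M)"
  proof (rule Suc.IH)
    fix l assume l: "l < n"
    show "finite (B l)" "f l \<in> borel_measurable (PiM (B l) M)" using Suc.prems(1,3) l by auto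
    show "f l z = f l z'" if "\<And>i. i \<in> B l \<Longrightarrow> z i = z' i" for z z'
      using l by (intro Suc.prems(4)[OF _ that]) auto
  qed (use Suc.prems(2) in auto)
  also have "(\<Prod>l<n. \<integral>\<^sup>+z. f l z \<partial>PiM (B l) M) * (\<integral>\<^sup>+z. f n z \<partial>PiM (B n) M) = (\<Prod>l<Suc n. \<integral>\<^sup>+z. f l z \<partial>PiM (B l) M)"
    by simp
  finally show ?case .
qed

lemma prod_mono_ennreal:
  fixes f g :: "'a \<Rightarrow> ennreal"
  assumes "\<And>i. i \<in> I \<Longrightarrow> f i \<le> g i"
  shows "prod f I \<le> prod g I"
  using assms by (induction I rule: infinite_finite_induct) (auto intro!: mult_mono)

lemma weight_dist_eq: "weight_dist N L (l, i, j) = (if l = L then gauss 1 else gauss (sqrt (2 / real N)))"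
  by (simp add: weight_dist_def gauss_def)

lemma sets_weight_dist [simp, measurable_cong]: "sets (weight_dist N L p) = sets borel"
  by (cases p) (simp add: weight_dist_eq)

lemma prob_space_weight_dist: "0 < N \<Longrightarrow> prob_space (weight_dist N L p)"
  by (cases p) (simp add: weight_dist_eq prob_space_gauss)

definition hidden_idx :: "nat \<Rightarrow> nat \<Rightarrow> nat \<Rightarrow> (nat \<times> nat \<times> nat) set" where
  "hidden_idx d N L = (\<Union>l<L. blk l N (in_dim d N l))"

lemma weight_idx_eq: "weight_idx d N L = hidden_idx d N L \<union> blk L 1 N"
  by (auto simp: weight_idx_def hidden_idx_def blk_def)

lemma finite_hidden_idx [simp]: "finite (hidden_idx d N L)"
  by (simp add: hidden_idx_def)

lemma hidden_idx_disjoint: "hidden_idx d N L \<inter> blk L 1 N = {}"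
  by (auto simp: hidden_idx_def blk_def)

lemma PiM_hidden_block:
  "l < L \<Longrightarrow> PiM (blk l m n) (weight_dist N L) = PiM (blk l m n) (\<lambda>_. gauss (sqrt (2 / real N)))"
  by (rule PiM_cong) (auto simp: blk_def weight_dist_eq)

lemma PiM_output_block: "PiM (blk L m n) (weight_dist N L) = PiM (blk L m n) (\<lambda>_. gauss 1)"
  by (rule PiM_cong) (auto simp: blk_def weight_dist_eq)

section \<open>The product space of the parameters and measurability\<close>

locale relu_setting =
  fixes d N L :: nat and D :: "nat \<Rightarrow> nat \<Rightarrow> real measure"
  assumes d: "1 \<le> d" and L: "1 \<le> L" and N: "d + 2 < N"
    and D: "\<And>l i. (l, i) \<in> bias_idx N L \<Longrightarrow> prob_space (D l i) \<and> sets (D l i) = sets borel"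
begin

abbreviation "PW \<equiv> PiM (weight_idx d N L) (weight_dist N L)"
abbreviation "PH \<equiv> PiM (hidden_idx d N L) (weight_dist N L)"
abbreviation "PO \<equiv> PiM (blk L 1 N) (weight_dist N L)"
abbreviation "PB \<equiv> PiM (bias_idx N L) (\<lambda>(l, i). D l i)"
abbreviation "\<sigma> \<equiv> sqrt (2 / real N)"

lemma pos: "0 < N" "0 < d" "0 < in_dim d N l" and \<sigma>: "0 < \<sigma>"
  using d N by (auto simp: in_dim_def)

sublocale W: product_sigma_finite "weight_dist N L"
  using pos by (simp add: product_sigma_finite_def prob_space_weight_dist prob_space_imp_sigma_finite)

lemma prob_spaces: "prob_space PW" "prob_space PH" "prob_space PO" "prob_space PB"
  using pos D by (auto intro!: prob_space_PiM simp: prob_space_weight_dist split: prod.splits)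

lemma measure_eq: "relu_net_measure d N L D = PW \<Otimes>\<^sub>M PB"
  by (simp add: relu_net_measure_def)

lemma measurable_weight:
  "p \<in> weight_idx d N L \<Longrightarrow> (\<lambda>\<omega>. fst \<omega> p) \<in> borel_measurable (PW \<Otimes>\<^sub>M PB)"
  by (rule measurable_compose[OF measurable_fst])
    (use measurable_component_singleton[of p "weight_idx d N L" "weight_dist N L"] in simp)

lemma measurable_bias:
  "(l, i) \<in> bias_idx N L \<Longrightarrow> (\<lambda>\<omega>. snd \<omega> (l, i)) \<in> borel_measurable (PW \<Otimes>\<^sub>M PB)"
  by (rule measurable_compose[OF measurable_snd])
    (use measurable_component_singleton[of "(l, i)" "bias_idx N L" "\<lambda>(l, i). D l i"] D in
      \<open>simp cong: measurable_cong_sets\<close>)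

lemma measurable_hidden:
  "l \<le> L \<Longrightarrow> (\<lambda>\<omega>. hidden d N (fst \<omega>) (snd \<omega>) x l i) \<in> borel_measurable (PW \<Otimes>\<^sub>M PB)"
proof (induction l arbitrary: i)
  case (Suc l)
  show ?case
  proof (cases "i < N")
    case True
    have "(\<lambda>\<omega>. (\<Sum>j<in_dim d N l. fst \<omega> (l, i, j) * hidden d N (fst \<omega>) (snd \<omega>) x l j) + snd \<omega> (l, i))
        \<in> borel_measurable (PW \<Otimes>\<^sub>M PB)"
      using Suc True
      by (intro borel_measurable_add borel_measurable_sum borel_measurable_times measurable_weight measurable_bias)
        (auto simp: weight_idx_def bias_idx_def)
    then show ?thesis using True by (simp add: relu_def)
  qed simp
qed simp

lemma measurable_relu_net: "(\<lambda>\<omega>. relu_net d N L \<omega> x) \<in> borel_measurable (PW \<Otimes>\<^sub>M PB)"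
  unfolding relu_net_def
  by (intro borel_measurable_add borel_measurable_sum borel_measurable_times measurable_weight measurable_bias measurable_hidden)
    (auto simp: weight_idx_def bias_idx_def)

lemma measurable_Lip: "(\<lambda>\<omega>. Lip d (relu_net d N L \<omega>)) \<in> borel_measurable (PW \<Otimes>\<^sub>M PB)"
proof (subst borel_measurable_iff_le, intro allI)
  fix a :: real
  show "{\<omega> \<in> space (PW \<Otimes>\<^sub>M PB). Lip d (relu_net d N L \<omega>) \<le> a} \<in> sets (PW \<Otimes>\<^sub>M PB)"
  \<comment> \<open>The pairwise description of the sublevel set is valid for nonnegative levels;
    below zero the set is empty.\<close>
  proof (cases "0 \<le> a")
    case True
    have "Lip d (relu_net d N L \<omega>) \<le> a \<longleftrightarrow> (\<forall>p\<in>Rvec d \<times> Rvec d.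
        \<bar>relu_net d N L \<omega> (fst p) - relu_net d N L \<omega> (snd p)\<bar> - a * dist_d d (fst p) (snd p) \<le> 0)" for \<omega>
      by (rule Lip_relu_net_bounded[OF L, of d N \<omega>]) (rule Lip_le_iff[OF _ True], blast)
    moreover have "{\<omega> \<in> space (PW \<Otimes>\<^sub>M PB). \<forall>p\<in>Rvec d \<times> Rvec d.
        \<bar>relu_net d N L \<omega> (fst p) - relu_net d N L \<omega> (snd p)\<bar> - a * dist_d d (fst p) (snd p) \<le> 0} \<in> sets (PW \<Otimes>\<^sub>M PB)"
    proof (rule sets_Ball_continuous_le)
      fix \<omega> :: "(nat \<times> nat \<times> nat \<Rightarrow> real) \<times> (nat \<times> nat \<Rightarrow> real)"
      have c: "continuous_on UNIV (\<lambda>p :: (nat \<Rightarrow> real) \<times> (nat \<Rightarrow> real). f (fst p))"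
        "continuous_on UNIV (\<lambda>p :: (nat \<Rightarrow> real) \<times> (nat \<Rightarrow> real). f (snd p))"
        if "continuous_on UNIV f" for f :: "(nat \<Rightarrow> real) \<Rightarrow> real"
        by (rule continuous_on_compose2[OF that continuous_on_fst[OF continuous_on_id]], simp,
            rule continuous_on_compose2[OF that continuous_on_snd[OF continuous_on_id]], simp)
      show "continuous_on UNIV (\<lambda>p. \<bar>relu_net d N L \<omega> (fst p) - relu_net d N L \<omega> (snd p)\<bar> - a * dist_d d (fst p) (snd p))"
        unfolding dist_d_def by (intro continuous_intros c continuous_on_relu_net continuous_on_product_coordinates)
    next
      fix p :: "(nat \<Rightarrow> real) \<times> (nat \<Rightarrow> real)"
      show "(\<lambda>\<omega>. \<bar>relu_net d N L \<omega> (fst p) - relu_net d N L \<omega> (snd p)\<bar> - a * dist_d d (fst p) (snd p)) \<in> borel_measurable (PW \<Otimes>\<^sub>M PB)"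
        by (intro borel_measurable_diff borel_measurable_abs measurable_relu_net) simp
    qed
    ultimately show ?thesis by simp
  next
    case False
    then have "{\<omega> \<in> space (PW \<Otimes>\<^sub>M PB). Lip d (relu_net d N L \<omega>) \<le> a} = {}"
      using Lip_relu_net_nonneg[OF L, of d N] by (auto intro: order_trans)
    then show ?thesis by (metis sets.empty_sets)
  qed
qed

text \<open>The output weights are innermost: with \<open>b\<close> and the hidden weights
  \<open>V\<close> fixed, the affine pieces are deterministic.\<close>

lemma nn_integral_split:
  assumes f: "f \<in> borel_measurable (PW \<Otimes>\<^sub>M PB)"
  shows "(\<integral>\<^sup>+\<omega>. f \<omega> \<partial>(PW \<Otimes>\<^sub>M PB)) =
    (\<integral>\<^sup>+b. \<integral>\<^sup>+V. \<integral>\<^sup>+w. f (merge (hidden_idx d N L) (blk L 1 N) (V, w), b) \<partial>PO \<partial>PH \<partial>PB)"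
proof -
  interpret PW: prob_space PW by (rule prob_spaces)
  interpret PB: prob_space PB by (rule prob_spaces)
  interpret P: pair_sigma_finite PW PB ..
  have "(\<integral>\<^sup>+\<omega>. f \<omega> \<partial>(PW \<Otimes>\<^sub>M PB)) = (\<integral>\<^sup>+b. \<integral>\<^sup>+V. f (V, b) \<partial>PW \<partial>PB)"
    by (rule P.nn_integral_snd[OF f, symmetric])
  also have "\<dots> = (\<integral>\<^sup>+b. \<integral>\<^sup>+V. \<integral>\<^sup>+w. f (merge (hidden_idx d N L) (blk L 1 N) (V, w), b) \<partial>PO \<partial>PH \<partial>PB)"
  proof (rule nn_integral_cong)
    fix b assume b: "b \<in> space PB"
    have "(\<lambda>V. f (V, b)) \<in> borel_measurable PW"
      by (rule measurable_compose[OF measurable_Pair2'[OF b] f])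
    then show "(\<integral>\<^sup>+V. f (V, b) \<partial>PW) = (\<integral>\<^sup>+V. \<integral>\<^sup>+w. f (merge (hidden_idx d N L) (blk L 1 N) (V, w), b) \<partial>PO \<partial>PH)"
      unfolding weight_idx_eq by (intro W.product_nn_integral_fold hidden_idx_disjoint) auto
  qed
  finally show ?thesis .
qed

lemma measurable_merge_output:
  assumes "V \<in> space PH" "b \<in> space PB"
  shows "(\<lambda>w. (merge (hidden_idx d N L) (blk L 1 N) (V, w), b)) \<in> measurable PO (PW \<Otimes>\<^sub>M PB)"
proof (rule measurable_Pair)
  show "(\<lambda>w. merge (hidden_idx d N L) (blk L 1 N) (V, w)) \<in> measurable PO PW"
    unfolding weight_idx_eq by (rule measurable_compose[OF measurable_Pair1'[OF assms(1)] measurable_merge])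
qed (use assms in simp)

section \<open>Tail and mean of the norm of one layer\<close>

lemma layer_norm_cong:
  assumes "\<And>p. p \<in> blk l N (in_dim d N l) \<Longrightarrow> z p = z' p"
  shows "layer_norm d N z l = layer_norm d N z' l"
proof -
  have "bil N (in_dim d N l) (\<lambda>i j. z (l, i, j)) u v = bil N (in_dim d N l) (\<lambda>i j. z' (l, i, j)) u v" for u v
    unfolding bil_def using assms by (intro sum.cong refl) (auto simp: blk_def)
  then show ?thesis by (simp add: layer_norm_def opn_def)
qed

lemma layer_norm_nonneg: "0 \<le> layer_norm d N z l"
  unfolding layer_norm_def using pos by (intro opn_nonneg)

lemma measurable_layer_norm:
  "(\<lambda>z. layer_norm d N z l) \<in> borel_measurable (PiM (blk l N (in_dim d N l)) (weight_dist N L))"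
  unfolding layer_norm_def
proof (rule measurable_opn)
  fix i j assume "i < N" "j < in_dim d N l"
  then show "(\<lambda>z. z (l, i, j)) \<in> borel_measurable (PiM (blk l N (in_dim d N l)) (weight_dist N L))"
    using measurable_component_singleton[of "(l, i, j)" "blk l N (in_dim d N l)" "weight_dist N L"]
    by (simp add: blk_def)
qed (use pos in auto)

lemma layer_norm_mgf:
  assumes "l < L" "0 \<le> t"
  shows "(\<integral>\<^sup>+z. exp (t * layer_norm d N z l) \<partial>PiM (blk l N (in_dim d N l)) (weight_dist N L))
    \<le> ennreal (exp (t * (\<sigma> * (sqrt N + sqrt (in_dim d N l))) + t\<^sup>2 * \<sigma>\<^sup>2 / 2))"
  unfolding PiM_hidden_block[OF assms(1)] layer_norm_def
  using gaussian_opn_mgf[OF \<sigma> assms(2) pos(1,3), of l l] by (simp only: mult.assoc)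

lemma prob_space_block: "prob_space (PiM (blk l m n) (weight_dist N L))"
  using pos by (intro prob_space_PiM prob_space_weight_dist)

lemma layer_norm_tail:
  assumes "l < L" "0 \<le> t"
  shows "ennreal (1 - exp (- t\<^sup>2 / 2)) \<le> emeasure (PiM (blk l N (in_dim d N l)) (weight_dist N L))
    {z \<in> space (PiM (blk l N (in_dim d N l)) (weight_dist N L)). layer_norm d N z l \<le> \<sigma> * (sqrt N + sqrt (in_dim d N l) + t)}"
  using chernoff_subgaussian[OF prob_space_block measurable_layer_norm[of l] \<sigma> assms(2), where k = 1
      and c = "\<sigma> * (sqrt N + sqrt (in_dim d N l))"] layer_norm_mgf[OF assms(1)]
  by (simp add: distrib_left)

lemma nn_integral_layer_norm_le:
  assumes "l < L"
  shows "(\<integral>\<^sup>+z. layer_norm d N z l \<partial>PiM (blk l N (in_dim d N l)) (weight_dist N L))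
    \<le> ennreal (\<sigma> * (sqrt N + sqrt (in_dim d N l)))"
proof (rule ennreal_le_epsilon)
  fix e :: real assume e: "0 < e"
  let ?c = "\<sigma> * (sqrt N + sqrt (in_dim d N l))"
  \<comment> \<open>Chosen so that the variance term, after division by \<open>t\<close>,
    contributes exactly \<open>e\<close>. Letting \<open>e\<close> vanish gives the sharp
    mean.\<close>
  define t where "t = 2 * e / \<sigma>\<^sup>2"
  have t: "0 < t" using e \<sigma> by (simp add: t_def)
  have c: "0 \<le> ?c" using \<sigma> by simp
  have "(\<integral>\<^sup>+z. layer_norm d N z l \<partial>PiM (blk l N (in_dim d N l)) (weight_dist N L))
      \<le> ennreal (ln (exp (t * ?c + t\<^sup>2 * \<sigma>\<^sup>2 / 2)) / t)"
    using t c \<sigma> layer_norm_mgf[OF assms, of t]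
    by (intro nn_integral_le_ln_mgf prob_space_block measurable_layer_norm layer_norm_nonneg) auto
  also have "ln (exp (t * ?c + t\<^sup>2 * \<sigma>\<^sup>2 / 2)) / t = ?c + e"
  proof -
    have "ln (exp (t * ?c + t\<^sup>2 * \<sigma>\<^sup>2 / 2)) / t = ?c + t * \<sigma>\<^sup>2 / 2"
      unfolding ln_exp using t by (simp add: add_divide_distrib power2_eq_square)
    also have "t * \<sigma>\<^sup>2 / 2 = e" using \<sigma> pos by (simp add: t_def)
    finally show ?thesis .
  qed
  also have "ennreal (?c + e) = ennreal ?c + ennreal e" using c e by (simp add: ennreal_plus)
  finally show "(\<integral>\<^sup>+z. layer_norm d N z l \<partial>PiM (blk l N (in_dim d N l)) (weight_dist N L)) \<le> ennreal ?c + ennreal e" .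
qed

lemma nn_integral_hidden_prod:
  assumes "\<And>l. l < L \<Longrightarrow> f l \<in> borel_measurable (PiM (blk l N (in_dim d N l)) (weight_dist N L))"
    "\<And>l z z'. l < L \<Longrightarrow> (\<And>i. i \<in> blk l N (in_dim d N l) \<Longrightarrow> z i = z' i) \<Longrightarrow> f l z = f l z'"
  shows "(\<integral>\<^sup>+z. (\<Prod>l<L. f l z) \<partial>PH) = (\<Prod>l<L. \<integral>\<^sup>+z. f l z \<partial>PiM (blk l N (in_dim d N l)) (weight_dist N L))"
  unfolding hidden_idx_def
proof (rule W.nn_integral_PiM_prod_factor)
  fix l assume l: "l < L"
  show "f l \<in> borel_measurable (PiM (blk l N (in_dim d N l)) (weight_dist N L))" by (rule assms(1)[OF l])
  show "f l z = f l z'" if "\<And>i. i \<in> blk l N (in_dim d N l) \<Longrightarrow> z i = z' i" for z z'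
    by (rule assms(2)[OF l that])
qed (auto simp: blk_def)

text \<open>The logarithm of the Sauer-Shelah bound on the number of affine pieces after
  \<open>L\<close> layers.\<close>

definition "entropy = real L * (real (d + 1) * ln (exp 1 * real N / real (d + 1)))"

lemma entropy: "1 \<le> ln (exp 1 * real N / real (d + 1))" "0 < entropy"
  "real ((\<Sum>j\<le>d+1. N choose j) ^ L) \<le> exp entropy"
proof -
  have "1 \<le> real N / real (d + 1)" using N by (simp add: field_simps)
  then have "exp 1 * 1 \<le> exp 1 * (real N / real (d + 1))" by (rule mult_left_mono) simp
  then have e: "exp (1::real) \<le> exp 1 * real N / real (d + 1)" by simp
  show "1 \<le> ln (exp 1 * real N / real (d + 1))"
    using ln_mono[OF e exp_gt_zero] by simp
  then show "0 < entropy" using L unfolding entropy_def by (intro mult_pos_pos) auto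
  have "real (\<Sum>j\<le>d+1. N choose j) \<le> (exp 1 * real N / real (d + 1)) ^ (d + 1)"
    using N by (intro sum_binomial_le) auto
  then have "real (\<Sum>j\<le>d+1. N choose j) ^ L \<le> ((exp 1 * real N / real (d + 1)) ^ (d + 1)) ^ L"
    by (rule power_mono) (rule of_nat_0_le_iff)
  also have "\<dots> = exp entropy"
  proof -
    have "exp 1 * real N / real (d + 1) > 0" using pos by simp
    then show ?thesis unfolding entropy_def by (simp only: exp_of_nat_mult exp_ln)
  qed
  finally show "real ((\<Sum>j\<le>d+1. N choose j) ^ L) \<le> exp entropy" by simp
qed

text \<open>Every piece has operator norm at most \<open>R\<close>, so each gradient has the same
  Gaussian moment bound and the sum over pieces costs the factor \<open>exp entropy\<close>.
  \<open>R\<close> is any positive upper bound because the product of the layer norms may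
  vanish.\<close>

lemma output_layer_mgf:
  assumes R: "0 < R" "(\<Prod>l<L. layer_norm d N V l) \<le> R" and t: "0 \<le> t"
  shows "(\<integral>\<^sup>+w. exp (t * Lip d (relu_net d N L (merge (hidden_idx d N L) (blk L 1 N) (V, w), b))) \<partial>PO)
    \<le> ennreal (exp entropy * exp (t * (R * sqrt d) + t\<^sup>2 * R\<^sup>2 / 2))"
proof -
  let ?m = "\<lambda>w. merge (hidden_idx d N L) (blk L 1 N) (V, w)"
  let ?I = "range (\<lambda>x. aff d N V b x L)"
  let ?B = "exp (t * R * sqrt d + t\<^sup>2 * R\<^sup>2 / 2)"
  have fin: "finite ?I" and card: "card ?I \<le> (\<Sum>j\<le>d+1. N choose j) ^ L"
    using card_range_aff[of d N V b L] by auto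
  have aff: "aff d N (?m w) b x L = aff d N V b x L" for w x
    by (rule aff_cong) (auto simp: merge_def hidden_idx_def blk_def)
  have out: "grad_norm d N (\<lambda>j. ?m w (L, 0, j)) P = sqrt (\<Sum>k<d. (\<Sum>i\<in>blk L 1 N. w i * fst P (snd (snd i)) k)\<^sup>2)" for w P
    unfolding grad_norm_def sum_blk
    by (auto simp: merge_def hidden_idx_def blk_def intro!: arg_cong[where f = sqrt] sum.cong)
  have bound: "(\<integral>\<^sup>+w. exp (t * grad_norm d N (\<lambda>j. ?m w (L, 0, j)) P) \<partial>PO) \<le> ennreal ?B" if "P \<in> ?I" for P
  proof -
    obtain x where P: "P = aff d N V b x L" using \<open>P \<in> ?I\<close> by auto
    have op: "(\<Sum>i\<in>blk L 1 N. (\<Sum>k<d. fst P (snd (snd i)) k * v k)\<^sup>2) \<le> R\<^sup>2 * (\<Sum>k<d. (v k)\<^sup>2)" for v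
    proof -
      have "sqrt (\<Sum>i<N. (\<Sum>k<d. fst P i k * v k)\<^sup>2) \<le> (\<Prod>l<L. layer_norm d N V l) * sqrt (\<Sum>k<d. (v k)\<^sup>2)"
        using norm_aff_le[OF pos(2,1), where l = L and W = V and b = b and x = x and v = v] L unfolding P by (simp add: in_dim_def)
      also have "\<dots> \<le> R * sqrt (\<Sum>k<d. (v k)\<^sup>2)"
        using R by (intro mult_right_mono) (auto simp: sum_nonneg)
      finally have "(sqrt (\<Sum>i<N. (\<Sum>k<d. fst P i k * v k)\<^sup>2))\<^sup>2 \<le> (R * sqrt (\<Sum>k<d. (v k)\<^sup>2))\<^sup>2"
        by (intro power_mono) (auto simp: sum_nonneg)
      then show ?thesis by (simp add: sum_blk power_mult_distrib sum_nonneg)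
    qed
    show ?thesis
      unfolding out PiM_output_block
      using nn_integral_gauss_exp_norm_matrix_le[OF finite_blk finite_lessThan R(1) t op] by simp
  qed
  have meas: "(\<lambda>w. ennreal (exp (t * grad_norm d N (\<lambda>j. ?m w (L, 0, j)) P))) \<in> borel_measurable PO" for P
  proof -
    have "(\<lambda>w. \<Sum>k<d. (\<Sum>i\<in>blk L 1 N. w i * fst P (snd (snd i)) k)\<^sup>2) \<in> borel_measurable PO"
      unfolding PiM_output_block
      by (intro borel_measurable_sum borel_measurable_power borel_measurable_times measurable_gauss_component) auto
    then show ?thesis unfolding out by measurable
  qed
  have le: "exp (t * Lip d (relu_net d N L (?m w, b))) \<le> (\<Sum>P\<in>?I. exp (t * grad_norm d N (\<lambda>j. ?m w (L, 0, j)) P))" for w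
    using exp_Lip_relu_net_le[OF L t, of d N "(?m w, b)"] unfolding fst_conv snd_conv aff .
  have "(\<integral>\<^sup>+w. exp (t * Lip d (relu_net d N L (?m w, b))) \<partial>PO)
      \<le> (\<integral>\<^sup>+w. (\<Sum>P\<in>?I. ennreal (exp (t * grad_norm d N (\<lambda>j. ?m w (L, 0, j)) P))) \<partial>PO)"
    using ennreal_leI[OF le] by (intro nn_integral_mono) (simp only: sum_ennreal exp_ge_zero)
  also have "\<dots> = (\<Sum>P\<in>?I. \<integral>\<^sup>+w. exp (t * grad_norm d N (\<lambda>j. ?m w (L, 0, j)) P) \<partial>PO)"
    by (rule nn_integral_sum) (rule meas)
  also have "\<dots> \<le> (\<Sum>P\<in>?I. ennreal ?B)" by (intro sum_mono bound)
  also have "\<dots> = ennreal (card ?I * ?B)" by (simp add: ennreal_mult' ennreal_of_nat_eq_real_of_nat)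
  also have "\<dots> \<le> ennreal (exp entropy * exp (t * (R * sqrt d) + t\<^sup>2 * R\<^sup>2 / 2))"
  proof (rule ennreal_leI)
    have "real (card ?I) \<le> exp entropy" using card entropy(3) of_nat_mono[OF card, where ?'a = real] by linarith
    then show "card ?I * ?B \<le> exp entropy * exp (t * (R * sqrt d) + t\<^sup>2 * R\<^sup>2 / 2)"
      by (simp add: mult.assoc mult_right_mono)
  qed
  finally show ?thesis .
qed

lemma prod_layers: "(\<Prod>l<L. g (in_dim d N l)) = g d * g N ^ (L - 1)" for g :: "nat \<Rightarrow> real"
proof -
  obtain k where k: "L = Suc k" using L by (cases L) auto
  show ?thesis unfolding k by (simp only: prod.lessThan_Suc_shift) (simp add: in_dim_def)
qed

lemma output_layer_mean:
  assumes R: "0 < R" "(\<Prod>l<L. layer_norm d N V l) \<le> R" and V: "V \<in> space PH" "b \<in> space PB"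
  shows "(\<integral>\<^sup>+w. Lip d (relu_net d N L (merge (hidden_idx d N L) (blk L 1 N) (V, w), b)) \<partial>PO)
    \<le> ennreal (R * (sqrt d + sqrt (2 * entropy)))"
proof -
  define h where "h = sqrt (2 * entropy)"
  have h: "0 < h" "h * h = 2 * entropy" using entropy(2) by (auto simp: h_def)
  \<comment> \<open>This \<open>t\<close> minimises \<open>entropy / t + t * R^2 / 2\<close>, with
    minimum \<open>R * sqrt (2 * entropy)\<close>.\<close>
  define t where "t = h / R"
  have t: "0 < t" "t * R = h" using h R by (auto simp: t_def)
  let ?a = "exp entropy * exp (t * (R * sqrt d) + t\<^sup>2 * R\<^sup>2 / 2)"
  have "1 * 1 \<le> ?a" using entropy(2) t R by (intro mult_mono) auto
  then have "(\<integral>\<^sup>+w. Lip d (relu_net d N L (merge (hidden_idx d N L) (blk L 1 N) (V, w), b)) \<partial>PO) \<le> ennreal (ln ?a / t)"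
    using t R
    by (intro nn_integral_le_ln_mgf prob_spaces output_layer_mgf Lip_relu_net_nonneg[OF L]
        measurable_compose[OF measurable_merge_output[OF V] measurable_Lip]) auto
  also have "ln ?a / t = R * (sqrt d + h)"
  proof -
    have "ln ?a = entropy + (t * (R * sqrt d) + t\<^sup>2 * R\<^sup>2 / 2)" by (simp only: exp_add[symmetric] ln_exp)
    also have "\<dots> = entropy + ((t * R) * sqrt d + (t * R) * (t * R) / 2)"
      by (simp add: power2_eq_square)
    also have "\<dots> = h * (sqrt d + h)" unfolding t using h by (simp add: algebra_simps)
    finally have "ln ?a = h * (sqrt d + h)" .
    then show ?thesis using t R h by (simp add: t_def)
  qed
  finally show ?thesis by (simp add: h_def)
qed

lemma nn_integral_Lip_le:
  "(\<integral>\<^sup>+\<omega>. Lip d (relu_net d N L \<omega>) \<partial>(PW \<Otimes>\<^sub>M PB))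
    \<le> ennreal ((\<sigma> * (sqrt N + sqrt d)) * (\<sigma> * (sqrt N + sqrt N)) ^ (L - 1) * (sqrt d + sqrt (2 * entropy)))"
proof -
  let ?\<beta> = "sqrt d + sqrt (2 * entropy)"
  let ?\<Lambda> = "\<lambda>V. \<Prod>l<L. layer_norm d N V l"
  have \<beta>: "0 < ?\<beta>" using entropy(2) by (intro add_nonneg_pos) auto
  have \<Lambda>: "0 \<le> ?\<Lambda> V" for V by (intro prod_nonneg layer_norm_nonneg)
  interpret PB: prob_space PB by (rule prob_spaces)
  have mean: "(\<integral>\<^sup>+w. Lip d (relu_net d N L (merge (hidden_idx d N L) (blk L 1 N) (V, w), b)) \<partial>PO)
      \<le> ennreal ?\<beta> * (\<Prod>l<L. ennreal (layer_norm d N V l))" if V: "V \<in> space PH" "b \<in> space PB" for V b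
  proof -
    have "(\<integral>\<^sup>+w. Lip d (relu_net d N L (merge (hidden_idx d N L) (blk L 1 N) (V, w), b)) \<partial>PO) \<le> ennreal (?\<Lambda> V * ?\<beta>)"
    \<comment> \<open>The product of the norms may be zero, so the conditional mean is bounded with
      the product enlarged by \<open>e / ?\<beta>\<close>, which costs \<open>e\<close> in
      total.\<close>
    proof (rule ennreal_le_epsilon)
      fix e :: real assume e: "0 < e"
      have "(\<integral>\<^sup>+w. Lip d (relu_net d N L (merge (hidden_idx d N L) (blk L 1 N) (V, w), b)) \<partial>PO)
          \<le> ennreal ((?\<Lambda> V + e / ?\<beta>) * ?\<beta>)"
        using e \<beta> \<Lambda>[of V] by (intro output_layer_mean V add_nonneg_pos) auto
      also have "(?\<Lambda> V + e / ?\<beta>) * ?\<beta> = ?\<Lambda> V * ?\<beta> + e" using \<beta> by (simp add: distrib_right)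
      also have "ennreal \<dots> = ennreal (?\<Lambda> V * ?\<beta>) + ennreal e"
        using \<Lambda>[of V] \<beta> e by (intro ennreal_plus mult_nonneg_nonneg) auto
      finally show "(\<integral>\<^sup>+w. Lip d (relu_net d N L (merge (hidden_idx d N L) (blk L 1 N) (V, w), b)) \<partial>PO)
          \<le> ennreal (?\<Lambda> V * ?\<beta>) + ennreal e" .
    qed
    also have "\<dots> = ennreal ?\<beta> * (\<Prod>l<L. ennreal (layer_norm d N V l))"
      using \<beta> \<Lambda>[of V] by (simp add: prod_ennreal layer_norm_nonneg ennreal_mult mult.commute)
    finally show ?thesis .
  qed
  have "(\<integral>\<^sup>+\<omega>. Lip d (relu_net d N L \<omega>) \<partial>(PW \<Otimes>\<^sub>M PB))
      = (\<integral>\<^sup>+b. \<integral>\<^sup>+V. \<integral>\<^sup>+w. Lip d (relu_net d N L (merge (hidden_idx d N L) (blk L 1 N) (V, w), b)) \<partial>PO \<partial>PH \<partial>PB)"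
    by (rule nn_integral_split, rule measurable_compose[OF measurable_Lip]) simp
  also have "\<dots> \<le> (\<integral>\<^sup>+b. \<integral>\<^sup>+V. ennreal ?\<beta> * (\<Prod>l<L. ennreal (layer_norm d N V l)) \<partial>PH \<partial>PB)"
    by (intro nn_integral_mono mean)
  also have "\<dots> = (\<integral>\<^sup>+V. ennreal ?\<beta> * (\<Prod>l<L. ennreal (layer_norm d N V l)) \<partial>PH)"
    by (simp add: PB.emeasure_space_1)
  also have "\<dots> = ennreal ?\<beta> * (\<integral>\<^sup>+V. (\<Prod>l<L. ennreal (layer_norm d N V l)) \<partial>PH)"
  proof (rule nn_integral_cmult)
    have "(\<lambda>V. layer_norm d N V l) \<in> borel_measurable PH" if "l < L" for l
      by (rule measurable_PiM_lift[OF measurable_layer_norm _ layer_norm_cong]) (use that in \<open>auto simp: hidden_idx_def\<close>)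
    then show "(\<lambda>V. \<Prod>l<L. ennreal (layer_norm d N V l)) \<in> borel_measurable PH"
      by (intro borel_measurable_prod_ennreal) simp
  qed
  finally have 1: "(\<integral>\<^sup>+\<omega>. Lip d (relu_net d N L \<omega>) \<partial>(PW \<Otimes>\<^sub>M PB))
      \<le> ennreal ?\<beta> * (\<integral>\<^sup>+V. (\<Prod>l<L. ennreal (layer_norm d N V l)) \<partial>PH)" .
  have "(\<integral>\<^sup>+V. (\<Prod>l<L. ennreal (layer_norm d N V l)) \<partial>PH)
      = (\<Prod>l<L. \<integral>\<^sup>+z. layer_norm d N z l \<partial>PiM (blk l N (in_dim d N l)) (weight_dist N L))"
    using measurable_layer_norm by (intro nn_integral_hidden_prod arg_cong[where f = ennreal] layer_norm_cong) simp_all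
  also have "\<dots> \<le> (\<Prod>l<L. ennreal (\<sigma> * (sqrt N + sqrt (in_dim d N l))))"
    by (intro prod_mono_ennreal) (auto intro: nn_integral_layer_norm_le)
  also have "\<dots> = ennreal (\<Prod>l<L. \<sigma> * (sqrt N + sqrt (in_dim d N l)))"
    using \<sigma> by (intro prod_ennreal) auto
  also have "(\<Prod>l<L. \<sigma> * (sqrt N + sqrt (in_dim d N l))) = (\<sigma> * (sqrt N + sqrt d)) * (\<sigma> * (sqrt N + sqrt N)) ^ (L - 1)"
    by (rule prod_layers)
  finally have 2: "(\<integral>\<^sup>+V. (\<Prod>l<L. ennreal (layer_norm d N V l)) \<partial>PH)
      \<le> ennreal ((\<sigma> * (sqrt N + sqrt d)) * (\<sigma> * (sqrt N + sqrt N)) ^ (L - 1))" .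
  have "ennreal ?\<beta> * ennreal ((\<sigma> * (sqrt N + sqrt d)) * (\<sigma> * (sqrt N + sqrt N)) ^ (L - 1))
      = ennreal ((\<sigma> * (sqrt N + sqrt d)) * (\<sigma> * (sqrt N + sqrt N)) ^ (L - 1) * ?\<beta>)"
    using \<beta> by (subst ennreal_mult'[symmetric]) (auto simp only: mult.commute less_imp_le)
  then show ?thesis using order_trans[OF 1 mult_left_mono[OF 2 zero_le]] by (simp only:)
qed

lemma output_layer_tail:
  assumes R: "0 < R" "(\<Prod>l<L. layer_norm d N V l) \<le> R" and V: "V \<in> space PH" "b \<in> space PB" and u: "0 \<le> u"
  shows "ennreal (1 - exp (- u\<^sup>2)) \<le> emeasure PO {w \<in> space PO.
    Lip d (relu_net d N L (merge (hidden_idx d N L) (blk L 1 N) (V, w), b)) \<le> R * (sqrt d + sqrt (2 * entropy) + sqrt 2 * u)}"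
proof -
  \<comment> \<open>Half the square of \<open>?t\<close> is at least \<open>entropy + u^2\<close>:
    the first summand pays for the number of pieces and the second leaves the tail
    \<open>exp (- u^2)\<close>.\<close>
  let ?t = "sqrt (2 * entropy) + sqrt 2 * u"
  have t: "0 \<le> ?t" using entropy(2) u by simp
  have "2 * entropy + 2 * u\<^sup>2 \<le> ?t\<^sup>2"
    using entropy(2) u by (simp add: power2_sum power_mult_distrib)
  then have "exp entropy * exp (- ?t\<^sup>2 / 2) \<le> exp (- u\<^sup>2)"
    by (simp add: exp_add[symmetric])
  then have "ennreal (1 - exp (- u\<^sup>2)) \<le> ennreal (1 - exp entropy * exp (- ?t\<^sup>2 / 2))"
    by (intro ennreal_leI) simp
  also have "\<dots> \<le> emeasure PO {w \<in> space PO.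
      Lip d (relu_net d N L (merge (hidden_idx d N L) (blk L 1 N) (V, w), b)) \<le> R * sqrt d + R * ?t}"
    using entropy(2) R t
    by (intro chernoff_subgaussian prob_spaces output_layer_mgf
        measurable_compose[OF measurable_merge_output[OF V] measurable_Lip]) auto
  finally show ?thesis by (simp add: distrib_left add.assoc)
qed

text \<open>On the event that every layer norm is below its threshold, the conditional probability
  over the output weights is at least \<open>1 - exp (- u^2)\<close>. The layer events are
  independent, so their probabilities multiply.\<close>

lemma measure_Lip_ge:
  assumes u: "0 \<le> u" and t: "0 \<le> t"
  shows "(1 - exp (- u\<^sup>2)) * (1 - exp (- t\<^sup>2 / 2)) ^ L \<le> measure (PW \<Otimes>\<^sub>M PB) {\<omega> \<in> space (PW \<Otimes>\<^sub>M PB).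
    Lip d (relu_net d N L \<omega>) \<le> (\<sigma> * (sqrt N + sqrt d + t)) * (\<sigma> * (sqrt N + sqrt N + t)) ^ (L - 1)
      * (sqrt d + sqrt (2 * entropy) + sqrt 2 * u)}"
proof -
  let ?\<rho> = "\<lambda>n. \<sigma> * (sqrt N + sqrt n + t)"
  define R where "R = (\<Prod>l<L. ?\<rho> (in_dim d N l))"
  have \<rho>: "0 < ?\<rho> n" for n :: nat using \<sigma> pos t by (intro mult_pos_pos add_pos_nonneg) auto
  have R: "0 < R" unfolding R_def using \<rho> by (intro prod_pos) auto
  have R': "R = ?\<rho> d * ?\<rho> N ^ (L - 1)" unfolding R_def by (rule prod_layers)
  let ?B = "R * (sqrt d + sqrt (2 * entropy) + sqrt 2 * u)"
  define A where "A = {\<omega> \<in> space (PW \<Otimes>\<^sub>M PB). Lip d (relu_net d N L \<omega>) \<le> ?B}"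
  have A: "A \<in> sets (PW \<Otimes>\<^sub>M PB)"
    unfolding A_def by (rule borel_measurable_iff_le[THEN iffD1, OF measurable_Lip, rule_format])
  interpret PW: prob_space PW by (rule prob_spaces)
  interpret PB: prob_space PB by (rule prob_spaces)
  interpret P: pair_prob_space PW PB ..
  \<comment> \<open>The layer events as \<open>ennreal\<close>-valued indicators. Their product
    vanishes as soon as one layer fails, so \<open>step\<close> below has content only on the good
    event.\<close>
  define g :: "nat \<Rightarrow> (nat \<times> nat \<times> nat \<Rightarrow> real) \<Rightarrow> ennreal"
    where "g l V = indicator {x. x \<le> ?\<rho> (in_dim d N l)} (layer_norm d N V l)" for l V
  have gm: "g l \<in> borel_measurable (PiM (blk l N (in_dim d N l)) (weight_dist N L))" for l
    unfolding g_def by (rule measurable_compose[OF measurable_layer_norm]) measurable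
  have gc: "g l z = g l z'" if "\<And>p. p \<in> blk l N (in_dim d N l) \<Longrightarrow> z p = z' p" for l z z'
    unfolding g_def by (simp only: layer_norm_cong[OF that])
  have step: "ennreal (1 - exp (- u\<^sup>2)) * (\<Prod>l<L. g l V)
      \<le> (\<integral>\<^sup>+w. indicator A (merge (hidden_idx d N L) (blk L 1 N) (V, w), b) \<partial>PO)"
    if V: "V \<in> space PH" "b \<in> space PB" for V b
  proof (cases "\<forall>l<L. layer_norm d N V l \<le> ?\<rho> (in_dim d N l)")
    case False
    then obtain l where "l < L" "\<not> layer_norm d N V l \<le> ?\<rho> (in_dim d N l)" by blast
    then have "(\<Prod>l<L. g l V) = 0" by (intro prod_zero bexI[of _ l]) (simp_all add: g_def)
    then show ?thesis by (simp only: mult_zero_right zero_le)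
  next
    case True
    let ?X = "\<lambda>w. Lip d (relu_net d N L (merge (hidden_idx d N L) (blk L 1 N) (V, w), b))"
    have m: "?X \<in> borel_measurable PO"
      by (rule measurable_compose[OF measurable_merge_output[OF V] measurable_Lip])
    have "(\<Prod>l<L. layer_norm d N V l) \<le> R"
      unfolding R_def using True by (intro prod_mono) (auto simp: layer_norm_nonneg)
    then have "ennreal (1 - exp (- u\<^sup>2)) \<le> emeasure PO {w \<in> space PO. ?X w \<le> ?B}"
      by (intro output_layer_tail R V u)
    also have "\<dots> = (\<integral>\<^sup>+w. indicator {w \<in> space PO. ?X w \<le> ?B} w \<partial>PO)"
      by (rule nn_integral_indicator[symmetric]) (rule borel_measurable_iff_le[THEN iffD1, OF m, rule_format])
    also have "\<dots> = (\<integral>\<^sup>+w. indicator A (merge (hidden_idx d N L) (blk L 1 N) (V, w), b) \<partial>PO)"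
      using measurable_space[OF measurable_merge_output[OF V]]
      by (intro nn_integral_cong) (auto simp: indicator_def A_def)
    finally have le: "ennreal (1 - exp (- u\<^sup>2))
      \<le> (\<integral>\<^sup>+w. indicator A (merge (hidden_idx d N L) (blk L 1 N) (V, w), b) \<partial>PO)" .
    have "(\<Prod>l<L. g l V) = 1" using True by (intro prod.neutral) (simp add: g_def)
    then show ?thesis using le by (simp only: mult_1_right)
  qed
  have "ennreal ((1 - exp (- u\<^sup>2)) * (1 - exp (- t\<^sup>2 / 2)) ^ L)
      = ennreal (1 - exp (- u\<^sup>2)) * (\<Prod>l<L. ennreal (1 - exp (- t\<^sup>2 / 2)))"
    by (simp add: ennreal_mult ennreal_power)
  also have "\<dots> \<le> ennreal (1 - exp (- u\<^sup>2)) * (\<Prod>l<L. \<integral>\<^sup>+z. g l z \<partial>PiM (blk l N (in_dim d N l)) (weight_dist N L))"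
  proof (intro mult_left_mono prod_mono_ennreal)
    fix l assume "l \<in> {..<L}"
    then have l: "l < L" by simp
    let ?P = "PiM (blk l N (in_dim d N l)) (weight_dist N L)"
    have "ennreal (1 - exp (- t\<^sup>2 / 2)) \<le> emeasure ?P {z \<in> space ?P. layer_norm d N z l \<le> ?\<rho> (in_dim d N l)}"
      by (rule layer_norm_tail[OF l t])
    also have "\<dots> = (\<integral>\<^sup>+z. indicator {z \<in> space ?P. layer_norm d N z l \<le> ?\<rho> (in_dim d N l)} z \<partial>?P)"
      by (rule nn_integral_indicator[symmetric])
        (rule borel_measurable_iff_le[THEN iffD1, OF measurable_layer_norm, rule_format])
    also have "\<dots> = (\<integral>\<^sup>+z. g l z \<partial>?P)"
      by (intro nn_integral_cong) (auto simp: g_def indicator_def)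
    finally show "ennreal (1 - exp (- t\<^sup>2 / 2)) \<le> (\<integral>\<^sup>+z. g l z \<partial>?P)" .
  qed simp_all
  also have "(\<Prod>l<L. \<integral>\<^sup>+z. g l z \<partial>PiM (blk l N (in_dim d N l)) (weight_dist N L)) = (\<integral>\<^sup>+V. (\<Prod>l<L. g l V) \<partial>PH)"
    by (rule nn_integral_hidden_prod[symmetric, OF gm gc])
  also have "ennreal (1 - exp (- u\<^sup>2)) * \<dots> = (\<integral>\<^sup>+V. ennreal (1 - exp (- u\<^sup>2)) * (\<Prod>l<L. g l V) \<partial>PH)"
  proof (rule nn_integral_cmult[symmetric])
    have "g l \<in> borel_measurable PH" if "l < L" for l
      by (rule measurable_PiM_lift[OF gm _ gc]) (use that in \<open>auto simp: hidden_idx_def\<close>)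
    then show "(\<lambda>V. \<Prod>l<L. g l V) \<in> borel_measurable PH" by (intro borel_measurable_prod_ennreal) simp
  qed
  also have "\<dots> = (\<integral>\<^sup>+b. \<integral>\<^sup>+V. ennreal (1 - exp (- u\<^sup>2)) * (\<Prod>l<L. g l V) \<partial>PH \<partial>PB)"
    by (simp add: PB.emeasure_space_1)
  also have "\<dots> \<le> (\<integral>\<^sup>+b. \<integral>\<^sup>+V. \<integral>\<^sup>+w. indicator A (merge (hidden_idx d N L) (blk L 1 N) (V, w), b) \<partial>PO \<partial>PH \<partial>PB)"
    by (intro nn_integral_mono step)
  also have "\<dots> = (\<integral>\<^sup>+\<omega>. indicator A \<omega> \<partial>(PW \<Otimes>\<^sub>M PB))"
    by (rule nn_integral_split[symmetric]) (rule borel_measurable_indicator[OF A])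
  also have "\<dots> = ennreal (measure (PW \<Otimes>\<^sub>M PB) A)"
    using A by (simp add: P.emeasure_eq_measure)
  finally have "(1 - exp (- u\<^sup>2)) * (1 - exp (- t\<^sup>2 / 2)) ^ L \<le> measure (PW \<Otimes>\<^sub>M PB) A"
    by (simp add: ennreal_le_iff)
  then show ?thesis unfolding A_def R' .
qed

text \<open>The variance \<open>2 / N\<close> turns the sharp norm bounds into the factors of the
  claim: the first layer has input dimension \<open>d\<close>, the others are square and give
  \<open>2 * sqrt 2\<close>.\<close>

lemma layer_scale:
  "\<sigma> * (sqrt N + sqrt d + t) = sqrt 2 * (1 + (sqrt d + t) / sqrt N)"
  "\<sigma> * (sqrt N + sqrt N + t) = 2 * sqrt 2 + sqrt 2 * t / sqrt N"
  using pos by (simp_all add: real_sqrt_divide field_simps)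

text \<open>The constant is \<open>3 = 1 + 2\<close>. Since \<open>?h \<ge> 1\<close>,
  \<open>sqrt d\<close> costs 1; since \<open>d + 1 \<le> 2 * d\<close>, the entropy term costs 2.
  The coefficient \<open>sqrt 2\<close> of \<open>u\<close> is below 3 as well.\<close>

lemma entropy_scale:
  assumes "0 \<le> u"
  shows "sqrt d + sqrt (2 * entropy) + sqrt 2 * u
    \<le> 3 * (sqrt L * sqrt (ln (exp 1 * real N / real (d + 1))) * (sqrt d + u))"
proof -
  let ?h = "sqrt L * sqrt (ln (exp 1 * real N / real (d + 1)))"
  have h: "1 \<le> ?h" using L entropy(1) mult_mono[of 1 "sqrt L" 1 "sqrt (ln (exp 1 * real N / real (d + 1)))"] by simp
  have "2 * entropy \<le> 4 * real d * (real L * ln (exp 1 * real N / real (d + 1)))"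
  proof -
    have "2 * real (d + 1) \<le> 4 * real d" using d by simp
    then have "2 * real (d + 1) * (real L * ln (exp 1 * real N / real (d + 1)))
        \<le> 4 * real d * (real L * ln (exp 1 * real N / real (d + 1)))"
      using entropy(1) by (intro mult_right_mono) auto
    then show ?thesis unfolding entropy_def by (simp only: mult.assoc mult.left_commute)
  qed
  then have "sqrt (2 * entropy) \<le> sqrt (4 * real d * (real L * ln (exp 1 * real N / real (d + 1))))"
    by (rule real_sqrt_le_mono)
  also have "\<dots> = 2 * (?h * sqrt d)" by (simp add: real_sqrt_mult)
  finally have 1: "sqrt (2 * entropy) \<le> 2 * (?h * sqrt d)" .
  have 2: "sqrt d \<le> ?h * sqrt d" using mult_right_mono[OF h, of "sqrt d"] by simp
  have "sqrt 2 \<le> 3" by (rule real_le_lsqrt) auto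
  then have "sqrt 2 * u \<le> 3 * (?h * u)"
    using mult_right_mono[OF h assms] mult_right_mono[of "sqrt 2" 3 u] assms by linarith
  then show ?thesis using 1 2 by (simp add: distrib_left)
qed

end

theorem theorem5p11:
  "\<exists>C c\<^sub>1 :: real. C > 0 \<and> c\<^sub>1 > 0 \<and>
     (\<forall>(d::nat) (N::nat) (L::nat) (D :: nat \<Rightarrow> nat \<Rightarrow> real measure).
        1 \<le> d \<longrightarrow> 1 \<le> L \<longrightarrow> d + 2 < N \<longrightarrow>
        (\<forall>l i. (l, i) \<in> bias_idx N L \<longrightarrow> prob_space (D l i) \<and> sets (D l i) = sets borel) \<longrightarrow>
        (let M = relu_net_measure d N L D in
           (\<forall>u t :: real. u \<ge> 0 \<longrightarrow> t \<ge> 0 \<longrightarrow>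
              measure M {\<omega> \<in> space M. Lip d (relu_net d N L \<omega>) \<le>
                 C * (1 + (sqrt d + t) / sqrt N) * (2 * sqrt 2 + sqrt 2 * t / sqrt N) ^ (L - 1)
                   * sqrt L * sqrt (ln (exp 1 * N / (d + 1))) * (sqrt d + u)}
              \<ge> pos_part (1 - 2 * exp (- (u^2))) * (pos_part (1 - 2 * exp (- c\<^sub>1 * t^2))) ^ L)
         \<and> (\<integral>\<^sup>+ \<omega>. ennreal (Lip d (relu_net d N L \<omega>)) \<partial>M)
              \<le> ennreal (C * (1 + sqrt d / sqrt N) * (2 * sqrt 2) ^ (L - 1) * sqrt L
                           * sqrt (ln (exp 1 * N / (d + 1))) * sqrt d)))"
proof (rule exI[of _ "3 * sqrt 2"], rule exI[of _ "1 / 2"], intro conjI allI impI)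
  \<comment> \<open>In \<open>C = 3 * sqrt 2\<close> the factor \<open>sqrt 2\<close> comes from the
    first layer and 3 from \<open>entropy_scale\<close>; \<open>1 / 2\<close> is the exponent of the
    tail of one layer norm.\<close>
  fix d N L :: nat and D :: "nat \<Rightarrow> nat \<Rightarrow> real measure"
  assume d: "1 \<le> d" and L: "1 \<le> L" and N: "d + 2 < N"
    and D: "\<forall>l i. (l, i) \<in> bias_idx N L \<longrightarrow> prob_space (D l i) \<and> sets (D l i) = sets borel"
  interpret relu_setting d N L D by standard (use d L N D in auto)
  let ?l = "sqrt (ln (exp 1 * N / (d + 1)))"
  interpret PW: prob_space PW by (rule prob_spaces)
  interpret PB: prob_space PB by (rule prob_spaces)
  interpret PP: pair_prob_space PW PB ..
  have bound: "sqrt 2 * (1 + (sqrt d + t) / sqrt N) * (2 * sqrt 2 + sqrt 2 * t / sqrt N) ^ (L - 1)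
        * (sqrt d + sqrt (2 * entropy) + sqrt 2 * u)
      \<le> 3 * sqrt 2 * (1 + (sqrt d + t) / sqrt N) * (2 * sqrt 2 + sqrt 2 * t / sqrt N) ^ (L - 1)
        * sqrt L * ?l * (sqrt d + u)" if ut: "0 \<le> u" "0 \<le> t" for u t
  proof -
    have "0 \<le> sqrt 2 * (1 + (sqrt d + t) / sqrt N) * (2 * sqrt 2 + sqrt 2 * t / sqrt N) ^ (L - 1)"
      using ut by (intro mult_nonneg_nonneg zero_le_power add_nonneg_nonneg) auto
    from mult_left_mono[OF entropy_scale[OF ut(1)] this] show ?thesis
      by (simp add: mult_ac add.commute)
  qed
  have tail: "pos_part (1 - 2 * exp (- (u^2))) * (pos_part (1 - 2 * exp (- (1 / 2) * t^2))) ^ L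
      \<le> measure (PW \<Otimes>\<^sub>M PB) {\<omega> \<in> space (PW \<Otimes>\<^sub>M PB). Lip d (relu_net d N L \<omega>) \<le>
        3 * sqrt 2 * (1 + (sqrt d + t) / sqrt N) * (2 * sqrt 2 + sqrt 2 * t / sqrt N) ^ (L - 1)
        * sqrt L * ?l * (sqrt d + u)}" if ut: "0 \<le> u" "0 \<le> t" for u t
  proof -
    \<comment> \<open>The one-sided tails hold with prefactor 1, so they imply the claimed ones with
      prefactor 2; the positive parts are absorbed because \<open>1 - exp\<close> of a nonpositive
      number is nonnegative.\<close>
    have "pos_part (1 - 2 * exp (- (u^2))) * (pos_part (1 - 2 * exp (- (1 / 2) * t^2))) ^ L
        \<le> (1 - exp (- u\<^sup>2)) * (1 - exp (- t\<^sup>2 / 2)) ^ L"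
      by (intro mult_mono power_mono zero_le_power) (auto simp: pos_part_def)
    also note measure_Lip_ge[OF ut]
    also have "measure (PW \<Otimes>\<^sub>M PB) {\<omega> \<in> space (PW \<Otimes>\<^sub>M PB). Lip d (relu_net d N L \<omega>) \<le>
        \<sigma> * (sqrt N + sqrt d + t) * (\<sigma> * (sqrt N + sqrt N + t)) ^ (L - 1) * (sqrt d + sqrt (2 * entropy) + sqrt 2 * u)}
      \<le> measure (PW \<Otimes>\<^sub>M PB) {\<omega> \<in> space (PW \<Otimes>\<^sub>M PB). Lip d (relu_net d N L \<omega>) \<le>
        3 * sqrt 2 * (1 + (sqrt d + t) / sqrt N) * (2 * sqrt 2 + sqrt 2 * t / sqrt N) ^ (L - 1)
        * sqrt L * ?l * (sqrt d + u)}"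
    proof (rule PP.P.finite_measure_mono)
      show "{\<omega> \<in> space (PW \<Otimes>\<^sub>M PB). Lip d (relu_net d N L \<omega>) \<le>
          3 * sqrt 2 * (1 + (sqrt d + t) / sqrt N) * (2 * sqrt 2 + sqrt 2 * t / sqrt N) ^ (L - 1)
          * sqrt L * ?l * (sqrt d + u)} \<in> sets (PW \<Otimes>\<^sub>M PB)"
        by (rule borel_measurable_iff_le[THEN iffD1, OF measurable_Lip, rule_format])
    qed (use bound[OF ut] in \<open>unfold layer_scale, auto intro: order_trans\<close>)
    finally show ?thesis .
  qed
  have mean: "(\<integral>\<^sup>+\<omega>. ennreal (Lip d (relu_net d N L \<omega>)) \<partial>(PW \<Otimes>\<^sub>M PB))
      \<le> ennreal (3 * sqrt 2 * (1 + sqrt d / sqrt N) * (2 * sqrt 2) ^ (L - 1) * sqrt L * ?l * sqrt d)"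
  proof (rule order_trans[OF nn_integral_Lip_le ennreal_leI])
    \<comment> \<open>The mean is compared through the inequality for the tail at
      \<open>u = t = 0\<close>.\<close>
    have scale: "\<sigma> * (sqrt N + sqrt d) = sqrt 2 * (1 + sqrt d / sqrt N)" "\<sigma> * (sqrt N + sqrt N) = 2 * sqrt 2"
      using layer_scale[of 0] by (simp_all only: add_0_right mult_zero_right div_0)
    show "\<sigma> * (sqrt N + sqrt d) * (\<sigma> * (sqrt N + sqrt N)) ^ (L - 1) * (sqrt d + sqrt (2 * entropy))
        \<le> 3 * sqrt 2 * (1 + sqrt d / sqrt N) * (2 * sqrt 2) ^ (L - 1) * sqrt L * ?l * sqrt d"
      unfolding scale using bound[of 0 0] by (simp only: add_0_right mult_zero_right div_0 order_refl)
  qed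
  show "let M = relu_net_measure d N L D in
           (\<forall>u t :: real. u \<ge> 0 \<longrightarrow> t \<ge> 0 \<longrightarrow>
              measure M {\<omega> \<in> space M. Lip d (relu_net d N L \<omega>) \<le>
                 3 * sqrt 2 * (1 + (sqrt d + t) / sqrt N) * (2 * sqrt 2 + sqrt 2 * t / sqrt N) ^ (L - 1)
                   * sqrt L * sqrt (ln (exp 1 * N / (d + 1))) * (sqrt d + u)}
              \<ge> pos_part (1 - 2 * exp (- (u^2))) * (pos_part (1 - 2 * exp (- (1 / 2) * t^2))) ^ L)
         \<and> (\<integral>\<^sup>+ \<omega>. ennreal (Lip d (relu_net d N L \<omega>)) \<partial>M)
              \<le> ennreal (3 * sqrt 2 * (1 + sqrt d / sqrt N) * (2 * sqrt 2) ^ (L - 1) * sqrt L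
                           * sqrt (ln (exp 1 * N / (d + 1))) * sqrt d)"
    unfolding measure_eq Let_def using tail mean by blast
qed simp_all

end
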